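(* Let $(M_1^{m_1},g_1)$ and $(M_2^{m_2},g_2)$, $m_1\ge1$, $m_2\ge0$, be Einstein manifolds with $m_2(m_2-1)\,\mathrm{Sc}(g_1)=-m_1(m_1-1)\,\mathrm{Sc}(g_2)$, and let $\mu\in\mathbb R$ satisfy $2m_1(m_1-1)\mu=\mathrm{Sc}(g_1)$ and $2m_2(m_2-1)\mu=-\mathrm{Sc}(g_2)$. Let $(\tilde M,\boldsymbol h)$ be the ambient manifold described in the context. Then the holonomy group of the $\mathcal Q$ connected component of the ambient manifold $\tilde M$ (the component containing $\mathcal Q$), with metric $\boldsymbol h$, is the same as the conformal holonomy of the underlying conformal manifold $(M_1\times M_2,[g_1\times g_2])$.
   Context: Metrics are pseudo-Riemannian; $M_i$ has dimension $m_i$, and $[g]$ denotes the conformal class of $g$. An $m$-manifold $(M,g)$ is Einstein if $\mathrm{Ric}(g)=\frac1m\mathrm{Sc}(g)\,g$ with scalar curvature $\mathrm{Sc}(g)$ constant; 1-manifolds are Einstein with $\mathrm{Sc}=0$, and $m_2=0$ corresponds to taking $M_2$ to be a point (with $\mathrm{Sc}(g_2)=0$ and the $g_2$ term absent). Ambient manifold: with $M=M_1\times M_2$, $g=g_1\times g_2$, let $\mathcal Q\to M$ be the $\mathbb R_+$-bundle of metrics conformally related to $g$, with fibre coordinate $t>0$ given by writing points as $(p,t^2g(p))$. Put $\tilde M=\mathcal Q\times\tilde I$, with $\tilde I=\mathbb R$ if $\mu=0$, $\tilde I=\mathbb R\setminus\{-1/\mu\}$ if $\mu\ne0$ and $m_2=0$,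 $\tilde I=\mathbb R\setminus\{1/\mu,-1/\mu\}$ otherwise; $\rho$ is the standard coordinate on $\tilde I$, $\mathcal Q$ is identified with $\mathcal Q\times\{0\}$, and $$\boldsymbol h=2t\,dt\,d\rho+2\rho\,dt^2+t^2\big[(1+\mu\rho)^2g_1+(1-\mu\rho)^2g_2\big],$$ where $g_1,g_2$ also denote their pull-backs to $\tilde M$. The holonomy of $\boldsymbol h$ is that of its Levi-Civita connection. Conformal holonomy is the holonomy group of the normal conformal tractor connection on the standard tractor bundle $\mathcal T$. Explicitly, for a conformal $n$-manifold with $n\ge3$, a choice of metric $g$ in the class identifies $\mathcal T$ with $\underline{\mathbb R}\oplus T^*M\oplus\underline{\mathbb R}$ (where $\underline{\mathbb R}=M\times\mathbb R$), and the normal tractor connection is $\nabla_a(\sigma,\mu_b,\tau)=(\nabla_a\sigma-\mu_a,\ \nabla_a\mu_b+P_{ab}\sigma+g_{ab}\tau,\ \nabla_a\tau-P_a{}^c\mu_c)$ with $P_{ab}=\frac1{n-2}(\mathrm{Ric}_{ab}-\frac{\mathrm{Sc}}{2(n-1)}g_{ab})$ and, on the right, $\nabla$ the Levi-Civita connection of $g$. With $\sigma^s(g_x)=s^2g_x$ the action of $s\in\mathbb R_+$ on $\mathcal Q$, $\mathcal T$ may be identified with the quotient of $T\tilde M|_{\mathcal Q}$ by the $\mathbb R_+$-action $\xi\mapsto s^{-1}\sigma^s_*\xi$, and under this identification ambient parallel transport induces the normal tractor connection; the two holonomy groups are compared through this identification. *)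

theory Defs
  imports "HOL-Analysis.Analysis"
begin

section \<open>Smooth manifolds\<close>

text \<open>
  The model space of dimension \<open>n\<close> is the library's \<^const>\<open>Euclidean_space\<close> \<open>n\<close>, i.e. the functions
  \<open>nat \<Rightarrow> real\<close> vanishing from index \<open>n\<close> on. It covers \<open>n = 0\<close>, and dimensions are ordinary natural
  numbers, so that they can be added.
\<close>

definition partial :: "nat \<Rightarrow> ((nat \<Rightarrow> real) \<Rightarrow> real) \<Rightarrow> (nat \<Rightarrow> real) \<Rightarrow> real" where
  "partial i f x = deriv (\<lambda>s. f (x(i := s))) (x i)"

text \<open>For \<open>V\<close> open in \<^const>\<open>Euclidean_space\<close> \<open>n\<close>.\<close>

fun Ck_on :: "nat \<Rightarrow> nat \<Rightarrow> (nat \<Rightarrow> real) set \<Rightarrow> ((nat \<Rightarrow> real) \<Rightarrow> real) \<Rightarrow> bool" where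
  "Ck_on n 0 V f \<longleftrightarrow> continuous_map (subtopology (Euclidean_space n) V) euclideanreal f"
| "Ck_on n (Suc k) V f \<longleftrightarrow>
     continuous_map (subtopology (Euclidean_space n) V) euclideanreal f \<and>
     (\<forall>i<n. (\<forall>x\<in>V. (\<lambda>s. f (x(i := s))) differentiable at (x i)) \<and> Ck_on n k V (partial i f))"

definition smooth_on :: "nat \<Rightarrow> (nat \<Rightarrow> real) set \<Rightarrow> ((nat \<Rightarrow> real) \<Rightarrow> real) \<Rightarrow> bool" where
  "smooth_on n V f \<longleftrightarrow> (\<forall>k. Ck_on n k V f)"

text \<open>The atlas is a family of charts indexed by labels of type \<open>'i\<close>: the chart labelled \<open>c\<close> is
  \<open>coord M c\<close> on \<open>cdom M c\<close>.\<close>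

record ('i, 'a) manifold =
  topo :: "'a topology"
  mdim :: nat
  charts :: "'i set"
  cdom :: "'i \<Rightarrow> 'a set"
  coord :: "'i \<Rightarrow> 'a \<Rightarrow> nat \<Rightarrow> real"

definition smooth_manifold :: "('i, 'a) manifold \<Rightarrow> bool" where
  "smooth_manifold M \<longleftrightarrow>
     Hausdorff_space (topo M) \<and> second_countable (topo M) \<and>
     topspace (topo M) = (\<Union>c\<in>charts M. cdom M c) \<and>
     (\<forall>c\<in>charts M.
        openin (topo M) (cdom M c) \<and>
        openin (Euclidean_space (mdim M)) (coord M c ` cdom M c) \<and>
        homeomorphic_map (subtopology (topo M) (cdom M c))
          (subtopology (Euclidean_space (mdim M)) (coord M c ` cdom M c)) (coord M c)) \<and>
     (\<forall>c\<in>charts M. \<forall>d\<in>charts M. \<forall>k<mdim M.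
        smooth_on (mdim M) (coord M c ` (cdom M c \<inter> cdom M d))
          (\<lambda>x. coord M d (inv_into (cdom M c) (coord M c) x) k))"

text \<open>\<open>pd M c i f p\<close> is \<open>\<partial>f/\<partial>x\<^sup>i\<close> at \<open>p\<close> in the coordinates of the chart \<open>c\<close>.\<close>

definition pd :: "('i, 'a) manifold \<Rightarrow> 'i \<Rightarrow> nat \<Rightarrow> ('a \<Rightarrow> real) \<Rightarrow> 'a \<Rightarrow> real" where
  "pd M c i f p = partial i (\<lambda>x. f (inv_into (cdom M c) (coord M c) x)) (coord M c p)"

text \<open>\<open>\<partial>x\<^sub>d\<^sup>k/\<partial>x\<^sub>c\<^sup>j\<close> at \<open>p\<close>.\<close>

definition jac :: "('i, 'a) manifold \<Rightarrow> 'i \<Rightarrow> 'i \<Rightarrow> 'a \<Rightarrow> nat \<Rightarrow> nat \<Rightarrow> real" where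
  "jac M c d p k j = pd M c j (\<lambda>q. coord M d q k) p"

text \<open>
  Tangent vectors, covectors and tensors are given by their components in all charts around the
  point, subject to the usual transformation laws. Components in irrelevant charts and with
  irrelevant indices are normalised to 0, so that equality of (co)vectors is equality in HOL.
\<close>

definition component_family :: "('i, 'a) manifold \<Rightarrow> 'a \<Rightarrow> ('i \<Rightarrow> nat \<Rightarrow> real) \<Rightarrow> bool" where
  "component_family M p X \<longleftrightarrow>
     (\<forall>c k. \<not> (c \<in> charts M \<and> p \<in> cdom M c \<and> k < mdim M) \<longrightarrow> X c k = 0)"

definition tangent_space :: "('i, 'a) manifold \<Rightarrow> 'a \<Rightarrow> ('i \<Rightarrow> nat \<Rightarrow> real) set" where
  "tangent_space M p = {X. component_family M p X \<and>
     (\<forall>c\<in>charts M. \<forall>d\<in>charts M. p \<in> cdom M c \<inter> cdom M d \<longrightarrow>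
        (\<forall>k<mdim M. X d k = (\<Sum>j<mdim M. jac M c d p k j * X c j)))}"

definition cotangent_space :: "('i, 'a) manifold \<Rightarrow> 'a \<Rightarrow> ('i \<Rightarrow> nat \<Rightarrow> real) set" where
  "cotangent_space M p = {\<omega>. component_family M p \<omega> \<and>
     (\<forall>c\<in>charts M. \<forall>d\<in>charts M. p \<in> cdom M c \<inter> cdom M d \<longrightarrow>
        (\<forall>j<mdim M. \<omega> c j = (\<Sum>k<mdim M. jac M c d p k j * \<omega> d k)))}"

text \<open>For \<open>W\<close> open in \<open>M\<close>.\<close>

definition open_submanifold :: "('i, 'a) manifold \<Rightarrow> 'a set \<Rightarrow> ('i, 'a) manifold" where
  "open_submanifold M W =
     M\<lparr>topo := subtopology (topo M) W, cdom := (\<lambda>c. cdom M c \<inter> W)\<rparr>"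

text \<open>The coordinates of the first factor precede those of the second.\<close>

definition prod_manifold ::
    "('i, 'a) manifold \<Rightarrow> ('j, 'b) manifold \<Rightarrow> ('i \<times> 'j, 'a \<times> 'b) manifold" where
  "prod_manifold M N =
     \<lparr>topo = prod_topology (topo M) (topo N),
      mdim = mdim M + mdim N,
      charts = charts M \<times> charts N,
      cdom = (\<lambda>(c, d). cdom M c \<times> cdom N d),
      coord = (\<lambda>(c, d) (p, q) k. if k < mdim M then coord M c p k else coord N d q (k - mdim M))\<rparr>"

text \<open>An open set of reals with its standard coordinate.\<close>

definition real_manifold :: "real set \<Rightarrow> (unit, real) manifold" where
  "real_manifold S =
     \<lparr>topo = subtopology euclideanreal S, mdim = 1, charts = {()}, cdom = (\<lambda>_. S),
      coord = (\<lambda>_ s k. if k = 0 then s else 0)\<rparr>"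


section \<open>Pseudo-Riemannian metrics and curvature\<close>

text \<open>\<open>g c p i j\<close> is the component \<open>g\<^sub>i\<^sub>j\<close> at \<open>p\<close> in the chart \<open>c\<close>.\<close>

type_synonym ('i, 'a) metric = "'i \<Rightarrow> 'a \<Rightarrow> nat \<Rightarrow> nat \<Rightarrow> real"

definition pseudo_riemannian :: "('i, 'a) manifold \<Rightarrow> ('i, 'a) metric \<Rightarrow> bool" where
  "pseudo_riemannian M g \<longleftrightarrow>
     (\<forall>c\<in>charts M.
        (\<forall>i<mdim M. \<forall>j<mdim M.
           smooth_on (mdim M) (coord M c ` cdom M c)
             (\<lambda>x. g c (inv_into (cdom M c) (coord M c) x) i j)) \<and>
        (\<forall>p\<in>cdom M c.
           (\<forall>i<mdim M. \<forall>j<mdim M. g c p i j = g c p j i) \<and>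
           (\<forall>v::nat \<Rightarrow> real. (\<forall>i<mdim M. (\<Sum>j<mdim M. g c p i j * v j) = 0) \<longrightarrow>
              (\<forall>j<mdim M. v j = 0)))) \<and>
     (\<forall>c\<in>charts M. \<forall>d\<in>charts M. \<forall>p\<in>cdom M c \<inter> cdom M d. \<forall>i<mdim M. \<forall>j<mdim M.
        g c p i j = (\<Sum>k<mdim M. \<Sum>l<mdim M. jac M c d p k i * jac M c d p l j * g d p k l))"

definition inverse_matrix :: "nat \<Rightarrow> (nat \<Rightarrow> nat \<Rightarrow> real) \<Rightarrow> nat \<Rightarrow> nat \<Rightarrow> real" where
  "inverse_matrix n A = (THE B.
     (\<forall>i<n. \<forall>k<n. (\<Sum>j<n. A i j * B j k) = (if i = k then 1 else 0)) \<and>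
     (\<forall>i j. \<not> (i < n \<and> j < n) \<longrightarrow> B i j = 0))"

text \<open>\<open>christoffel M g c p k i j\<close> is \<open>\<Gamma>\<^sup>k\<^sub>i\<^sub>j\<close> of the Levi-Civita connection.\<close>

definition christoffel ::
    "('i, 'a) manifold \<Rightarrow> ('i, 'a) metric \<Rightarrow> 'i \<Rightarrow> 'a \<Rightarrow> nat \<Rightarrow> nat \<Rightarrow> nat \<Rightarrow> real" where
  "christoffel M g c p k i j =
     (\<Sum>l<mdim M. inverse_matrix (mdim M) (g c p) k l *
        (pd M c i (\<lambda>q. g c q j l) p + pd M c j (\<lambda>q. g c q i l) p - pd M c l (\<lambda>q. g c q i j) p)) / 2"

text \<open>Sign convention: positive on round spheres.\<close>

definition ricci ::
    "('i, 'a) manifold \<Rightarrow> ('i, 'a) metric \<Rightarrow> 'i \<Rightarrow> 'a \<Rightarrow> nat \<Rightarrow> nat \<Rightarrow> real" where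
  "ricci M g c p i j =
     (\<Sum>k<mdim M.
        pd M c k (\<lambda>q. christoffel M g c q k i j) p - pd M c j (\<lambda>q. christoffel M g c q k k i) p +
        (\<Sum>l<mdim M. christoffel M g c p k k l * christoffel M g c p l i j
                    - christoffel M g c p k j l * christoffel M g c p l k i))"

definition scalar_curvature :: "('i, 'a) manifold \<Rightarrow> ('i, 'a) metric \<Rightarrow> 'i \<Rightarrow> 'a \<Rightarrow> real" where
  "scalar_curvature M g c p =
     (\<Sum>i<mdim M. \<Sum>j<mdim M. inverse_matrix (mdim M) (g c p) i j * ricci M g c p i j)"

text \<open>
  \<open>(M, g)\<close> is Einstein and its constant scalar curvature is \<open>S\<close>. For dimension 0 or 1 the formulas
  for \<^const>\<open>ricci\<close> and \<^const>\<open>scalar_curvature\<close> give 0, hence \<open>S = 0\<close> if \<open>M\<close> is nonempty.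
\<close>

definition einstein :: "('i, 'a) manifold \<Rightarrow> ('i, 'a) metric \<Rightarrow> real \<Rightarrow> bool" where
  "einstein M g S \<longleftrightarrow>
     (\<forall>c\<in>charts M. \<forall>p\<in>cdom M c.
        scalar_curvature M g c p = S \<and>
        (\<forall>i<mdim M. \<forall>j<mdim M.
           ricci M g c p i j = scalar_curvature M g c p / real (mdim M) * g c p i j))"

definition schouten ::
    "('i, 'a) manifold \<Rightarrow> ('i, 'a) metric \<Rightarrow> 'i \<Rightarrow> 'a \<Rightarrow> nat \<Rightarrow> nat \<Rightarrow> real" where
  "schouten M g c p i j =
     (ricci M g c p i j
        - scalar_curvature M g c p / (2 * (real (mdim M) - 1)) * g c p i j) / (real (mdim M) - 2)"

definition product_metric ::
    "('i, 'a) manifold \<Rightarrow> ('j, 'b) manifold \<Rightarrow> ('i, 'a) metric \<Rightarrow> ('j, 'b) metric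
      \<Rightarrow> ('i \<times> 'j, 'a \<times> 'b) metric" where
  "product_metric M N g g' = (\<lambda>(c, d) (p, q) i j.
     if i < mdim M \<and> j < mdim M then g c p i j
     else if mdim M \<le> i \<and> mdim M \<le> j then g' d q (i - mdim M) (j - mdim M)
     else 0)"


section \<open>Holonomy\<close>

text \<open>\<open>F\<close> collects the break points of a piecewise smooth curve on \<open>[0,1]\<close>: \<open>[a,b]\<close> is a segment
  that lies in the chart \<open>c\<close> and has no break point in its interior.\<close>

definition chart_segment ::
    "('i, 'a) manifold \<Rightarrow> real set \<Rightarrow> (real \<Rightarrow> 'a) \<Rightarrow> 'i \<Rightarrow> real \<Rightarrow> real \<Rightarrow> bool" where
  "chart_segment M F \<gamma> c a b \<longleftrightarrow>
     c \<in> charts M \<and> 0 \<le> a \<and> a < b \<and> b \<le> 1 \<and> {a<..<b} \<inter> F = {} \<and> \<gamma> ` {a..b} \<subseteq> cdom M c"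

text \<open>All derivatives exist on the closed interval, one-sided ones at the end points.\<close>

definition smooth_on_interval :: "(real \<Rightarrow> real) \<Rightarrow> real \<Rightarrow> real \<Rightarrow> bool" where
  "smooth_on_interval f a b \<longleftrightarrow>
     (\<exists>D :: nat \<Rightarrow> real \<Rightarrow> real. D 0 = f \<and>
        (\<forall>k. \<forall>s\<in>{a..b}. (D k has_real_derivative D (Suc k) s) (at s within {a..b})))"

definition piecewise_smooth_curve ::
    "('i, 'a) manifold \<Rightarrow> real set \<Rightarrow> (real \<Rightarrow> 'a) \<Rightarrow> bool" where
  "piecewise_smooth_curve M F \<gamma> \<longleftrightarrow>
     finite F \<and> pathin (topo M) \<gamma> \<and>
     (\<forall>c a b. chart_segment M F \<gamma> c a b \<longrightarrow>
        (\<forall>i<mdim M. smooth_on_interval (\<lambda>s. coord M c (\<gamma> s) i) a b))"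

definition velocity ::
    "('i, 'a) manifold \<Rightarrow> 'i \<Rightarrow> (real \<Rightarrow> 'a) \<Rightarrow> real \<Rightarrow> real \<Rightarrow> real \<Rightarrow> nat \<Rightarrow> real" where
  "velocity M c \<gamma> a b s i = vector_derivative (\<lambda>s. coord M c (\<gamma> s) i) (at s within {a..b})"

text \<open>
  Holonomy group at \<open>p\<close> of a vector bundle with connection, given by the fibres \<open>fib\<close> and by the
  predicate \<open>par F \<gamma> V\<close> stating that the section \<open>V\<close> along \<open>\<gamma>\<close> is parallel: the set of all parallel
  transports around piecewise smooth loops at \<open>p\<close>. A map of the fibre is represented by a function
  that is \<^const>\<open>undefined\<close> outside the fibre.
\<close>

definition holonomy_group ::
    "('i, 'a) manifold \<Rightarrow> ('a \<Rightarrow> 'v set) \<Rightarrow> (real set \<Rightarrow> (real \<Rightarrow> 'a) \<Rightarrow> (real \<Rightarrow> 'v) \<Rightarrow> bool)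
      \<Rightarrow> 'a \<Rightarrow> ('v \<Rightarrow> 'v) set" where
  "holonomy_group M fib par p =
     {A \<in> extensional (fib p).
        \<exists>F \<gamma>. piecewise_smooth_curve M F \<gamma> \<and> \<gamma> 0 = p \<and> \<gamma> 1 = p \<and>
          (\<forall>v\<in>fib p. \<exists>V. par F \<gamma> V \<and> V 0 = v \<and> V 1 = A v)}"

text \<open>\<open>\<nabla>\<^sub>\<gamma>\<^sub>'V = 0\<close> for the Levi-Civita connection. At a break point the equation holds for both one-sided
  derivatives, hence \<open>V\<close> is continuous.\<close>

definition parallel_along ::
    "('i, 'a) manifold \<Rightarrow> ('i, 'a) metric \<Rightarrow> real set \<Rightarrow> (real \<Rightarrow> 'a)
      \<Rightarrow> (real \<Rightarrow> 'i \<Rightarrow> nat \<Rightarrow> real) \<Rightarrow> bool" where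
  "parallel_along M g F \<gamma> V \<longleftrightarrow>
     (\<forall>s\<in>{0..1}. V s \<in> tangent_space M (\<gamma> s)) \<and>
     (\<forall>c a b. chart_segment M F \<gamma> c a b \<longrightarrow> (\<forall>s\<in>{a..b}. \<forall>k<mdim M.
        ((\<lambda>s. V s c k) has_real_derivative
           - (\<Sum>i<mdim M. \<Sum>j<mdim M.
                christoffel M g c (\<gamma> s) k i j * velocity M c \<gamma> a b s i * V s c j))
          (at s within {a..b})))"

definition metric_holonomy ::
    "('i, 'a) manifold \<Rightarrow> ('i, 'a) metric \<Rightarrow> 'a
      \<Rightarrow> (('i \<Rightarrow> nat \<Rightarrow> real) \<Rightarrow> ('i \<Rightarrow> nat \<Rightarrow> real)) set" where
  "metric_holonomy M g = holonomy_group M (tangent_space M) (parallel_along M g)"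


section \<open>Conformal holonomy\<close>

text \<open>
  The standard tractor bundle of \<open>[g]\<close>, identified with \<open>\<real> \<oplus> T\<^sup>*M \<oplus> \<real>\<close> by the choice of \<open>g\<close>.
\<close>

type_synonym 'i tractor = "real \<times> ('i \<Rightarrow> nat \<Rightarrow> real) \<times> real"

definition tractor_fibre :: "('i, 'a) manifold \<Rightarrow> 'a \<Rightarrow> 'i tractor set" where
  "tractor_fibre M p = UNIV \<times> cotangent_space M p \<times> UNIV"

text \<open>
  The normal tractor connection in the scale \<open>g\<close> is
  \<open>\<nabla>\<^sub>a(\<sigma>, \<omega>\<^sub>b, \<tau>) = (\<nabla>\<^sub>a\<sigma> - \<omega>\<^sub>a, \<nabla>\<^sub>a\<omega>\<^sub>b + P\<^sub>a\<^sub>b\<sigma> + g\<^sub>a\<^sub>b\<tau>, \<nabla>\<^sub>a\<tau> - P\<^sub>a\<^sup>c\<omega>\<^sub>c)\<close>;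
  the definition spells out that its contraction with the velocity vanishes along \<open>\<gamma>\<close>.
\<close>

definition tractor_parallel_along ::
    "('i, 'a) manifold \<Rightarrow> ('i, 'a) metric \<Rightarrow> real set \<Rightarrow> (real \<Rightarrow> 'a)
      \<Rightarrow> (real \<Rightarrow> 'i tractor) \<Rightarrow> bool" where
  "tractor_parallel_along M g F \<gamma> V \<longleftrightarrow>
     (\<forall>s\<in>{0..1}. V s \<in> tractor_fibre M (\<gamma> s)) \<and>
     (\<forall>c a b. chart_segment M F \<gamma> c a b \<longrightarrow> (\<forall>s\<in>{a..b}.
        let n = mdim M; p = \<gamma> s; u = velocity M c \<gamma> a b s;
            \<sigma> = fst (V s); \<omega> = fst (snd (V s)) c; \<tau> = snd (snd (V s));
            P = schouten M g c p; ginv = inverse_matrix n (g c p)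
        in
          ((\<lambda>s. fst (V s)) has_real_derivative (\<Sum>i<n. u i * \<omega> i)) (at s within {a..b}) \<and>
          (\<forall>b'<n. ((\<lambda>s. fst (snd (V s)) c b') has_real_derivative
             (\<Sum>i<n. \<Sum>k<n. christoffel M g c p k i b' * u i * \<omega> k)
             - (\<Sum>i<n. u i * P i b') * \<sigma> - (\<Sum>i<n. u i * g c p i b') * \<tau>)
             (at s within {a..b})) \<and>
          ((\<lambda>s. snd (snd (V s))) has_real_derivative
             (\<Sum>i<n. \<Sum>d<n. \<Sum>k<n. u i * P i d * ginv d k * \<omega> k)) (at s within {a..b})))"

definition conformal_holonomy ::
    "('i, 'a) manifold \<Rightarrow> ('i, 'a) metric \<Rightarrow> 'a \<Rightarrow> ('i tractor \<Rightarrow> 'i tractor) set" where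
  "conformal_holonomy M g = holonomy_group M (tractor_fibre M) (tractor_parallel_along M g)"


section \<open>The ambient manifold\<close>

text \<open>
  The point \<open>(p, t\<^sup>2 g(p))\<close> of the metric bundle \<open>\<Q>\<close> is represented by \<open>(p, t)\<close> with \<open>t > 0\<close>, and the
  point of \<open>\<Q> \<times> I\<close> with second coordinate \<open>\<rho>\<close> by \<open>(p, t, \<rho>)\<close>, where \<open>p = (p\<^sub>1, p\<^sub>2)\<close>.
  Coordinates are ordered \<open>(x\<^sub>1, x\<^sub>2, t, \<rho>)\<close>: with \<open>n = m\<^sub>1 + m\<^sub>2\<close>, \<open>t\<close> has index \<open>n\<close> and \<open>\<rho>\<close> has
  index \<open>n + 1\<close>.
\<close>

definition rho_domain :: "real \<Rightarrow> nat \<Rightarrow> real set" where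
  "rho_domain \<mu> m\<^sub>2 =
     (if \<mu> = 0 then UNIV else if m\<^sub>2 = 0 then UNIV - {-1/\<mu>} else UNIV - {1/\<mu>, -1/\<mu>})"

type_synonym 'k ambient_label = "'k \<times> unit \<times> unit"
type_synonym 'p ambient_point = "'p \<times> real \<times> real"

definition ambient_manifold ::
    "('i, 'a) manifold \<Rightarrow> ('j, 'b) manifold \<Rightarrow> real
      \<Rightarrow> (('i \<times> 'j) ambient_label, ('a \<times> 'b) ambient_point) manifold" where
  "ambient_manifold M\<^sub>1 M\<^sub>2 \<mu> =
     prod_manifold (prod_manifold M\<^sub>1 M\<^sub>2)
       (prod_manifold (real_manifold {0<..}) (real_manifold (rho_domain \<mu> (mdim M\<^sub>2))))"

text \<open>
  \<open>h = 2 t dt d\<rho> + 2 \<rho> dt\<^sup>2 + t\<^sup>2 [(1 + \<mu>\<rho>)\<^sup>2 g\<^sub>1 + (1 - \<mu>\<rho>)\<^sup>2 g\<^sub>2]\<close>, with \<open>dt d\<rho>\<close> the symmetric product;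
  hence the components \<open>h\<^sub>t\<^sub>\<rho> = h\<^sub>\<rho>\<^sub>t = t\<close>.
\<close>

definition ambient_metric ::
    "('i, 'a) manifold \<Rightarrow> ('j, 'b) manifold \<Rightarrow> ('i, 'a) metric \<Rightarrow> ('j, 'b) metric \<Rightarrow> real
      \<Rightarrow> (('i \<times> 'j) ambient_label, ('a \<times> 'b) ambient_point) metric" where
  "ambient_metric M\<^sub>1 M\<^sub>2 g\<^sub>1 g\<^sub>2 \<mu> = (\<lambda>(c, _) (p, t, \<rho>) i j.
     let n = mdim M\<^sub>1 + mdim M\<^sub>2 in
     if i < n \<and> j < n then
       t\<^sup>2 * product_metric M\<^sub>1 M\<^sub>2 (\<lambda>c p i j. (1 + \<mu> * \<rho>)\<^sup>2 * g\<^sub>1 c p i j)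
                             (\<lambda>c p i j. (1 - \<mu> * \<rho>)\<^sup>2 * g\<^sub>2 c p i j) c p i j
     else if i = n \<and> j = n then 2 * \<rho>
     else if i = n \<and> j = n + 1 \<or> i = n + 1 \<and> j = n then t
     else 0)"

text \<open>
  The union of the connected components that meet \<open>\<Q> = \<Q> \<times> {0}\<close>; if \<open>M\<^sub>1 \<times> M\<^sub>2\<close> is connected, so is
  \<open>\<Q>\<close>, and this is the connected component containing it.
\<close>

definition Q_component ::
    "('i, 'a) manifold \<Rightarrow> ('j, 'b) manifold \<Rightarrow> real
      \<Rightarrow> (('i \<times> 'j) ambient_label, ('a \<times> 'b) ambient_point) manifold" where
  "Q_component M\<^sub>1 M\<^sub>2 \<mu> =
     open_submanifold (ambient_manifold M\<^sub>1 M\<^sub>2 \<mu>)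
       {x. \<exists>p t. connected_component_of (topo (ambient_manifold M\<^sub>1 M\<^sub>2 \<mu>)) (p, t, 0) x}"

text \<open>
  The identification of the tangent space of the ambient manifold at a point \<open>(p, t, 0)\<close> of \<open>\<Q>\<close> with
  the tractor fibre at \<open>p\<close> (in the scale \<open>g\<close>):
  \<open>\<xi>\<^sup>t \<partial>\<^sub>t + \<xi>\<^sup>e \<partial>\<^sub>e + \<xi>\<^sup>\<rho> \<partial>\<^sub>\<rho>\<close> is sent to \<open>(\<sigma>, \<omega>\<^sub>b, \<tau>) = (t \<xi>\<^sup>\<rho>, t g\<^sub>b\<^sub>e \<xi>\<^sup>e, \<xi>\<^sup>t)\<close>. The components \<open>\<xi>\<^sup>t\<close> and
  \<open>\<xi>\<^sup>\<rho>\<close> do not depend on the chart; they are read off in an arbitrary one.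
  The equations for a parallel field along a curve in \<open>\<Q>\<close>,
  \<open>(\<xi>\<^sup>t)' = t P\<^sub>i\<^sub>j x\<^sup>i' \<xi>\<^sup>j\<close>,
  \<open>\<nabla>\<xi>\<^sup>k + t'/t \<xi>\<^sup>k + 1/t x\<^sup>k' \<xi>\<^sup>t + P\<^sup>k\<^sub>j x\<^sup>j' \<xi>\<^sup>\<rho> = 0\<close>,
  \<open>(\<xi>\<^sup>\<rho>)' + t'/t \<xi>\<^sup>\<rho> = g\<^sub>i\<^sub>j x\<^sup>i' \<xi>\<^sup>j\<close>,
  thereby become those of the normal tractor connection.
\<close>

definition ambient_to_tractor ::
    "('k, 'p) manifold \<Rightarrow> ('k, 'p) metric \<Rightarrow> 'p \<Rightarrow> real
      \<Rightarrow> ('k ambient_label \<Rightarrow> nat \<Rightarrow> real) \<Rightarrow> 'k tractor" where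
  "ambient_to_tractor M g p t \<xi> =
     (let n = mdim M; c\<^sub>0 = (SOME c. c \<in> charts M \<and> p \<in> cdom M c) in
      (t * \<xi> (c\<^sub>0, (), ()) (n + 1),
       (\<lambda>c b. if c \<in> charts M \<and> p \<in> cdom M c \<and> b < n
              then t * (\<Sum>e<n. g c p b e * \<xi> (c, (), ()) e) else 0),
       \<xi> (c\<^sub>0, (), ()) n))"

text \<open>
  The action \<open>\<xi> \<mapsto> s\<^sup>-\<^sup>1 \<sigma>\<^sup>s\<^sub>*\<xi>\<close> of \<open>s > 0\<close>, from the tangent space at \<open>(p, t, 0)\<close> to that at \<open>(p, s t, 0)\<close>:
  as \<open>\<sigma>\<^sup>s\<close> is \<open>t \<mapsto> s t\<close>, only the component \<open>\<xi>\<^sup>t\<close> is unchanged. The identification is constant on its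
  orbits.
\<close>

definition R_plus_action ::
    "('k, 'p) manifold \<Rightarrow> real \<Rightarrow> ('k ambient_label \<Rightarrow> nat \<Rightarrow> real)
      \<Rightarrow> 'k ambient_label \<Rightarrow> nat \<Rightarrow> real" where
  "R_plus_action M s \<xi> = (\<lambda>c k. inverse s * (if k = mdim M then s * \<xi> c k else \<xi> c k))"

lemma ambient_to_tractor_R_plus_action:
  assumes "s > 0"
  shows "ambient_to_tractor M g p (s * t) (R_plus_action M s \<xi>) = ambient_to_tractor M g p t \<xi>"
proof -
  have "(\<Sum>e<mdim M. g c p b e * R_plus_action M s \<xi> (c, (), ()) e) =
        inverse s * (\<Sum>e<mdim M. g c p b e * \<xi> (c, (), ()) e)" for c b
    by (simp add: R_plus_action_def sum_distrib_left mult_ac)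
  with assms show ?thesis
    by (auto simp: ambient_to_tractor_def Let_def R_plus_action_def fun_eq_iff)
qed

end

theory Submission
  imports Defs "Jordan_Normal_Form.Determinant"
begin

text \<open>
  With \<open>r\<^sub>1 = t (1 + \<mu>\<rho>)\<close> and \<open>r\<^sub>2 = t (1 - \<mu>\<rho>)\<close> the ambient metric is, for \<open>\<mu> \<noteq> 0\<close>, the product
  \<open>(dr\<^sub>1\<^sup>2 - dr\<^sub>2\<^sup>2) / (2\<mu>) + r\<^sub>1\<^sup>2 g\<^sub>1 + r\<^sub>2\<^sup>2 g\<^sub>2\<close> of two cones. On a cone, \<open>(\<xi>\<^sup>r, r \<xi>\<^sup>e)\<close> identifies the
  tangent spaces at all points of a ray, and in these terms the Levi-Civita connection does not depend
  on \<open>r\<close>. Written without dividing by \<open>\<mu>\<close>, this is the map sending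
  \<open>\<xi>\<^sup>t \<partial>\<^sub>t + \<xi>\<^sup>e \<partial>\<^sub>e + \<xi>\<^sup>\<rho> \<partial>\<^sub>\<rho>\<close> at \<open>(p, t, \<rho>)\<close> to the tractor
  \<open>\<sigma> = t \<xi>\<^sup>\<rho> + \<rho> \<xi>\<^sup>t\<close>, \<open>\<omega>\<^sub>b = t (1 \<plusminus> \<mu>\<rho>) g\<^sub>b\<^sub>e \<xi>\<^sup>e\<close>, \<open>\<tau> = \<xi>\<^sup>t\<close> at \<open>p\<close>; it is an isomorphism on every
  tangent space and extends the given identification over \<open>\<Q>\<close>. Because the Schouten tensor of
  \<open>g\<^sub>1 \<times> g\<^sub>2\<close> is \<open>\<mu> g\<^sub>1 - \<mu> g\<^sub>2\<close>, it takes parallel fields along a curve \<open>(\<gamma>, t, \<rho>)\<close> to parallel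
  tractors along \<open>\<gamma>\<close>. So a loop in the ambient manifold and its projection have the same parallel
  transport, and every loop \<open>\<gamma>\<close> is the projection of a loop \<open>(\<gamma>, t, 0)\<close> in \<open>\<Q>\<close>. No existence or
  uniqueness theorem for parallel transport is involved.
\<close>

section \<open>Inverse matrices\<close>

text \<open>Put \<nu> = t\<rho>. Then
  \<open>2 t dt d\<rho> + 2 \<rho> dt\<^sup>2 = 2 dt d\<nu>\<close>, and the ambient metric becomes
  \<open>2 dt d\<nu> + (t + \<mu>\<nu>)\<^sup>2 g\<^sub>1 + (t - \<mu>\<nu>)\<^sup>2
  g\<^sub>2\<close>, a form that also covers \<mu> = 0. It explains the map to tractors: \<sigma>
  and \<tau> are the components of \<xi> along \<nu> and t, whence the term
  \<open>\<rho> \<xi>\<^sup>t\<close>, and \<omega> is the lowered base part, scaled by the warping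
  factor. The two passages between parallel fields are not symmetric. From the ambient side the
  product rule differentiates the tractor. From the tractor side the vector is recovered through the
  inverse of the metric, and its components must be known to be differentiable before the equations
  can be compared. Hence the cofactor description of inverse matrices, and a chain rule that covers
  one-sided derivatives at break points. Transferring fields is enough because
  \<open>holonomy_group\<close> makes a parallel field through each initial vector part of the
  membership condition.\<close>

definition nondegenerate_matrix :: "nat \<Rightarrow> (nat \<Rightarrow> nat \<Rightarrow> real) \<Rightarrow> bool" where
  "nondegenerate_matrix n A \<longleftrightarrow>
     (\<forall>v::nat \<Rightarrow> real. (\<forall>i<n. (\<Sum>j<n. A i j * v j) = 0) \<longrightarrow> (\<forall>j<n. v j = 0))"

lemma sum_kronecker_mult:
  fixes f :: "nat \<Rightarrow> real"
  assumes "i < n"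
  shows "(\<Sum>l<n. (if i = l then 1 else 0) * f l) = f i"
    and "(\<Sum>l<n. f l * (if l = i then 1 else 0)) = f i"
proof -
  have *: "(if i = l then 1 else 0) * f l = (if l = i then f l else 0)"
    "f l * (if l = i then 1 else 0) = (if l = i then f l else 0)" for l
    by auto
  show "(\<Sum>l<n. (if i = l then 1 else 0) * f l) = f i" "(\<Sum>l<n. f l * (if l = i then 1 else 0)) = f i"
    using assms unfolding * by simp_all
qed

text \<open>Bridge to the type \<open>mat\<close>: the development works with functions of two
  indices, while determinants, adjugates and one-sided inverses are available for matrices.\<close>

lemma mat_mult_entries:
  "mat n n (\<lambda>(i, j). A i j) * mat n n (\<lambda>(i, j). B i j) =
     mat n n (\<lambda>(i, k). \<Sum>j<n. A i j * B j k :: real)"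
  by (rule eq_matI) (auto simp: scalar_prod_def lessThan_atLeast0)

lemma mat_mult_one_iff:
  "mat n n (\<lambda>(i, j). A i j) * mat n n (\<lambda>(i, j). B i j) = 1\<^sub>m n \<longleftrightarrow>
     (\<forall>i<n. \<forall>k<n. (\<Sum>j<n. A i j * B j k) = (if i = k then 1 else 0 :: real))"
  unfolding mat_mult_entries by (auto simp: mat_eq_iff)

lemma right_inverse_imp_left_inverse:
  fixes A B :: "nat \<Rightarrow> nat \<Rightarrow> real"
  assumes "\<forall>i<n. \<forall>k<n. (\<Sum>j<n. A i j * B j k) = (if i = k then 1 else 0)"
  shows "\<forall>i<n. \<forall>k<n. (\<Sum>j<n. B i j * A j k) = (if i = k then 1 else 0)"
  using assms mat_mult_left_right_inverse[of "mat n n (\<lambda>(i, j). A i j)" n "mat n n (\<lambda>(i, j). B i j)"]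
  unfolding mat_mult_one_iff[symmetric] by simp

lemma det_nondegenerate:
  assumes "nondegenerate_matrix n A"
  shows "det (mat n n (\<lambda>(i, j). A i j)) \<noteq> 0"
proof
  let ?A = "mat n n (\<lambda>(i, j). A i j)"
  assume "det ?A = 0"
  then obtain v where v: "v \<in> carrier_vec n" "v \<noteq> 0\<^sub>v n" "?A *\<^sub>v v = 0\<^sub>v n"
    by (subst (asm) det_0_iff_vec_prod_zero[of _ n]) auto
  have "(\<Sum>j<n. A i j * vec_index v j) = 0" if "i < n" for i
  proof -
    have "vec_index (?A *\<^sub>v v) i = (\<Sum>j<n. A i j * vec_index v j)"
      using that v(1) by (simp add: scalar_prod_def lessThan_atLeast0)
    with v(3) that show ?thesis by simp
  qed
  then have "\<forall>j<n. vec_index v j = 0"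
    using assms[unfolded nondegenerate_matrix_def, rule_format, of "vec_index v"] by blast
  with v(1,2) show False by (metis carrier_vecD dim_vec eq_vecI index_zero_vec)
qed

text \<open>Resolves the definite description in \<open>inverse_matrix\<close>. The right inverse
  \<open>B\<close> is also a left inverse, so a competitor satisfies
  \<open>C = (B A) C = B (A C) = B\<close> on the block, and the normalisation to 0 elsewhere makes
  the functions equal.\<close>

lemma inverse_matrix_eqI:
  assumes inv: "\<And>i k. i < n \<Longrightarrow> k < n \<Longrightarrow> (\<Sum>j<n. A i j * B j k) = (if i = k then 1 else 0)"
    and zero: "\<And>i j. \<not> (i < n \<and> j < n) \<Longrightarrow> B i j = 0"
  shows "inverse_matrix n A = B"
  unfolding inverse_matrix_def
proof (rule the_equality, intro conjI allI impI)
  fix C assume C: "(\<forall>i<n. \<forall>k<n. (\<Sum>j<n. A i j * C j k) = (if i = k then 1 else 0)) \<and>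
    (\<forall>i j. \<not> (i < n \<and> j < n) \<longrightarrow> C i j = 0)"
  have BA: "\<forall>i<n. \<forall>k<n. (\<Sum>j<n. B i j * A j k) = (if i = k then 1 else 0)"
    by (rule right_inverse_imp_left_inverse) (intro allI impI inv)
  have "C i k = B i k" if "i < n" "k < n" for i k
  proof -
    have "C i k = (\<Sum>l<n. (if i = l then 1 else 0) * C l k)"
      by (rule sum_kronecker_mult(1)[OF that(1), symmetric])
    also have "\<dots> = (\<Sum>l<n. (\<Sum>j<n. B i j * A j l) * C l k)"
      using that by (intro sum.cong arg_cong2[of _ _ _ _ "(*)"] BA[rule_format, symmetric]) auto
    also have "\<dots> = (\<Sum>j<n. B i j * (\<Sum>l<n. A j l * C l k))"
      unfolding sum_distrib_left sum_distrib_right by (subst sum.swap) (simp only: mult.assoc)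
    also have "\<dots> = (\<Sum>j<n. B i j * (if j = k then 1 else 0))"
      using that by (intro sum.cong arg_cong2[of _ _ _ _ "(*)"] conjunct1[OF C, rule_format]) auto
    also have "\<dots> = B i k"
      by (rule sum_kronecker_mult(2)[OF that(2)])
    finally show ?thesis .
  qed
  moreover have "C i k = B i k" if "\<not> (i < n \<and> k < n)" for i k
    using conjunct2[OF C, rule_format, OF that] zero[OF that] by (rule trans[OF _ sym])
  ultimately show "C = B" by (intro ext) blast
qed (fact inv, fact zero)

text \<open>A trivial kernel makes the determinant nonzero, so the adjugate divided by it is a right
  inverse. The explicit quotient is recorded because differentiability of the entries is read off
  from it.\<close>

lemma
  assumes nd: "nondegenerate_matrix n A"
  shows inverse_matrix_adj_mat:
      "i < n \<Longrightarrow> j < n \<Longrightarrow> inverse_matrix n A i j =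
         adj_mat (mat n n (\<lambda>(i, j). A i j)) $$ (i, j) / det (mat n n (\<lambda>(i, j). A i j))"
    and inverse_matrix_eq_0: "\<not> (i < n \<and> j < n) \<Longrightarrow> inverse_matrix n A i j = 0"
    and inverse_matrix_right: "i < n \<Longrightarrow> k < n \<Longrightarrow>
       (\<Sum>j<n. A i j * inverse_matrix n A j k) = (if i = k then 1 else 0)"
proof -
  let ?A = "mat n n (\<lambda>(i, j). A i j)"
  define B where "B = (\<lambda>i j. if i < n \<and> j < n then adj_mat ?A $$ (i, j) / det ?A else 0)"
  have AB: "(\<Sum>j<n. A i j * B j k) = (if i = k then 1 else 0)" if ik: "i < n" "k < n" for i k
  proof -
    have "(\<Sum>j<n. A i j * B j k) = (?A * adj_mat ?A) $$ (i, k) / det ?A"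
      using ik adj_mat(1)[of ?A n]
      by (simp add: B_def scalar_prod_def lessThan_atLeast0 sum_divide_distrib)
    also have "\<dots> = (if i = k then 1 else 0)"
      using ik adj_mat(2)[of ?A n] det_nondegenerate[OF nd] by simp
    finally show ?thesis .
  qed
  have B0: "B i j = 0" if "\<not> (i < n \<and> j < n)" for i j
    using that unfolding B_def by (rule if_not_P)
  have eq: "inverse_matrix n A = B"
    using AB B0 by (rule inverse_matrix_eqI)
  show "i < n \<Longrightarrow> j < n \<Longrightarrow> inverse_matrix n A i j = adj_mat ?A $$ (i, j) / det ?A"
    unfolding eq by (simp add: B_def)
  show "\<not> (i < n \<and> j < n) \<Longrightarrow> inverse_matrix n A i j = 0"
    unfolding eq by (rule B0)
  show "i < n \<Longrightarrow> k < n \<Longrightarrow>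
       (\<Sum>j<n. A i j * inverse_matrix n A j k) = (if i = k then 1 else 0)"
    unfolding eq by (rule AB)
qed

lemma inverse_matrix_left:
  assumes "nondegenerate_matrix n A" "i < n" "k < n"
  shows "(\<Sum>j<n. inverse_matrix n A i j * A j k) = (if i = k then 1 else 0)"
proof -
  have "\<forall>i<n. \<forall>k<n. (\<Sum>j<n. A i j * inverse_matrix n A j k) = (if i = k then 1 else 0)"
    by (intro allI impI) (rule inverse_matrix_right[OF assms(1)])
  from right_inverse_imp_left_inverse[OF this, rule_format, OF assms(2,3)] show ?thesis .
qed

section \<open>Differentiability of inverse matrices along a curve\<close>

lemma det_differentiable:
  fixes A :: "real \<Rightarrow> nat \<Rightarrow> nat \<Rightarrow> real"
  assumes "\<And>i j. i < n \<Longrightarrow> j < n \<Longrightarrow> (\<lambda>s. A s i j) differentiable (at s\<^sub>0 within S)"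
  shows "(\<lambda>s. det (mat n n (\<lambda>(i, j). A s i j))) differentiable (at s\<^sub>0 within S)"
proof -
  have "(\<lambda>s. \<Sum>p\<in>{p. p permutes {0..<n}}. signof p * (\<Prod>i<n. A s i (p i)))
      differentiable (at s\<^sub>0 within S)"
  proof (intro differentiable_sum ballI differentiable_mult differentiable_const)
    fix p assume "p \<in> {p. p permutes {0..<n}}"
    then have p: "p i < n" if "i < n" for i
      using that by (auto dest: permutes_in_image[of _ _ i])
    show "(\<lambda>s. \<Prod>i<n. A s i (p i)) differentiable (at s\<^sub>0 within S)"
    proof -
      have "\<forall>i. \<exists>D. i < n \<longrightarrow> ((\<lambda>s. A s i (p i)) has_derivative D) (at s\<^sub>0 within S)"
        using assms[unfolded differentiable_def] p by blast
      then obtain D where D: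
        "((\<lambda>s. A s i (p i)) has_derivative D i) (at s\<^sub>0 within S)" if "i < n" for i
        using choice[of "\<lambda>i D. i < n \<longrightarrow> ((\<lambda>s. A s i (p i)) has_derivative D) (at s\<^sub>0 within S)"]
        by blast
      show ?thesis
        unfolding differentiable_def by (rule exI, rule has_derivative_prod, rule D, simp)
    qed
  qed (auto simp: finite_permutations)
  also have "(\<lambda>s. \<Sum>p\<in>{p. p permutes {0..<n}}. signof p * (\<Prod>i<n. A s i (p i))) =
      (\<lambda>s. det (mat n n (\<lambda>(i, j). A s i j)))"
  proof
    fix s
    have "det (mat n n (\<lambda>(i, j). A s i j)) = (\<Sum>p\<in>{p. p permutes {0..<n}}. signof p *
        (\<Prod>i = 0..<n. mat n n (\<lambda>(i, j). A s i j) $$ (i, p i)))"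
      by (rule det_def'[of _ n]) simp
    also have "\<dots> = (\<Sum>p\<in>{p. p permutes {0..<n}}. signof p * (\<Prod>i<n. A s i (p i)))"
    proof (rule sum.cong[OF refl])
      fix p assume "p \<in> {p. p permutes {0..<n}}"
      then have p: "p i < n" if "i < n" for i
        using that by (auto dest: permutes_in_image[of _ _ i])
      show "signof p * (\<Prod>i = 0..<n. mat n n (\<lambda>(i, j). A s i j) $$ (i, p i)) =
          signof p * (\<Prod>i<n. A s i (p i))"
        by (simp add: lessThan_atLeast0 p)
    qed
    finally show "(\<Sum>p\<in>{p. p permutes {0..<n}}. signof p * (\<Prod>i<n. A s i (p i))) =
      det (mat n n (\<lambda>(i, j). A s i j))" by simp
  qed
  finally show ?thesis .
qed

text \<open>Each entry is a cofactor divided by the determinant, both polynomial in the entries of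
  \<open>A s\<close>. Working within \<open>S\<close> includes the end points of a segment.\<close>

lemma inverse_matrix_differentiable:
  fixes A :: "real \<Rightarrow> nat \<Rightarrow> nat \<Rightarrow> real"
  assumes diff: "\<And>i j. i < n \<Longrightarrow> j < n \<Longrightarrow> (\<lambda>s. A s i j) differentiable (at s\<^sub>0 within S)"
    and nd: "\<And>s. s \<in> S \<Longrightarrow> nondegenerate_matrix n (A s)" and "s\<^sub>0 \<in> S" "i < n" "j < n"
  shows "(\<lambda>s. inverse_matrix n (A s) i j) differentiable (at s\<^sub>0 within S)"
proof -
  let ?A = "\<lambda>s. mat n n (\<lambda>(i, j). A s i j)"
  \<comment> \<open>A minor is rewritten as a matrix function skipping row \<open>j\<close> and
    column \<open>i\<close>, so that \<open>det_differentiable\<close> applies to it.\<close>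
  have del: "mat_delete (?A s) j i =
      mat (n - 1) (n - 1) (\<lambda>(k, l). A s (if k < j then k else Suc k) (if l < i then l else Suc l))" for s
    using assms(4,5) by (intro eq_matI) (auto simp: mat_delete_def)
  have "(\<lambda>s. (-1) ^ (j + i) * det (mat_delete (?A s) j i)) differentiable (at s\<^sub>0 within S)"
    unfolding del
    by (intro differentiable_mult differentiable_const det_differentiable diff) auto
  then have "(\<lambda>s. (-1) ^ (j + i) * det (mat_delete (?A s) j i) / det (?A s))
      differentiable (at s\<^sub>0 within S)"
    using det_nondegenerate[OF nd[OF \<open>s\<^sub>0 \<in> S\<close>]]
    by (intro differentiable_divide det_differentiable diff) auto
  then obtain D where D: "((\<lambda>s. (-1) ^ (j + i) * det (mat_delete (?A s) j i) / det (?A s))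
      has_derivative D) (at s\<^sub>0 within S)"
    unfolding differentiable_def by (rule exE)
  have eq: "inverse_matrix n (A s) i j = (-1) ^ (j + i) * det (mat_delete (?A s) j i) / det (?A s)"
    if "s \<in> S" for s
    using assms(4,5) by (simp add: inverse_matrix_adj_mat[OF nd[OF that]] adj_mat_def cofactor_def)
  show ?thesis
    unfolding differentiable_def
    by (rule exI, rule has_derivative_transform[OF \<open>s\<^sub>0 \<in> S\<close> _ D], rule eq)
qed

section \<open>The chain rule in Euclidean space\<close>

text \<open>Points of the model space vanish from index \<open>n\<close> on, so a basic open set
  constrains only the first \<open>n\<close> coordinates, and finitely many radii have a positive
  minimum.\<close>

lemma openin_Euclidean_space_box:
  assumes "openin (Euclidean_space n) V" "x \<in> V"
  obtains e where "e > 0" "\<And>y. \<forall>i\<ge>n. y i = 0 \<Longrightarrow> \<forall>i<n. \<bar>y i - x i\<bar> < e \<Longrightarrow> y \<in> V"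
proof -
  obtain U where U: "openin (powertop_real UNIV) U" "V = U \<inter> {x. \<forall>i\<ge>n. x i = 0}"
    using assms(1) unfolding Euclidean_space_def openin_subtopology by blast
  have "openin (product_topology (\<lambda>i. euclidean) UNIV) U" "x \<in> U"
    using U assms(2) by auto
  from product_topology_open_contains_basis[OF this] obtain X where
    X: "x \<in> (\<Pi>\<^sub>E i\<in>UNIV. X i)" "\<And>i. openin euclidean (X i)" "(\<Pi>\<^sub>E i\<in>UNIV. X i) \<subseteq> U"
    by blast
  have "\<forall>i. \<exists>d>0. \<forall>r. \<bar>r - x i\<bar> < d \<longrightarrow> r \<in> X i"
  proof
    fix i
    have "open (X i)" "x i \<in> X i"
      using X(1,2) by (auto simp: PiE_UNIV_domain)
    then show "\<exists>d>0. \<forall>r. \<bar>r - x i\<bar> < d \<longrightarrow> r \<in> X i"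
      by (auto simp: open_dist dist_real_def)
  qed
  then obtain d where d: "\<And>i. d i > 0" "\<And>i r. \<bar>r - x i\<bar> < d i \<Longrightarrow> r \<in> X i"
    by metis
  \<comment> \<open>The 1 covers \<open>n = 0\<close>, where there is no radius to take the minimum
    of.\<close>
  define e where "e = Min (insert 1 (d ` {..<n}))"
  have "e > 0" unfolding e_def using d(1) by (subst Min_gr_iff) auto
  moreover have "y \<in> V" if y: "\<forall>i\<ge>n. y i = 0" "\<forall>i<n. \<bar>y i - x i\<bar> < e" for y
  proof -
    have "y i \<in> X i" for i
    proof (cases "i < n")
      case True
      then have "e \<le> d i" by (auto simp: e_def)
      with True y(2) d(2)[of "y i" i] show ?thesis by force
    next
      case False
      moreover have "x i = 0" using False assms(2) U(2) by auto
      ultimately show ?thesis using y(1) d(2)[of "y i" i] d(1)[of i] by auto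
    qed
    then have "y \<in> U" using X(3) by (auto simp: PiE_UNIV_domain)
    with y(1) U(2) show ?thesis by auto
  qed
  ultimately show thesis by (rule that)
qed

lemma continuous_map_Euclidean_space_box:
  fixes f :: "(nat \<Rightarrow> real) \<Rightarrow> real"
  assumes "openin (Euclidean_space n) V" "x \<in> V"
    "continuous_map (subtopology (Euclidean_space n) V) euclideanreal f" "\<epsilon> > 0"
  obtains e where "e > 0"
    "\<And>y. \<forall>i\<ge>n. y i = 0 \<Longrightarrow> \<forall>i<n. \<bar>y i - x i\<bar> < e \<Longrightarrow> y \<in> V \<and> \<bar>f y - f x\<bar> < \<epsilon>"
proof -
  let ?W = "{y \<in> topspace (subtopology (Euclidean_space n) V). f y \<in> ball (f x) \<epsilon>}"
  have "openin (subtopology (Euclidean_space n) V) ?W"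
    by (rule openin_continuous_map_preimage[OF assms(3)]) simp
  then have W: "openin (Euclidean_space n) ?W"
    using assms(1) openin_trans_full by blast
  have "V \<subseteq> topspace (Euclidean_space n)" using assms(1) by (rule openin_subset)
  then have "x \<in> ?W" using assms(2,4) by auto
  from W this show thesis
  proof (rule openin_Euclidean_space_box)
    fix e :: real
    assume "e > 0" and e: "\<And>y. \<forall>i\<ge>n. y i = 0 \<Longrightarrow> \<forall>i<n. \<bar>y i - x i\<bar> < e \<Longrightarrow> y \<in> ?W"
    show thesis
    proof (rule that[OF \<open>e > 0\<close>])
      fix y :: "nat \<Rightarrow> real"
      assume "\<forall>i\<ge>n. y i = 0" "\<forall>i<n. \<bar>y i - x i\<bar> < e"
      then have "y \<in> ?W" by (rule e)
      then show "y \<in> V \<and> \<bar>f y - f x\<bar> < \<epsilon>" by (auto simp: dist_real_def abs_minus_commute)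
    qed
  qed
qed

text \<open>A chain rule in increment form: \<open>\<phi>\<close> need not be a function of
  \<open>y\<close>; its increment only has to be \<open>c\<close> times that of \<open>y\<close> up
  to an arbitrarily small multiple.\<close>

lemma has_real_derivative_comp_increment:
  fixes y \<phi> :: "real \<Rightarrow> real"
  assumes y: "(y has_real_derivative u) (at s\<^sub>0 within S)" and "\<phi> s\<^sub>0 = 0"
    and le: "\<And>\<epsilon>. \<epsilon> > 0 \<Longrightarrow>
      \<forall>\<^sub>F s in at s\<^sub>0 within S. \<bar>\<phi> s - c * (y s - y s\<^sub>0)\<bar> \<le> \<epsilon> * \<bar>y s - y s\<^sub>0\<bar>"
  shows "(\<phi> has_real_derivative u * c) (at s\<^sub>0 within S)"
proof -
  \<comment> \<open>The quotient of increments, completed by its limit where \<open>y\<close> does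
    not move. There the estimate forces \<open>\<phi> s = 0\<close>, so \<open>q\<close> times the
    difference quotient of \<open>y\<close> is always that of \<open>\<phi>\<close>.\<close>
  define q where "q s = (if y s = y s\<^sub>0 then c else \<phi> s / (y s - y s\<^sub>0))" for s
  have q: "(q \<longlongrightarrow> c) (at s\<^sub>0 within S)"
  proof (rule tendstoI)
    fix \<epsilon> :: real assume "\<epsilon> > 0"
    then have "\<epsilon> / 2 > 0" by simp
    from le[OF this] show "\<forall>\<^sub>F s in at s\<^sub>0 within S. dist (q s) c < \<epsilon>"
    proof (rule eventually_mono)
      fix s assume s: "\<bar>\<phi> s - c * (y s - y s\<^sub>0)\<bar> \<le> \<epsilon> / 2 * \<bar>y s - y s\<^sub>0\<bar>"
      show "dist (q s) c < \<epsilon>"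
      proof (cases "y s = y s\<^sub>0")
        case False
        then have "q s - c = (\<phi> s - c * (y s - y s\<^sub>0)) / (y s - y s\<^sub>0)"
          by (simp add: q_def field_simps)
        then have "\<bar>q s - c\<bar> = \<bar>\<phi> s - c * (y s - y s\<^sub>0)\<bar> / \<bar>y s - y s\<^sub>0\<bar>"
          by (simp only: abs_divide)
        then have "\<bar>q s - c\<bar> \<le> \<epsilon> / 2"
          using s False by (simp add: pos_divide_le_eq)
        with \<open>\<epsilon> > 0\<close> show ?thesis by (simp add: dist_real_def)
      qed (use \<open>\<epsilon> > 0\<close> in \<open>simp add: q_def\<close>)
    qed
  qed
  have le1: "\<forall>\<^sub>F s in at s\<^sub>0 within S. \<bar>\<phi> s - c * (y s - y s\<^sub>0)\<bar> \<le> 1 * \<bar>y s - y s\<^sub>0\<bar>"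
    by (rule le) simp
  have "\<forall>\<^sub>F s in at s\<^sub>0 within S. q s * ((y s - y s\<^sub>0) / (s - s\<^sub>0)) = (\<phi> s - \<phi> s\<^sub>0) / (s - s\<^sub>0)"
    using le1
  proof (rule eventually_mono)
    fix s assume "\<bar>\<phi> s - c * (y s - y s\<^sub>0)\<bar> \<le> 1 * \<bar>y s - y s\<^sub>0\<bar>"
    then show "q s * ((y s - y s\<^sub>0) / (s - s\<^sub>0)) = (\<phi> s - \<phi> s\<^sub>0) / (s - s\<^sub>0)"
      using \<open>\<phi> s\<^sub>0 = 0\<close> by (auto simp: q_def)
  qed
  moreover have "((\<lambda>s. q s * ((y s - y s\<^sub>0) / (s - s\<^sub>0))) \<longlongrightarrow> c * u) (at s\<^sub>0 within S)"
    using q y unfolding has_field_derivative_iff by (rule tendsto_mult)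
  ultimately have "((\<lambda>s. (\<phi> s - \<phi> s\<^sub>0) / (s - s\<^sub>0)) \<longlongrightarrow> c * u) (at s\<^sub>0 within S)"
    by (rule Lim_transform_eventually[rotated])
  then show ?thesis
    unfolding has_field_derivative_iff by (simp only: mult.commute)
qed

lemma mvt_partial:
  assumes "\<And>r. \<bar>r - x i\<bar> \<le> \<bar>b - x i\<bar> \<Longrightarrow> (\<lambda>s. f ((x(i := r))(i := s))) differentiable at r"
  obtains r where "\<bar>r - x i\<bar> \<le> \<bar>b - x i\<bar>"
    "f (x(i := b)) - f x = (b - x i) * partial i f (x(i := r))"
proof -
  have der: "((\<lambda>s. f (x(i := s))) has_real_derivative partial i f (x(i := r))) (at r)"
    if "\<bar>r - x i\<bar> \<le> \<bar>b - x i\<bar>" for r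
    using assms[OF that] by (auto simp: partial_def DERIV_deriv_iff_real_differentiable)
  consider "b = x i" | "x i < b" | "b < x i" by linarith
  then show thesis
  proof cases
    case 2
    obtain r where "x i < r" "r < b"
      "f (x(i := b)) - f (x(i := x i)) = (b - x i) * partial i f (x(i := r))"
      using MVT2[OF 2, of "\<lambda>s. f (x(i := s))" "\<lambda>r. partial i f (x(i := r))"] der by auto
    then show thesis by (intro that[of r]) auto
  next
    case 3
    obtain r where "b < r" "r < x i"
      "f (x(i := x i)) - f (x(i := b)) = (x i - b) * partial i f (x(i := r))"
      using MVT2[OF 3, of "\<lambda>s. f (x(i := s))" "\<lambda>r. partial i f (x(i := r))"] der by auto
    then show thesis by (intro that[of r]) (auto simp: algebra_simps)
  qed (auto intro: that[of "x i"])
qed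

text \<open>The increment of \<open>f\<close> is telescoped along the edges of the box spanned by \<open>x s\<^sub>0\<close> and \<open>x s\<close>; the
  mean value theorem applies to each edge.\<close>

lemma chain_rule_Euclidean_space:
  fixes x :: "real \<Rightarrow> nat \<Rightarrow> real"
  assumes V: "openin (Euclidean_space n) V" and f: "Ck_on n 1 V f"
    and xV: "\<And>s. s \<in> S \<Longrightarrow> x s \<in> V" and s\<^sub>0: "s\<^sub>0 \<in> S"
    and x: "\<And>i. i < n \<Longrightarrow> ((\<lambda>s. x s i) has_real_derivative u i) (at s\<^sub>0 within S)"
  shows "((\<lambda>s. f (x s)) has_real_derivative (\<Sum>i<n. u i * partial i f (x s\<^sub>0))) (at s\<^sub>0 within S)"
proof -
  \<comment> \<open>Corners of the edge path: in \<open>z s k\<close> the first \<open>k\<close>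
    coordinates have already moved from \<open>x s\<^sub>0\<close> to \<open>x s\<close>.\<close>
  define z where "z s k = (\<lambda>i. if i < k then x s i else x s\<^sub>0 i)" for s k
  have top: "V \<subseteq> {x. \<forall>i\<ge>n. x i = 0}"
    using openin_subset[OF V] by (simp add: topspace_Euclidean_space)
  have zero: "x s i = 0" if "s \<in> S" "i \<ge> n" for s i
    using xV[OF that(1)] that(2) top by auto
  have z0: "z s 0 = x s\<^sub>0" for s by (simp add: z_def)
  have zn: "z s n = x s" if "s \<in> S" for s
    using that zero s\<^sub>0 by (auto simp: z_def fun_eq_iff)
  have zSuc: "z s (Suc i) = (z s i)(i := x s i)" for s i
    by (auto simp: z_def fun_eq_iff less_Suc_eq)
  have zi: "z s i i = x s\<^sub>0 i" for s i
    by (simp add: z_def)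
  have close: "\<forall>\<^sub>F s in at s\<^sub>0 within S. s \<in> S \<and> (\<forall>i<n. \<bar>x s i - x s\<^sub>0 i\<bar> < e)" if "e > 0" for e
  proof -
    have "\<forall>\<^sub>F s in at s\<^sub>0 within S. \<forall>i\<in>{..<n}. dist (x s i) (x s\<^sub>0 i) < e"
    proof (rule eventually_ball_finite, simp, rule ballI)
      fix i assume "i \<in> {..<n}"
      then have "((\<lambda>s. x s i) \<longlongrightarrow> x s\<^sub>0 i) (at s\<^sub>0 within S)"
        using DERIV_continuous[OF x] unfolding continuous_within by simp
      then show "\<forall>\<^sub>F s in at s\<^sub>0 within S. dist (x s i) (x s\<^sub>0 i) < e"
        using that by (rule tendstoD)
    qed
    moreover have "\<forall>\<^sub>F s in at s\<^sub>0 within S. s \<in> S"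
      by (simp add: eventually_at_filter)
    ultimately show ?thesis
      by eventually_elim (auto simp: dist_real_def)
  qed
  have "((\<lambda>s. f (z s (Suc i)) - f (z s i)) has_real_derivative u i * partial i f (x s\<^sub>0))
      (at s\<^sub>0 within S)" if i: "i < n" for i
  proof (rule has_real_derivative_comp_increment[OF x[OF i]])
    have "z s\<^sub>0 k = x s\<^sub>0" for k by (auto simp: z_def)
    then show "f (z s\<^sub>0 (Suc i)) - f (z s\<^sub>0 i) = 0" by simp
    fix \<epsilon> :: real assume "\<epsilon> > 0"
    have diff: "\<forall>x\<in>V. (\<lambda>s. f (x(i := s))) differentiable at (x i)"
      and cont: "continuous_map (subtopology (Euclidean_space n) V) euclideanreal (partial i f)"
      using f i by simp_all
    obtain e where e: "e > 0" "\<And>y. \<forall>i\<ge>n. y i = 0 \<Longrightarrow> \<forall>i<n. \<bar>y i - x s\<^sub>0 i\<bar> < e \<Longrightarrow>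
        y \<in> V \<and> \<bar>partial i f y - partial i f (x s\<^sub>0)\<bar> < \<epsilon>"
      using continuous_map_Euclidean_space_box[OF V xV[OF s\<^sub>0] cont \<open>\<epsilon> > 0\<close>] by metis
    show "\<forall>\<^sub>F s in at s\<^sub>0 within S.
        \<bar>f (z s (Suc i)) - f (z s i) - partial i f (x s\<^sub>0) * (x s i - x s\<^sub>0 i)\<bar> \<le> \<epsilon> * \<bar>x s i - x s\<^sub>0 i\<bar>"
      using close[OF e(1)]
    proof (rule eventually_mono, elim conjE)
      fix s assume s: "s \<in> S" "\<forall>i<n. \<bar>x s i - x s\<^sub>0 i\<bar> < e"
      \<comment> \<open>The whole edge lies in the small box around \<open>x s\<^sub>0\<close>,
        where the partial derivative differs by less than \<open>\<epsilon>\<close> from its value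
        at the centre.\<close>
      have near: "(z s i)(i := r) \<in> V \<and>
          \<bar>partial i f ((z s i)(i := r)) - partial i f (x s\<^sub>0)\<bar> < \<epsilon>"
        if "\<bar>r - x s\<^sub>0 i\<bar> \<le> \<bar>x s i - x s\<^sub>0 i\<bar>" for r
        using i s(2) that zero[OF s\<^sub>0] \<open>e > 0\<close> by (intro e(2)) (force simp: z_def)+
      obtain r where r: "\<bar>r - z s i i\<bar> \<le> \<bar>x s i - z s i i\<bar>"
        "f ((z s i)(i := x s i)) - f (z s i) = (x s i - z s i i) * partial i f ((z s i)(i := r))"
      proof (rule mvt_partial[of "z s i" i "x s i" f])
        fix r assume "\<bar>r - z s i i\<bar> \<le> \<bar>x s i - z s i i\<bar>"
        then have "(z s i)(i := r) \<in> V" using near unfolding zi by blast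
        from bspec[OF diff this] show "(\<lambda>s'. f ((z s i)(i := r, i := s'))) differentiable at r"
          by simp
      qed
      have "f (z s (Suc i)) - f (z s i) - partial i f (x s\<^sub>0) * (x s i - x s\<^sub>0 i) =
          (partial i f ((z s i)(i := r)) - partial i f (x s\<^sub>0)) * (x s i - x s\<^sub>0 i)"
        unfolding zSuc r(2) zi by (simp add: algebra_simps)
      moreover have "\<bar>partial i f ((z s i)(i := r)) - partial i f (x s\<^sub>0)\<bar> \<le> \<epsilon>"
        using near[of r] r(1) unfolding zi by auto
      ultimately show "\<bar>f (z s (Suc i)) - f (z s i) - partial i f (x s\<^sub>0) * (x s i - x s\<^sub>0 i)\<bar> \<le>
          \<epsilon> * \<bar>x s i - x s\<^sub>0 i\<bar>"
        by (simp add: abs_mult mult_right_mono)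
    qed
  qed
  then have "((\<lambda>s. f (x s\<^sub>0) + (\<Sum>i<n. f (z s (Suc i)) - f (z s i))) has_real_derivative
      0 + (\<Sum>i<n. u i * partial i f (x s\<^sub>0))) (at s\<^sub>0 within S)"
    by (intro DERIV_add DERIV_const DERIV_sum) auto
  moreover have "f (x s\<^sub>0) + (\<Sum>i<n. f (z s (Suc i)) - f (z s i)) = f (x s)" if "s \<in> S" for s
    using zn[OF that] by (simp add: sum_lessThan_telescope[of "\<lambda>k. f (z s k)"] z0)
  ultimately show ?thesis
    using s\<^sub>0 by (auto elim!: has_field_derivative_transform_within[where d = 1])
qed

section \<open>Partial derivatives in charts\<close>

text \<open>
  This is what partial derivatives need: through every point of a chart and inside every
  neighbourhood of that point, short pieces of the coordinate lines exist. The condition passes to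
  products and to open submanifolds without any smoothness.
\<close>

definition regular_atlas :: "('i, 'a) manifold \<Rightarrow> bool" where
  "regular_atlas M \<longleftrightarrow>
     (\<forall>c\<in>charts M. openin (topo M) (cdom M c) \<and> inj_on (coord M c) (cdom M c) \<and>
       (\<forall>p\<in>cdom M c. \<forall>k\<ge>mdim M. coord M c p k = 0) \<and>
       (\<forall>W. openin (topo M) W \<longrightarrow> (\<forall>p\<in>cdom M c \<inter> W. \<forall>i<mdim M.
          \<forall>\<^sub>F s in nhds (coord M c p i). (coord M c p)(i := s) \<in> coord M c ` (cdom M c \<inter> W))))"

lemma regular_atlasD:
  assumes "regular_atlas M" "c \<in> charts M"
  shows regular_atlas_openin: "openin (topo M) (cdom M c)"
    and regular_atlas_inj: "inj_on (coord M c) (cdom M c)"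
    and regular_atlas_zero: "p \<in> cdom M c \<Longrightarrow> mdim M \<le> k \<Longrightarrow> coord M c p k = 0"
    and regular_atlas_line: "openin (topo M) W \<Longrightarrow> p \<in> cdom M c \<Longrightarrow> p \<in> W \<Longrightarrow> i < mdim M \<Longrightarrow>
      \<forall>\<^sub>F s in nhds (coord M c p i). (coord M c p)(i := s) \<in> coord M c ` (cdom M c \<inter> W)"
  using assms unfolding regular_atlas_def by blast+

lemma regular_atlas_line_chart:
  assumes "regular_atlas M" "c \<in> charts M" "p \<in> cdom M c" "i < mdim M"
  shows "\<forall>\<^sub>F s in nhds (coord M c p i). (coord M c p)(i := s) \<in> coord M c ` cdom M c"
  using regular_atlas_line[OF assms(1,2) regular_atlas_openin[OF assms(1,2)] assms(3,3,4)]
  by (simp only: Int_absorb)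

lemma regular_atlasI:
  assumes "\<And>c. c \<in> charts M \<Longrightarrow> openin (topo M) (cdom M c)"
    and "\<And>c. c \<in> charts M \<Longrightarrow> inj_on (coord M c) (cdom M c)"
    and "\<And>c p k. c \<in> charts M \<Longrightarrow> p \<in> cdom M c \<Longrightarrow> mdim M \<le> k \<Longrightarrow> coord M c p k = 0"
    and "\<And>c W p i. c \<in> charts M \<Longrightarrow> openin (topo M) W \<Longrightarrow> p \<in> cdom M c \<Longrightarrow> p \<in> W \<Longrightarrow> i < mdim M \<Longrightarrow>
      \<forall>\<^sub>F s in nhds (coord M c p i). (coord M c p)(i := s) \<in> coord M c ` (cdom M c \<inter> W)"
  shows "regular_atlas M"
  using assms unfolding regular_atlas_def by blast

text \<open>A chart is a homeomorphism onto an open set of the model space, so the image of a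
  smaller open set is open there and contains a box, in particular a piece of every coordinate
  line.\<close>

lemma smooth_manifold_regular_atlas:
  assumes "smooth_manifold M"
  shows "regular_atlas M"
  unfolding regular_atlas_def
proof (intro ballI conjI allI impI)
  fix c assume c: "c \<in> charts M"
  have op: "openin (topo M) (cdom M c)" "openin (Euclidean_space (mdim M)) (coord M c ` cdom M c)"
    and hom: "homeomorphic_map (subtopology (topo M) (cdom M c))
          (subtopology (Euclidean_space (mdim M)) (coord M c ` cdom M c)) (coord M c)"
    using assms c unfolding smooth_manifold_def by auto
  have sub: "cdom M c \<subseteq> topspace (topo M)"
    using op(1) by (rule openin_subset)
  show "openin (topo M) (cdom M c)" by fact
  show "inj_on (coord M c) (cdom M c)"
    using hom sub unfolding homeomorphic_map_def by (simp add: inf_absorb2)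
  have top: "coord M c ` cdom M c \<subseteq> {x. \<forall>i\<ge>mdim M. x i = 0}"
    using openin_subset[OF op(2)] by (simp add: topspace_Euclidean_space)
  show "coord M c p k = 0" if "p \<in> cdom M c" "mdim M \<le> k" for p k
    using top that by auto
  fix W p i assume W: "openin (topo M) W" and p: "p \<in> cdom M c \<inter> W" and i: "i < mdim M"
  have "openin (subtopology (topo M) (cdom M c)) (cdom M c \<inter> W)"
    using W by (simp add: openin_subtopology_Int2)
  then have "openin (subtopology (Euclidean_space (mdim M)) (coord M c ` cdom M c))
      (coord M c ` (cdom M c \<inter> W))"
    using hom homeomorphic_map_openness[OF hom, of "cdom M c \<inter> W"] sub by auto
  then have "openin (Euclidean_space (mdim M)) (coord M c ` (cdom M c \<inter> W))"
    using op(2) openin_trans_full by blast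
  then show "\<forall>\<^sub>F s in nhds (coord M c p i). (coord M c p)(i := s) \<in> coord M c ` (cdom M c \<inter> W)"
  proof (rule openin_Euclidean_space_box)
    show "coord M c p \<in> coord M c ` (cdom M c \<inter> W)" using p by blast
    fix e :: real
    assume e: "e > 0" "\<And>y. \<forall>i\<ge>mdim M. y i = 0 \<Longrightarrow> \<forall>i<mdim M. \<bar>y i - coord M c p i\<bar> < e \<Longrightarrow>
      y \<in> coord M c ` (cdom M c \<inter> W)"
    have "(coord M c p)(i := s) \<in> coord M c ` (cdom M c \<inter> W)" if "dist s (coord M c p i) < e" for s
      using that i e(1) top p by (intro e(2)) (auto simp: dist_real_def)
    then show ?thesis using e(1) unfolding eventually_nhds_metric by blast
  qed
qed

section \<open>Atlases of products, open sets of reals and open submanifolds\<close>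

lemma prod_manifold_simps [simp]:
  "topo (prod_manifold M N) = prod_topology (topo M) (topo N)"
  "mdim (prod_manifold M N) = mdim M + mdim N"
  "charts (prod_manifold M N) = charts M \<times> charts N"
  "cdom (prod_manifold M N) (c, d) = cdom M c \<times> cdom N d"
  "coord (prod_manifold M N) (c, d) (p, q) k =
     (if k < mdim M then coord M c p k else coord N d q (k - mdim M))"
  by (simp_all add: prod_manifold_def)

lemma real_manifold_simps [simp]:
  "topo (real_manifold S) = subtopology euclideanreal S"
  "mdim (real_manifold S) = Suc 0"
  "charts (real_manifold S) = {()}"
  "cdom (real_manifold S) = (\<lambda>_. S)"
  "coord (real_manifold S) c s k = (if k = 0 then s else 0)"
  by (simp_all add: real_manifold_def)

lemma open_submanifold_simps [simp]:
  "topo (open_submanifold M W) = subtopology (topo M) W"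
  "mdim (open_submanifold M W) = mdim M"
  "charts (open_submanifold M W) = charts M"
  "cdom (open_submanifold M W) c = cdom M c \<inter> W"
  "coord (open_submanifold M W) = coord M"
  by (simp_all add: open_submanifold_def)

lemma regular_atlas_real_manifold:
  assumes "open S"
  shows "regular_atlas (real_manifold S)"
  unfolding regular_atlas_def
proof (intro ballI conjI allI impI)
  fix c :: unit and W p i
  assume "openin (topo (real_manifold S)) W" and p: "p \<in> cdom (real_manifold S) c \<inter> W"
    and i: "i < mdim (real_manifold S)"
  then have W: "open W" "W \<subseteq> S"
    using assms openin_open_eq by auto
  have "\<forall>\<^sub>F s in nhds p. s \<in> W"
    using W(1) p by (intro eventually_nhds_in_open) auto
  then have "\<forall>\<^sub>F s in nhds p. (coord (real_manifold S) c p)(0 := s) \<in> coord (real_manifold S) c ` (S \<inter> W)"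
  proof (rule eventually_mono)
    fix s assume "s \<in> W"
    then show "(coord (real_manifold S) c p)(0 := s) \<in> coord (real_manifold S) c ` (S \<inter> W)"
      using W(2) by (intro image_eqI[of _ _ s]) (auto simp: fun_eq_iff)
  qed
  then show "\<forall>\<^sub>F s in nhds (coord (real_manifold S) c p i). (coord (real_manifold S) c p)(i := s) \<in>
      coord (real_manifold S) c ` (cdom (real_manifold S) c \<inter> W)"
    using i by simp
qed (auto intro!: inj_onI dest: fun_cong[of _ _ 0])

text \<open>A coordinate line of the product moves one factor only, and a short piece of it stays in
  a product neighbourhood \<open>U \<times> V\<close> inside \<open>W\<close>.\<close>

lemma regular_atlas_prod_manifold:
  assumes M: "regular_atlas M" and N: "regular_atlas N"
  shows "regular_atlas (prod_manifold M N)"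
proof (rule regular_atlasI)
  let ?P = "prod_manifold M N"
  fix cd assume cd: "cd \<in> charts ?P"
  then obtain c d where [simp]: "cd = (c, d)" and c: "c \<in> charts M" and d: "d \<in> charts N" by auto
  show "openin (topo ?P) (cdom ?P cd)"
    using regular_atlas_openin[OF M c] regular_atlas_openin[OF N d]
    by (simp add: openin_prod_Times_iff)
  have zero: "coord ?P cd x k = 0" if "x \<in> cdom ?P cd" "mdim ?P \<le> k" for x k
    using that regular_atlas_zero[OF N d, of "snd x" "k - mdim M"] by (cases x) auto
  then show "x \<in> cdom ?P cd \<Longrightarrow> mdim ?P \<le> k \<Longrightarrow> coord ?P cd x k = 0" for x k .
  show "inj_on (coord ?P cd) (cdom ?P cd)"
  proof (rule inj_onI)
    fix x y assume x: "x \<in> cdom ?P cd" and y: "y \<in> cdom ?P cd"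
      and eq: "coord ?P cd x = coord ?P cd y"
    obtain p q p' q' where [simp]: "x = (p, q)" "y = (p', q')" by (metis prod.exhaust)
    have pq: "p \<in> cdom M c" "q \<in> cdom N d" "p' \<in> cdom M c" "q' \<in> cdom N d"
      using x y by simp_all
    have "coord M c p k = coord M c p' k" for k
      using fun_cong[OF eq, of k] regular_atlas_zero[OF M c, of _ k] pq
      by (cases "k < mdim M") auto
    then have "coord M c p = coord M c p'" by (rule ext)
    then have "p = p'" using inj_onD[OF regular_atlas_inj[OF M c]] pq by blast
    moreover have "coord N d q k = coord N d q' k" for k
      using fun_cong[OF eq, of "mdim M + k"] by simp
    then have "coord N d q = coord N d q'" by (rule ext)
    then have "q = q'" using inj_onD[OF regular_atlas_inj[OF N d]] pq by blast
    ultimately show "x = y" by simp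
  qed
  fix W x i
  assume W': "openin (topo ?P) W" and x: "x \<in> cdom ?P cd" "x \<in> W" and i: "i < mdim ?P"
  obtain p q where [simp]: "x = (p, q)" by (rule prod.exhaust)
  have W: "openin (prod_topology (topo M) (topo N)) W"
    using W' by (simp only: prod_manifold_simps)
  have p: "p \<in> cdom M c" and q: "q \<in> cdom N d" and pq: "(p, q) \<in> W"
    using x by (simp_all only: prod_manifold_simps \<open>x = (p, q)\<close> \<open>cd = (c, d)\<close> mem_Times_iff fst_conv snd_conv)
  obtain U V where UV: "openin (topo M) U" "openin (topo N) V" "p \<in> U" "q \<in> V" "U \<times> V \<subseteq> W"
    using W[unfolded openin_prod_topology_alt, rule_format, OF pq] by (elim exE conjE) (rule that)
  show "\<forall>\<^sub>F s in nhds (coord ?P cd x i). (coord ?P cd x)(i := s) \<in> coord ?P cd ` (cdom ?P cd \<inter> W)"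
  proof (cases "i < mdim M")
    case True
    then have eq: "coord ?P cd x i = coord M c p i" by simp
    show ?thesis unfolding eq
    proof (rule eventually_mono[OF regular_atlas_line[OF M c UV(1) p UV(3) True]])
      fix s assume "(coord M c p)(i := s) \<in> coord M c ` (cdom M c \<inter> U)"
      then obtain p' where p': "p' \<in> cdom M c" "p' \<in> U" "(coord M c p)(i := s) = coord M c p'" by auto
      have "coord M c p' k = (if k = i then s else coord M c p k)" for k
        unfolding p'(3)[symmetric] by simp
      then have "(coord ?P cd x)(i := s) = coord ?P cd (p', q)"
        using True by (auto simp: fun_eq_iff)
      then show "(coord ?P cd x)(i := s) \<in> coord ?P cd ` (cdom ?P cd \<inter> W)"
        using p' UV(4,5) q by auto
    qed
  next
    case False
    then have eq: "coord ?P cd x i = coord N d q (i - mdim M)" by simp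
    have j: "i - mdim M < mdim N" using i False by simp
    show ?thesis unfolding eq
    proof (rule eventually_mono[OF regular_atlas_line[OF N d UV(2) q UV(4) j]])
      fix s assume "(coord N d q)(i - mdim M := s) \<in> coord N d ` (cdom N d \<inter> V)"
      then obtain q' where q': "q' \<in> cdom N d" "q' \<in> V" "(coord N d q)(i - mdim M := s) = coord N d q'"
        by auto
      have "coord N d q' k = (if k = i - mdim M then s else coord N d q k)" for k
        unfolding q'(3)[symmetric] by simp
      then have "(coord ?P cd x)(i := s) = coord ?P cd (p, q')"
        using False by (auto simp: fun_eq_iff)
      then show "(coord ?P cd x)(i := s) \<in> coord ?P cd ` (cdom ?P cd \<inter> W)"
        using q' UV(3,5) p by auto
    qed
  qed
qed

lemma regular_atlas_open_submanifold:
  assumes M: "regular_atlas M" and W: "openin (topo M) W"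
  shows "regular_atlas (open_submanifold M W)"
  unfolding regular_atlas_def
proof (intro ballI conjI allI impI)
  fix c assume "c \<in> charts (open_submanifold M W)"
  then have c: "c \<in> charts M" by simp
  show "openin (topo (open_submanifold M W)) (cdom (open_submanifold M W) c)"
    using regular_atlas_openin[OF M c] by (simp add: openin_subtopology_Int)
  show "inj_on (coord (open_submanifold M W) c) (cdom (open_submanifold M W) c)"
    using regular_atlas_inj[OF M c] by (auto intro: inj_on_subset)
  show "coord (open_submanifold M W) c p k = 0"
    if "p \<in> cdom (open_submanifold M W) c" "mdim (open_submanifold M W) \<le> k" for p k
    using that regular_atlas_zero[OF M c] by simp
  fix W' p i
  assume "openin (topo (open_submanifold M W)) W'" "p \<in> cdom (open_submanifold M W) c \<inter> W'"
    "i < mdim (open_submanifold M W)"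
  then have W': "openin (topo M) W'" "W' \<subseteq> W" and p: "p \<in> cdom M c" "p \<in> W'" and i: "i < mdim M"
    using W openin_trans_full[of "topo M" W W'] openin_imp_subset[of "topo M" W W'] by auto
  have "cdom M c \<inter> W \<inter> W' = cdom M c \<inter> W'" using W'(2) by blast
  with regular_atlas_line[OF M c W'(1) p i]
  show "\<forall>\<^sub>F s in nhds (coord (open_submanifold M W) c p i). (coord (open_submanifold M W) c p)(i := s) \<in>
     coord (open_submanifold M W) c ` (cdom (open_submanifold M W) c \<inter> W')"
    by simp
qed

section \<open>Partial derivatives in products and open submanifolds, and the chain rule in a
  chart\<close>

lemma pd_cong:
  assumes "regular_atlas M" "c \<in> charts M" "p \<in> cdom M c" "i < mdim M"
    and "\<And>q. q \<in> cdom M c \<Longrightarrow> f q = g q"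
  shows "pd M c i f p = pd M c i g p"
  unfolding pd_def partial_def
  by (rule deriv_cong_ev[OF eventually_mono[OF regular_atlas_line_chart[OF assms(1-4)]] refl])
    (auto intro!: assms(5) inv_into_into)

lemma pd_const [simp]: "pd M c i (\<lambda>_. k) p = 0"
  by (simp add: pd_def partial_def)

text \<open>The inverse of a product chart can be compared with that of a factor only on the image
  of the chart. A short piece of the coordinate line stays in that image, so the derivatives are
  those of eventually equal functions.\<close>

lemma pd_prod_manifold:
  assumes M: "regular_atlas M" and N: "regular_atlas N"
    and c: "c \<in> charts M" and d: "d \<in> charts N" and p: "p \<in> cdom M c" and q: "q \<in> cdom N d"
    and i: "i < mdim M + mdim N"
  shows "pd (prod_manifold M N) (c, d) i f (p, q) =
    (if i < mdim M then pd M c i (\<lambda>p'. f (p', q)) p else pd N d (i - mdim M) (\<lambda>q'. f (p, q')) q)"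
proof -
  have inj: "inj_on (coord (prod_manifold M N) (c, d)) (cdom M c \<times> cdom N d)"
    using regular_atlas_inj[OF regular_atlas_prod_manifold[OF M N], of "(c, d)"] c d by simp
  note inv = inv_into_f_f[OF inj] inv_into_f_f[OF regular_atlas_inj[OF M c]]
    inv_into_f_f[OF regular_atlas_inj[OF N d]]
  show ?thesis
  proof (cases "i < mdim M")
    case True
    have "\<forall>\<^sub>F s in nhds (coord M c p i).
        f (inv_into (cdom (prod_manifold M N) (c, d)) (coord (prod_manifold M N) (c, d))
             ((coord (prod_manifold M N) (c, d) (p, q))(i := s))) =
        f (inv_into (cdom M c) (coord M c) ((coord M c p)(i := s)), q)"
    proof (rule eventually_mono[OF regular_atlas_line_chart[OF M c p True]])
      fix s assume "(coord M c p)(i := s) \<in> coord M c ` cdom M c"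
      then obtain p' where p': "p' \<in> cdom M c" "(coord M c p)(i := s) = coord M c p'" by auto
      have "coord M c p' k = (if k = i then s else coord M c p k)" for k
        unfolding p'(2)[symmetric] by simp
      then have "(coord (prod_manifold M N) (c, d) (p, q))(i := s) = coord (prod_manifold M N) (c, d) (p', q)"
        using True by (auto simp: fun_eq_iff)
      with p' q show "f (inv_into (cdom (prod_manifold M N) (c, d)) (coord (prod_manifold M N) (c, d))
             ((coord (prod_manifold M N) (c, d) (p, q))(i := s))) =
          f (inv_into (cdom M c) (coord M c) ((coord M c p)(i := s)), q)"
        by (simp add: inv)
    qed
    from deriv_cong_ev[OF this refl] True show ?thesis
      by (simp add: pd_def partial_def)
  next
    case False
    then have j: "i - mdim M < mdim N" using i by simp
    have "\<forall>\<^sub>F s in nhds (coord N d q (i - mdim M)).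
        f (inv_into (cdom (prod_manifold M N) (c, d)) (coord (prod_manifold M N) (c, d))
             ((coord (prod_manifold M N) (c, d) (p, q))(i := s))) =
        f (p, inv_into (cdom N d) (coord N d) ((coord N d q)(i - mdim M := s)))"
    proof (rule eventually_mono[OF regular_atlas_line_chart[OF N d q j]])
      fix s assume "(coord N d q)(i - mdim M := s) \<in> coord N d ` cdom N d"
      then obtain q' where q': "q' \<in> cdom N d" "(coord N d q)(i - mdim M := s) = coord N d q'" by auto
      have "coord N d q' k = (if k = i - mdim M then s else coord N d q k)" for k
        unfolding q'(2)[symmetric] by simp
      then have "(coord (prod_manifold M N) (c, d) (p, q))(i := s) = coord (prod_manifold M N) (c, d) (p, q')"
        using False by (auto simp: fun_eq_iff)
      with q' p show "f (inv_into (cdom (prod_manifold M N) (c, d)) (coord (prod_manifold M N) (c, d))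
             ((coord (prod_manifold M N) (c, d) (p, q))(i := s))) =
          f (p, inv_into (cdom N d) (coord N d) ((coord N d q)(i - mdim M := s)))"
        by (simp add: inv)
    qed
    from deriv_cong_ev[OF this refl] False show ?thesis
      by (simp add: pd_def partial_def)
  qed
qed

lemma pd_real_manifold:
  assumes "open S" "s \<in> S"
  shows "pd (real_manifold S) c 0 f s = deriv f s"
  unfolding pd_def partial_def
proof (rule deriv_cong_ev[OF eventually_mono[OF eventually_nhds_in_open]])
  fix r assume "r \<in> S"
  moreover have "(coord (real_manifold S) c s)(0 := r) = coord (real_manifold S) c r"
    by (auto simp: fun_eq_iff)
  moreover have "inj_on (coord (real_manifold S) c) S"
    using regular_atlas_inj[OF regular_atlas_real_manifold[OF assms(1)], of c] by simp
  ultimately show "f (inv_into (cdom (real_manifold S) c) (coord (real_manifold S) c)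
      ((coord (real_manifold S) c s)(0 := r))) = f r"
    by (simp add: inv_into_f_f)
qed (use assms in auto)

lemma pd_open_submanifold:
  assumes M: "regular_atlas M" and W: "openin (topo M) W" and c: "c \<in> charts M"
    and p: "p \<in> cdom M c" "p \<in> W" and i: "i < mdim M"
  shows "pd (open_submanifold M W) c i f p = pd M c i f p"
proof -
  note inj = regular_atlas_inj[OF M c]
  have "\<forall>\<^sub>F s in nhds (coord M c p i).
      f (inv_into (cdom M c \<inter> W) (coord M c) ((coord M c p)(i := s))) =
      f (inv_into (cdom M c) (coord M c) ((coord M c p)(i := s)))"
  proof (rule eventually_mono[OF regular_atlas_line[OF M c W p i]])
    fix s assume "(coord M c p)(i := s) \<in> coord M c ` (cdom M c \<inter> W)"
    then obtain p' where p': "p' \<in> cdom M c" "p' \<in> W" "(coord M c p)(i := s) = coord M c p'" by auto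
    then show "f (inv_into (cdom M c \<inter> W) (coord M c) ((coord M c p)(i := s))) =
        f (inv_into (cdom M c) (coord M c) ((coord M c p)(i := s)))"
      using inv_into_f_f[OF inj] inv_into_f_f[OF inj_on_subset[OF inj, of "cdom M c \<inter> W"]] by simp
  qed
  from deriv_cong_ev[OF this refl] show ?thesis
    by (simp add: pd_def partial_def)
qed

text \<open>The chain rule itself is taken as the property, for arbitrary maps and within arbitrary
  sets \<open>S\<close>. It thus includes one-sided derivatives, and it passes from a factor to a
  product without any smoothness of the product atlas.\<close>

definition differentiable_in_chart :: "('i, 'a) manifold \<Rightarrow> 'i \<Rightarrow> ('a \<Rightarrow> real) \<Rightarrow> bool" where
  "differentiable_in_chart M c f \<longleftrightarrow>
     (\<forall>\<gamma> S s u. \<gamma> ` S \<subseteq> cdom M c \<longrightarrow> s \<in> S \<longrightarrow>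
        (\<forall>i<mdim M. ((\<lambda>s. coord M c (\<gamma> s) i) has_real_derivative u i) (at s within S)) \<longrightarrow>
        ((\<lambda>s. f (\<gamma> s)) has_real_derivative (\<Sum>i<mdim M. u i * pd M c i f (\<gamma> s))) (at s within S))"

lemma differentiable_in_chartD:
  assumes "differentiable_in_chart M c f" "\<gamma> ` S \<subseteq> cdom M c" "s \<in> S"
    "\<And>i. i < mdim M \<Longrightarrow> ((\<lambda>s. coord M c (\<gamma> s) i) has_real_derivative u i) (at s within S)"
  shows "((\<lambda>s. f (\<gamma> s)) has_real_derivative (\<Sum>i<mdim M. u i * pd M c i f (\<gamma> s))) (at s within S)"
  using assms unfolding differentiable_in_chart_def by blast

lemma differentiable_in_chart_const [simp]: "differentiable_in_chart M c (\<lambda>_. k)"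
  by (simp add: differentiable_in_chart_def)

lemma smooth_on_differentiable_in_chart:
  assumes M: "smooth_manifold M" and c: "c \<in> charts M"
    and f: "smooth_on (mdim M) (coord M c ` cdom M c) (\<lambda>x. f (inv_into (cdom M c) (coord M c) x))"
  shows "differentiable_in_chart M c f"
  unfolding differentiable_in_chart_def
proof (intro allI impI)
  fix \<gamma> S s u
  assume \<gamma>: "\<gamma> ` S \<subseteq> cdom M c" and s: "s \<in> S"
    and u: "\<forall>i<mdim M. ((\<lambda>s. coord M c (\<gamma> s) i) has_real_derivative u i) (at s within S)"
  have V: "openin (Euclidean_space (mdim M)) (coord M c ` cdom M c)"
    using M c unfolding smooth_manifold_def by blast
  have inj: "inj_on (coord M c) (cdom M c)"
    using smooth_manifold_regular_atlas[OF M] c by (rule regular_atlas_inj)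
  have "((\<lambda>s. f (inv_into (cdom M c) (coord M c) (coord M c (\<gamma> s)))) has_real_derivative
     (\<Sum>i<mdim M. u i * partial i (\<lambda>x. f (inv_into (cdom M c) (coord M c) x)) (coord M c (\<gamma> s))))
     (at s within S)"
    using chain_rule_Euclidean_space[OF V f[unfolded smooth_on_def, rule_format], of S "\<lambda>s. coord M c (\<gamma> s)" s u]
      \<gamma> s u by blast
  then show "((\<lambda>s. f (\<gamma> s)) has_real_derivative (\<Sum>i<mdim M. u i * pd M c i f (\<gamma> s))) (at s within S)"
    unfolding pd_def
    by (rule has_field_derivative_transform_within[where d = 1])
      (use \<gamma> s inv_into_f_f[OF inj] in auto)
qed

lemma sum_lessThan_add:
  fixes f :: "nat \<Rightarrow> 'a::comm_monoid_add"
  shows "(\<Sum>i<m + n. f i) = (\<Sum>i<m. f i) + (\<Sum>i<n. f (m + i))"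
  by (induction n) (auto simp: add.assoc)

lemma differentiable_in_chart_fst:
  assumes M: "regular_atlas M" and N: "regular_atlas N" and c: "c \<in> charts M" and d: "d \<in> charts N"
    and f: "differentiable_in_chart M c f"
  shows "differentiable_in_chart (prod_manifold M N) (c, d) (\<lambda>x. f (fst x))"
  unfolding differentiable_in_chart_def
proof (intro allI impI)
  fix \<gamma> S s u
  assume \<gamma>: "\<gamma> ` S \<subseteq> cdom (prod_manifold M N) (c, d)" and s: "s \<in> S"
    and u: "\<forall>i<mdim (prod_manifold M N). ((\<lambda>s. coord (prod_manifold M N) (c, d) (\<gamma> s) i)
      has_real_derivative u i) (at s within S)"
  have "((\<lambda>s. coord M c (fst (\<gamma> s)) i) has_real_derivative u i) (at s within S)" if "i < mdim M" for i
    using u[rule_format, of i] that by (cases "\<gamma> s") (simp add: prod_manifold_def case_prod_unfold)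
  moreover have "(\<lambda>s. fst (\<gamma> s)) ` S \<subseteq> cdom M c" using \<gamma> by auto
  ultimately have "((\<lambda>s. f (fst (\<gamma> s))) has_real_derivative
      (\<Sum>i<mdim M. u i * pd M c i f (fst (\<gamma> s)))) (at s within S)"
    using s by (intro differentiable_in_chartD[OF f])
  moreover obtain p q where pq: "\<gamma> s = (p, q)" by fastforce
  have "p \<in> cdom M c" "q \<in> cdom N d" using \<gamma> s pq by force+
  then have "(\<Sum>i<mdim M + mdim N. u i * pd (prod_manifold M N) (c, d) i (\<lambda>x. f (fst x)) (p, q)) =
      (\<Sum>i<mdim M. u i * pd M c i f p)"
    unfolding sum_lessThan_add by (simp add: pd_prod_manifold[OF M N c d])
  ultimately show "((\<lambda>s. f (fst (\<gamma> s))) has_real_derivative (\<Sum>i<mdim (prod_manifold M N).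
      u i * pd (prod_manifold M N) (c, d) i (\<lambda>x. f (fst x)) (\<gamma> s))) (at s within S)"
    using pq by simp
qed

lemma differentiable_in_chart_snd:
  assumes M: "regular_atlas M" and N: "regular_atlas N" and c: "c \<in> charts M" and d: "d \<in> charts N"
    and f: "differentiable_in_chart N d f"
  shows "differentiable_in_chart (prod_manifold M N) (c, d) (\<lambda>x. f (snd x))"
  unfolding differentiable_in_chart_def
proof (intro allI impI)
  fix \<gamma> S s u
  assume \<gamma>: "\<gamma> ` S \<subseteq> cdom (prod_manifold M N) (c, d)" and s: "s \<in> S"
    and u: "\<forall>i<mdim (prod_manifold M N). ((\<lambda>s. coord (prod_manifold M N) (c, d) (\<gamma> s) i)
      has_real_derivative u i) (at s within S)"
  have "((\<lambda>s. coord N d (snd (\<gamma> s)) i) has_real_derivative u (mdim M + i)) (at s within S)"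
    if "i < mdim N" for i
    using u[rule_format, of "mdim M + i"] that by (simp add: prod_manifold_def case_prod_unfold)
  moreover have "(\<lambda>s. snd (\<gamma> s)) ` S \<subseteq> cdom N d" using \<gamma> by auto
  ultimately have "((\<lambda>s. f (snd (\<gamma> s))) has_real_derivative
      (\<Sum>i<mdim N. u (mdim M + i) * pd N d i f (snd (\<gamma> s)))) (at s within S)"
    using s by (intro differentiable_in_chartD[OF f])
  moreover obtain p q where pq: "\<gamma> s = (p, q)" by fastforce
  have "p \<in> cdom M c" "q \<in> cdom N d" using \<gamma> s pq by force+
  then have "(\<Sum>i<mdim M + mdim N. u i * pd (prod_manifold M N) (c, d) i (\<lambda>x. f (snd x)) (p, q)) =
      (\<Sum>i<mdim N. u (mdim M + i) * pd N d i f q)"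
    unfolding sum_lessThan_add by (simp add: pd_prod_manifold[OF M N c d])
  ultimately show "((\<lambda>s. f (snd (\<gamma> s))) has_real_derivative (\<Sum>i<mdim (prod_manifold M N).
      u i * pd (prod_manifold M N) (c, d) i (\<lambda>x. f (snd x)) (\<gamma> s))) (at s within S)"
    using pq by simp
qed

text \<open>The chain rule applied to a coordinate line. It turns the \<open>deriv\<close> inside
  \<open>pd\<close> into an actual derivative, as needed for \<open>pd_cmult\<close>.\<close>

lemma pd_has_real_derivative:
  assumes M: "regular_atlas M" and c: "c \<in> charts M" and f: "differentiable_in_chart M c f"
    and p: "p \<in> cdom M c" and i: "i < mdim M"
  shows "((\<lambda>s. f (inv_into (cdom M c) (coord M c) ((coord M c p)(i := s))))
    has_real_derivative pd M c i f p) (at (coord M c p i))"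
proof -
  let ?x = "coord M c p i" and ?\<gamma> = "\<lambda>s. inv_into (cdom M c) (coord M c) ((coord M c p)(i := s))"
  from regular_atlas_line_chart[OF M c p i] obtain S where
    S: "open S" "?x \<in> S" "\<And>s. s \<in> S \<Longrightarrow> (coord M c p)(i := s) \<in> coord M c ` cdom M c"
    unfolding eventually_nhds by blast
  have \<gamma>: "?\<gamma> s \<in> cdom M c" "coord M c (?\<gamma> s) = (coord M c p)(i := s)" if "s \<in> S" for s
    using S(3)[OF that] by (auto intro: inv_into_into f_inv_into_f)
  have \<gamma>x: "?\<gamma> ?x = p"
    using inv_into_f_f[OF regular_atlas_inj[OF M c] p] by simp
  have "((\<lambda>s. f (?\<gamma> s)) has_real_derivative
      (\<Sum>j<mdim M. (if j = i then 1 else 0) * pd M c j f (?\<gamma> ?x))) (at ?x within S)"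
  proof (rule differentiable_in_chartD[OF f])
    fix j
    have "((\<lambda>s. ((coord M c p)(i := s)) j) has_real_derivative (if j = i then 1 else 0)) (at ?x within S)"
      by (auto intro!: derivative_eq_intros)
    then show "((\<lambda>s. coord M c (?\<gamma> s) j) has_real_derivative (if j = i then 1 else 0)) (at ?x within S)"
      by (rule has_field_derivative_transform_within[where d = 1]) (use S(2) \<gamma> in auto)
  qed (use \<gamma> S(2) in auto)
  also have "(\<Sum>j<mdim M. (if j = i then 1 else 0) * pd M c j f (?\<gamma> ?x)) = pd M c i f p"
    using i sum_kronecker_mult(2)[OF i, of "\<lambda>j. pd M c j f p"] unfolding \<gamma>x by (simp add: mult.commute)
  finally show ?thesis
    unfolding at_within_open[OF S(2,1)] .
qed

lemma pd_cmult:
  assumes "regular_atlas M" "c \<in> charts M" "differentiable_in_chart M c f" "p \<in> cdom M c" "i < mdim M"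
  shows "pd M c i (\<lambda>q. k * f q) p = k * pd M c i f p"
  unfolding pd_def[of M c i "\<lambda>q. k * f q"] partial_def
  by (rule DERIV_imp_deriv[OF DERIV_cmult[OF pd_has_real_derivative[OF assms]]])

lemma jac_prod_manifold:
  assumes "regular_atlas M" "regular_atlas N" "c \<in> charts M" "d \<in> charts N"
    and "p \<in> cdom M c" "q \<in> cdom N d" "j < mdim M + mdim N"
  shows "jac (prod_manifold M N) (c, d) (c', d') (p, q) k j =
    (if k < mdim M then if j < mdim M then jac M c c' p k j else 0
     else if j < mdim M then 0 else jac N d d' q (k - mdim M) (j - mdim M))"
  unfolding jac_def pd_prod_manifold[OF assms]
  by (cases "k < mdim M"; cases "j < mdim M") simp_all

section \<open>Product metrics\<close>

definition block_diag :: "nat \<Rightarrow> (nat \<Rightarrow> nat \<Rightarrow> real) \<Rightarrow> (nat \<Rightarrow> nat \<Rightarrow> real) \<Rightarrow> nat \<Rightarrow> nat \<Rightarrow> real" where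
  "block_diag m A B i j =
     (if i < m \<and> j < m then A i j else if m \<le> i \<and> m \<le> j then B (i - m) (j - m) else 0)"

lemma block_diag_simps [simp]:
  "i < m \<Longrightarrow> j < m \<Longrightarrow> block_diag m A B i j = A i j"
  "block_diag m A B (m + i) (m + j) = B i j"
  "i < m \<Longrightarrow> block_diag m A B i (m + j) = 0"
  "j < m \<Longrightarrow> block_diag m A B (m + i) j = 0"
  by (simp_all add: block_diag_def)

text \<open>Writing an index of the second factor as \<open>m + i'\<close> lets the block rules act
  as rewrite rules.\<close>

lemma less_add_cases [consumes 1, case_names left right]:
  fixes i m n :: nat
  assumes "i < m + n"
  obtains "i < m" | i' where "i = m + i'" "i' < n"
  using assms by (metis add_less_cancel_left le_Suc_ex not_less)

lemma nondegenerate_block_diag: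
  assumes A: "nondegenerate_matrix m A" and B: "nondegenerate_matrix n B"
  shows "nondegenerate_matrix (m + n) (block_diag m A B)"
  unfolding nondegenerate_matrix_def
proof (intro allI impI)
  fix v :: "nat \<Rightarrow> real" and j
  assume v: "\<forall>i<m + n. (\<Sum>j<m + n. block_diag m A B i j * v j) = 0" and j: "j < m + n"
  have 1: "(\<Sum>j<m. A i j * v j) = 0" if "i < m" for i
    using v[rule_format, of i] that by (simp add: sum_lessThan_add)
  have 2: "(\<Sum>j<n. B i j * v (m + j)) = 0" if "i < n" for i
    using v[rule_format, of "m + i"] that by (simp add: sum_lessThan_add)
  from j show "v j = 0"
  proof (cases rule: less_add_cases)
    case left
    then show ?thesis using A 1 unfolding nondegenerate_matrix_def by blast
  next
    case (right j')
    then show ?thesis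
      using B[unfolded nondegenerate_matrix_def, rule_format, of "\<lambda>j. v (m + j)" j'] 2 by simp
  qed
qed

lemma inverse_matrix_block_diag:
  assumes A: "nondegenerate_matrix m A" and B: "nondegenerate_matrix n B"
  shows "inverse_matrix (m + n) (block_diag m A B) =
    block_diag m (inverse_matrix m A) (inverse_matrix n B)"
proof (rule inverse_matrix_eqI)
  fix i k assume "i < m + n" "k < m + n"
  then show "(\<Sum>j<m + n. block_diag m A B i j * block_diag m (inverse_matrix m A) (inverse_matrix n B) j k) =
      (if i = k then 1 else 0)"
    by (elim less_add_cases)
      (simp_all add: sum_lessThan_add inverse_matrix_right[OF A] inverse_matrix_right[OF B])
next
  fix i j assume "\<not> (i < m + n \<and> j < m + n)"
  then show "block_diag m (inverse_matrix m A) (inverse_matrix n B) i j = 0"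
    by (auto simp: block_diag_def intro!: inverse_matrix_eq_0[OF B])
qed

lemma pseudo_riemannianD:
  assumes "pseudo_riemannian M g" "c \<in> charts M" "p \<in> cdom M c"
  shows pseudo_riemannian_nondegenerate: "nondegenerate_matrix (mdim M) (g c p)"
    and pseudo_riemannian_sym: "i < mdim M \<Longrightarrow> j < mdim M \<Longrightarrow> g c p i j = g c p j i"
    and pseudo_riemannian_transform: "d \<in> charts M \<Longrightarrow> p \<in> cdom M d \<Longrightarrow> i < mdim M \<Longrightarrow> j < mdim M \<Longrightarrow>
      g c p i j = (\<Sum>k<mdim M. \<Sum>l<mdim M. jac M c d p k i * jac M c d p l j * g d p k l)"
proof -
  show "nondegenerate_matrix (mdim M) (g c p)"
    using assms unfolding pseudo_riemannian_def nondegenerate_matrix_def by blast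
  show "i < mdim M \<Longrightarrow> j < mdim M \<Longrightarrow> g c p i j = g c p j i"
    using assms unfolding pseudo_riemannian_def by blast
  show "d \<in> charts M \<Longrightarrow> p \<in> cdom M d \<Longrightarrow> i < mdim M \<Longrightarrow> j < mdim M \<Longrightarrow>
      g c p i j = (\<Sum>k<mdim M. \<Sum>l<mdim M. jac M c d p k i * jac M c d p l j * g d p k l)"
    using assms(1)[unfolded pseudo_riemannian_def, THEN conjunct2, rule_format, of c d p i j]
      assms(2,3) by simp
qed

lemma pseudo_riemannian_differentiable:
  assumes "smooth_manifold M" "pseudo_riemannian M g" "c \<in> charts M" "i < mdim M" "j < mdim M"
  shows "differentiable_in_chart M c (\<lambda>p. g c p i j)"
  by (rule smooth_on_differentiable_in_chart[OF assms(1,3)])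
    (use assms in \<open>unfold pseudo_riemannian_def, blast\<close>)

lemma product_metric_block_diag:
  "product_metric M N g g' (c, d) (p, q) = block_diag (mdim M) (g c p) (g' d q)"
  by (auto simp: product_metric_def block_diag_def fun_eq_iff)

text \<open>The pattern shared by the first derivatives of a product metric and by its Christoffel
  symbols: nothing survives unless all three indices belong to the same factor.\<close>

definition block_diag3 ::
    "nat \<Rightarrow> (nat \<Rightarrow> nat \<Rightarrow> nat \<Rightarrow> real) \<Rightarrow> (nat \<Rightarrow> nat \<Rightarrow> nat \<Rightarrow> real) \<Rightarrow> nat \<Rightarrow> nat \<Rightarrow> nat \<Rightarrow> real" where
  "block_diag3 m A B k i j =
     (if k < m \<and> i < m \<and> j < m then A k i j
      else if m \<le> k \<and> m \<le> i \<and> m \<le> j then B (k - m) (i - m) (j - m) else 0)"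

lemma block_diag3_simps [simp]:
  "k < m \<Longrightarrow> i < m \<Longrightarrow> j < m \<Longrightarrow> block_diag3 m A B k i j = A k i j"
  "block_diag3 m A B (m + k) (m + i) (m + j) = B k i j"
  "k < m \<Longrightarrow> block_diag3 m A B k (m + i) j = 0"
  "k < m \<Longrightarrow> block_diag3 m A B k i (m + j) = 0"
  "i < m \<Longrightarrow> block_diag3 m A B (m + k) i j = 0"
  "j < m \<Longrightarrow> block_diag3 m A B (m + k) i j = 0"
  by (simp_all add: block_diag3_def)

locale product_charts =
  fixes M :: "('i, 'a) manifold" and N :: "('j, 'b) manifold"
    and g :: "('i, 'a) metric" and g' :: "('j, 'b) metric"
  assumes M: "smooth_manifold M" and N: "smooth_manifold N"
    and g: "pseudo_riemannian M g" and g': "pseudo_riemannian N g'"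
begin

abbreviation "m \<equiv> mdim M"
abbreviation "n \<equiv> mdim N"
abbreviation "MN \<equiv> prod_manifold M N"
abbreviation "G \<equiv> product_metric M N g g'"

lemmas regM = smooth_manifold_regular_atlas[OF M]
lemmas regN = smooth_manifold_regular_atlas[OF N]
lemmas regMN = regular_atlas_prod_manifold[OF regM regN]

context
  fixes c d p q
  assumes c: "c \<in> charts M" and d: "d \<in> charts N" and p: "p \<in> cdom M c" and q: "q \<in> cdom N d"
begin

lemmas pd_MN = pd_prod_manifold[OF regM regN c d p q]
lemmas inverse_G = inverse_matrix_block_diag[OF pseudo_riemannian_nondegenerate[OF g c p]
    pseudo_riemannian_nondegenerate[OF g' d q]]

lemma pd_G:
  assumes "i < m + n" "j < m + n" "l < m + n"
  shows "pd MN (c, d) i (\<lambda>x. G (c, d) x j l) (p, q) =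
    block_diag3 m (\<lambda>i j l. pd M c i (\<lambda>p. g c p j l) p) (\<lambda>i j l. pd N d i (\<lambda>q. g' d q j l) q) i j l"
  using assms by (elim less_add_cases) (simp_all add: pd_MN product_metric_block_diag)

lemma christoffel_MN:
  assumes "k < m + n" "i < m + n" "j < m + n"
  shows "christoffel MN G (c, d) (p, q) k i j =
    block_diag3 m (christoffel M g c p) (christoffel N g' d q) k i j"
  using assms
  by (elim less_add_cases)
    (simp_all add: christoffel_def product_metric_block_diag[of M N g g' c d p q] inverse_G
      sum_lessThan_add pd_G)

end

context
  fixes c d p q
  assumes c: "c \<in> charts M" and d: "d \<in> charts N" and p: "p \<in> cdom M c" and q: "q \<in> cdom N d"
begin

text \<open>Differentiation uses \<open>christoffel_MN\<close> at all points of the chart, so that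
  formula is needed in the form generalised over the points, outside the context that proves
  it.\<close>

lemma pd_christoffel_MN:
  assumes "l < m + n" "k < m + n" "i < m + n" "j < m + n"
  shows "pd MN (c, d) l (\<lambda>x. christoffel MN G (c, d) x k i j) (p, q) =
    (if l < m then if k < m \<and> i < m \<and> j < m then pd M c l (\<lambda>p. christoffel M g c p k i j) p else 0
     else if m \<le> k \<and> m \<le> i \<and> m \<le> j
       then pd N d (l - m) (\<lambda>q. christoffel N g' d q (k - m) (i - m) (j - m)) q else 0)"
proof -
  have "pd MN (c, d) l (\<lambda>x. christoffel MN G (c, d) x k i j) (p, q) =
      pd MN (c, d) l (\<lambda>x. block_diag3 m (christoffel M g c (fst x)) (christoffel N g' d (snd x)) k i j) (p, q)"
    by (rule pd_cong[OF regMN]) (use c d p q assms in \<open>auto simp: christoffel_MN\<close>)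
  also have "\<dots> = (if l < m then if k < m \<and> i < m \<and> j < m then pd M c l (\<lambda>p. christoffel M g c p k i j) p else 0
     else if m \<le> k \<and> m \<le> i \<and> m \<le> j
       then pd N d (l - m) (\<lambda>q. christoffel N g' d q (k - m) (i - m) (j - m)) q else 0)"
    using assms by (elim less_add_cases) (simp_all add: pd_MN[OF c d p q])
  finally show ?thesis .
qed

text \<open>The symbols couple indices within one factor and are constant along the other factor, so
  the traces split and no mixed term survives.\<close>

lemma ricci_MN:
  assumes "i < m + n" "j < m + n"
  shows "ricci MN G (c, d) (p, q) i j = block_diag m (ricci M g c p) (ricci N g' d q) i j"
  using assms
  by (elim less_add_cases)
    (simp_all add: ricci_def sum_lessThan_add pd_christoffel_MN christoffel_MN[OF c d p q])

lemma scalar_curvature_MN: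
  "scalar_curvature MN G (c, d) (p, q) = scalar_curvature M g c p + scalar_curvature N g' d q"
  by (simp add: scalar_curvature_def sum_lessThan_add ricci_MN product_metric_block_diag
      inverse_G[OF c d p q])

end

end

section \<open>The Levi-Civita connection of the ambient metric\<close>

lemma rescaled_inverse_term:
  fixes t a b d x y :: real
  assumes "t \<noteq> 0" "b \<noteq> 0"
  shows "t\<^sup>2 * (a * b) * x * (y / (t\<^sup>2 * (b * d))) = a / d * (x * y)"
  using assms by (cases "d = 0") (simp_all add: field_simps)

text \<open>The terms that arise when all indices have the same eigenvalue: \<open>a\<close> stands
  for \<open>1 + e l * \<rho>\<close> and \<open>b\<close> for the eigenvalue. The three cases
  belong to derivatives of the metric along the base, in \<open>t\<close> and in
  \<open>\<rho>\<close>.\<close>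

lemma rescaled_christoffel_terms:
  fixes t a b x x' x'' y :: real
  assumes "t \<noteq> 0" "a \<noteq> 0"
  shows "y / (t\<^sup>2 * (a * a)) * (t\<^sup>2 * (a * a) * x + t\<^sup>2 * (a * a) * x' - t\<^sup>2 * (a * a) * x'') = y * (x + x' - x'')"
    and "y / (t\<^sup>2 * (a * a)) * (2 * t * (a * a) * x) = 2 / t * (y * x)"
    and "y / (t\<^sup>2 * (a * a)) * (t\<^sup>2 * (b * a + a * b) * x) = 2 * b / a * (y * x)"
  using assms by (simp_all add: field_simps power2_eq_square)

text \<open>
  The product structure enters only through the eigenvalues \<open>e\<close> of the Schouten tensor: \<open>e i\<close> is
  \<open>\<mu>\<close> if \<open>i\<close> is an index of the first factor and \<open>- \<mu>\<close> otherwise, and indices with different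
  eigenvalues do not interact. \<open>J\<close> is the component of the \<open>\<rho>\<close>-domain \<open>D\<close> containing 0.
\<close>

locale split_conformal =
  fixes M :: "('k, 'p) manifold" and g :: "('k, 'p) metric" and e :: "nat \<Rightarrow> real" and D J :: "real set"
  assumes reg: "regular_atlas M"
    and cover: "topspace (topo M) = (\<Union>c\<in>charts M. cdom M c)"
    and nondeg: "c \<in> charts M \<Longrightarrow> p \<in> cdom M c \<Longrightarrow> nondegenerate_matrix (mdim M) (g c p)"
    and sym: "c \<in> charts M \<Longrightarrow> p \<in> cdom M c \<Longrightarrow> i < mdim M \<Longrightarrow> j < mdim M \<Longrightarrow> g c p i j = g c p j i"
    and transform: "c \<in> charts M \<Longrightarrow> d \<in> charts M \<Longrightarrow> p \<in> cdom M c \<Longrightarrow> p \<in> cdom M d \<Longrightarrow>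
      i < mdim M \<Longrightarrow> j < mdim M \<Longrightarrow>
      g c p i j = (\<Sum>k<mdim M. \<Sum>l<mdim M. jac M c d p k i * jac M c d p l j * g d p k l)"
    and diff: "c \<in> charts M \<Longrightarrow> i < mdim M \<Longrightarrow> j < mdim M \<Longrightarrow> differentiable_in_chart M c (\<lambda>p. g c p i j)"
    and e_jac: "c \<in> charts M \<Longrightarrow> d \<in> charts M \<Longrightarrow> p \<in> cdom M c \<Longrightarrow> p \<in> cdom M d \<Longrightarrow>
      i < mdim M \<Longrightarrow> j < mdim M \<Longrightarrow> e i \<noteq> e j \<Longrightarrow> jac M c d p i j = 0"
    and e_g: "c \<in> charts M \<Longrightarrow> p \<in> cdom M c \<Longrightarrow> i < mdim M \<Longrightarrow> j < mdim M \<Longrightarrow> e i \<noteq> e j \<Longrightarrow> g c p i j = 0"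
    and e_ginv: "c \<in> charts M \<Longrightarrow> p \<in> cdom M c \<Longrightarrow> i < mdim M \<Longrightarrow> j < mdim M \<Longrightarrow> e i \<noteq> e j \<Longrightarrow>
      inverse_matrix (mdim M) (g c p) i j = 0"
    and e_pd: "c \<in> charts M \<Longrightarrow> p \<in> cdom M c \<Longrightarrow> i < mdim M \<Longrightarrow> j < mdim M \<Longrightarrow> l < mdim M \<Longrightarrow>
      e l \<noteq> e i \<or> e i \<noteq> e j \<Longrightarrow> pd M c l (\<lambda>p. g c p i j) p = 0"
    and schouten: "c \<in> charts M \<Longrightarrow> p \<in> cdom M c \<Longrightarrow> i < mdim M \<Longrightarrow> j < mdim M \<Longrightarrow>
      schouten M g c p i j = e i * g c p i j"
    and openD: "open D" and openJ: "open J" and JD: "J \<subseteq> D" and J0: "0 \<in> J"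
    and factor_nz: "\<rho> \<in> J \<Longrightarrow> i < mdim M \<Longrightarrow> 1 + e i * \<rho> \<noteq> 0"
begin

abbreviation "n \<equiv> mdim M"

definition ambient :: "('k ambient_label, 'p ambient_point) manifold" where
  "ambient = open_submanifold
     (prod_manifold M (prod_manifold (real_manifold {0<..}) (real_manifold D)))
     (topspace (topo M) \<times> {0<..} \<times> J)"

text \<open>A product of two factors keeps the formula symmetric in \<open>i\<close> and
  \<open>j\<close>. Where \<open>e i\<close> and \<open>e j\<close> differ the component of
  \<open>g\<close> is 0, so this is the square of the warping function on each factor.\<close>

definition h :: "('k ambient_label, 'p ambient_point) metric" where
  "h = (\<lambda>(c, _) (p, t, \<rho>) i j.
     if i < n \<and> j < n then t\<^sup>2 * ((1 + e i * \<rho>) * (1 + e j * \<rho>)) * g c p i j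
     else if i = n \<and> j = n then 2 * \<rho>
     else if i = n \<and> j = n + 1 \<or> i = n + 1 \<and> j = n then t
     else 0)"

lemmas reg_lines = regular_atlas_prod_manifold[OF regular_atlas_real_manifold[OF open_greaterThan[of "0::real"]]
    regular_atlas_real_manifold[OF openD]]
lemmas reg_full = regular_atlas_prod_manifold[OF reg reg_lines]

lemma cdom_subset: "c \<in> charts M \<Longrightarrow> cdom M c \<subseteq> topspace (topo M)"
  using cover by blast

lemma openin_ambient:
  "openin (topo (prod_manifold M (prod_manifold (real_manifold {0<..}) (real_manifold D))))
     (topspace (topo M) \<times> {0<..} \<times> J)"
proof -
  have "openin (subtopology euclideanreal D) J"
    using openJ JD by (metis open_openin open_subset)
  moreover have "openin (subtopology euclideanreal {0<..}) {0::real<..}"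
    by (simp add: openin_subtopology_self)
  ultimately show ?thesis
    unfolding prod_manifold_simps real_manifold_simps openin_prod_Times_iff by auto
qed

lemma ambient_simps:
  "mdim ambient = Suc (Suc n)"
  "charts ambient = charts M \<times> UNIV"
  "c \<in> charts M \<Longrightarrow> cdom ambient (c, ab) = cdom M c \<times> {0<..} \<times> J"
  "coord ambient (c, ab) (p, t, \<rho>) k =
     (if k < n then coord M c p k else if k = n then t else if k = Suc n then \<rho> else 0)"
proof -
  obtain a b where ab: "ab = (a, b)" by (rule prod.exhaust)
  show "c \<in> charts M \<Longrightarrow> cdom ambient (c, ab) = cdom M c \<times> {0<..} \<times> J"
    using cdom_subset[of c] JD unfolding ambient_def ab by auto
  show "coord ambient (c, ab) (p, t, \<rho>) k =
     (if k < n then coord M c p k else if k = n then t else if k = Suc n then \<rho> else 0)"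
    unfolding ambient_def ab by auto
qed (auto simp: ambient_def)

context
  fixes c p and t \<rho> :: real
  assumes c: "c \<in> charts M" and p: "p \<in> cdom M c" and t: "t > 0" and \<rho>: "\<rho> \<in> J"
begin

lemma pd_ambient:
  "i < n \<Longrightarrow> pd ambient (c, ab) i f (p, t, \<rho>) = pd M c i (\<lambda>p'. f (p', t, \<rho>)) p"
  "pd ambient (c, ab) n f (p, t, \<rho>) = deriv (\<lambda>s. f (p, s, \<rho>)) t"
  "pd ambient (c, ab) (Suc n) f (p, t, \<rho>) = deriv (\<lambda>r. f (p, t, r)) \<rho>"
proof -
  let ?R = "prod_manifold (real_manifold {0::real<..}) (real_manifold D)"
  obtain a b where ab: "ab = (a, b)" by (rule prod.exhaust)
  have \<rho>D: "\<rho> \<in> D" using \<rho> JD by blast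
  have 1: "pd ambient (c, ab) i f (p, t, \<rho>) = pd (prod_manifold M ?R) (c, ab) i f (p, t, \<rho>)"
    if "i < Suc (Suc n)" for i
    unfolding ambient_def
    by (rule pd_open_submanifold[OF reg_full openin_ambient])
      (use c p t \<rho> \<rho>D that cdom_subset[OF c] in \<open>auto simp: ab\<close>)
  have 2: "pd (prod_manifold M ?R) (c, ab) i f (p, t, \<rho>) =
      (if i < n then pd M c i (\<lambda>p'. f (p', t, \<rho>)) p
       else pd ?R ab (i - n) (\<lambda>q. f (p, q)) (t, \<rho>))" if "i < Suc (Suc n)" for i
    by (rule pd_prod_manifold[OF reg reg_lines c]) (use p t \<rho>D that in \<open>auto simp: ab\<close>)
  have 3: "pd ?R ab i f' (t, \<rho>) = (if i < Suc 0 then deriv (\<lambda>s. f' (s, \<rho>)) t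
      else deriv (\<lambda>r. f' (t, r)) \<rho>)" if "i < 2" for i and f' :: "real \<times> real \<Rightarrow> real"
  proof -
    have "pd ?R ab i f' (t, \<rho>) =
      (if i < mdim (real_manifold {0<..}) then pd (real_manifold {0<..}) a i (\<lambda>s. f' (s, \<rho>)) t
       else pd (real_manifold D) b (i - mdim (real_manifold {0<..})) (\<lambda>r. f' (t, r)) \<rho>)"
      unfolding ab
      by (rule pd_prod_manifold[OF regular_atlas_real_manifold regular_atlas_real_manifold])
        (use t \<rho>D that openD in auto)
    moreover have "i = 0 \<or> i = Suc 0" using that by auto
    ultimately show ?thesis
      using pd_real_manifold[of "{0<..}" t a "\<lambda>s. f' (s, \<rho>)"]
        pd_real_manifold[OF openD \<rho>D, of b "\<lambda>r. f' (t, r)"] t by auto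
  qed
  show "i < n \<Longrightarrow> pd ambient (c, ab) i f (p, t, \<rho>) = pd M c i (\<lambda>p'. f (p', t, \<rho>)) p"
    using 1[of i] 2[of i] by simp
  show "pd ambient (c, ab) n f (p, t, \<rho>) = deriv (\<lambda>s. f (p, s, \<rho>)) t"
    using 1[of n] 2[of n] 3[of 0] by simp
  show "pd ambient (c, ab) (Suc n) f (p, t, \<rho>) = deriv (\<lambda>r. f (p, t, r)) \<rho>"
    using 1[of "Suc n"] 2[of "Suc n"] 3[of "Suc 0"] by simp
qed

lemma jac_ambient:
  assumes "k < Suc (Suc n)" "j < Suc (Suc n)"
  shows "jac ambient (c, ab) (d, ab') (p, t, \<rho>) k j =
    (if k < n \<and> j < n then jac M c d p k j else if k = j then 1 else 0)"
proof -
  consider "j < n" | "j = n" | "j = Suc n" using assms(2) by linarith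
  then show ?thesis
    by cases (use assms(1) in \<open>auto simp: jac_def pd_ambient ambient_simps less_Suc_eq\<close>)
qed

text \<open>The vertical block has rows (2\<rho>, t) and (t, 0); its inverse has rows (0, 1/t) and
  (1/t, \<open>-2\<rho>/t\<^sup>2\<close>). In the base block the scale factors at the summation
  index cancel, and those at \<open>i\<close> and \<open>k\<close> cancel on the diagonal.\<close>

lemma inverse_matrix_h:
  "inverse_matrix (Suc (Suc n)) (h (c, ab) (p, t, \<rho>)) = (\<lambda>i j.
     if i < n \<and> j < n then inverse_matrix n (g c p) i j / (t\<^sup>2 * ((1 + e i * \<rho>) * (1 + e j * \<rho>)))
     else if i = n \<and> j = Suc n \<or> i = Suc n \<and> j = n then 1 / t
     else if i = Suc n \<and> j = Suc n then - 2 * \<rho> / t\<^sup>2 else 0)" (is "_ = ?H")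
proof (rule inverse_matrix_eqI)
  fix i k assume i: "i < Suc (Suc n)" and k: "k < Suc (Suc n)"
  have block: "(\<Sum>j<n. t\<^sup>2 * ((1 + e i * \<rho>) * (1 + e j * \<rho>)) * g c p i j *
      (inverse_matrix n (g c p) j k / (t\<^sup>2 * ((1 + e j * \<rho>) * (1 + e k * \<rho>))))) =
      (if i = k then 1 else 0)" if ik: "i < n" "k < n"
  proof -
    have "(\<Sum>j<n. t\<^sup>2 * ((1 + e i * \<rho>) * (1 + e j * \<rho>)) * g c p i j *
      (inverse_matrix n (g c p) j k / (t\<^sup>2 * ((1 + e j * \<rho>) * (1 + e k * \<rho>))))) =
      (\<Sum>j<n. (1 + e i * \<rho>) / (1 + e k * \<rho>) * (g c p i j * inverse_matrix n (g c p) j k))"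
      by (intro sum.cong refl rescaled_inverse_term) (use t factor_nz[OF \<rho>] in auto)
    also have "\<dots> = (1 + e i * \<rho>) / (1 + e k * \<rho>) * (if i = k then 1 else 0)"
      unfolding sum_distrib_left[symmetric] inverse_matrix_right[OF nondeg[OF c p] ik] ..
    also have "\<dots> = (if i = k then 1 else 0)"
      using factor_nz[OF \<rho> ik(2)] by simp
    finally show ?thesis .
  qed
  show "(\<Sum>j<Suc (Suc n). h (c, ab) (p, t, \<rho>) i j * ?H j k) = (if i = k then 1 else 0)"
  proof (cases "i < n \<and> k < n")
    case True
    then show ?thesis using block by (simp add: h_def)
  next
    case False
    have "i < n \<or> i = n \<or> i = Suc n" "k < n \<or> k = n \<or> k = Suc n"
      using i k by linarith+
    with False t show ?thesis
      by (elim disjE) (simp_all add: h_def power2_eq_square)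
  qed
next
  fix i j assume "\<not> (i < Suc (Suc n) \<and> j < Suc (Suc n))"
  then show "?H i j = 0" by auto
qed

lemma pd_h:
  assumes "i < Suc (Suc n)" "j < Suc (Suc n)" "l < Suc (Suc n)"
  shows "pd ambient (c, ab) i (\<lambda>x. h (c, ab) x j l) (p, t, \<rho>) =
    (if j < n \<and> l < n then
       if i < n then t\<^sup>2 * ((1 + e j * \<rho>) * (1 + e l * \<rho>)) * pd M c i (\<lambda>p. g c p j l) p
       else if i = n then 2 * t * ((1 + e j * \<rho>) * (1 + e l * \<rho>)) * g c p j l
       else t\<^sup>2 * (e j * (1 + e l * \<rho>) + (1 + e j * \<rho>) * e l) * g c p j l
     else if i = n \<and> (j = n \<and> l = Suc n \<or> j = Suc n \<and> l = n) then 1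
     else if i = Suc n \<and> j = n \<and> l = n then 2 else 0)"
proof -
  have jl: "j < n \<or> j = n \<or> j = Suc n" "l < n \<or> l = n \<or> l = Suc n"
    using assms(2,3) by linarith+
  consider "i < n" | "i = n" | "i = Suc n" using assms(1) by linarith
  then show ?thesis
  proof cases
    case 1
    then show ?thesis
      using jl pd_cmult[OF reg c diff[OF c] p 1] by (elim disjE) (simp_all add: pd_ambient h_def)
  next
    case 2
    have "deriv (\<lambda>s. s\<^sup>2 * ((1 + e j * \<rho>) * (1 + e l * \<rho>)) * g c p j l) t =
        2 * t * ((1 + e j * \<rho>) * (1 + e l * \<rho>)) * g c p j l"
      by (rule DERIV_imp_deriv) (auto intro!: derivative_eq_intros)
    with 2 show ?thesis
      using jl by (elim disjE) (simp_all add: pd_ambient h_def)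
  next
    case 3
    have "deriv (\<lambda>r. t\<^sup>2 * ((1 + e j * r) * (1 + e l * r)) * g c p j l) \<rho> =
        t\<^sup>2 * (e j * (1 + e l * \<rho>) + (1 + e j * \<rho>) * e l) * g c p j l"
      by (rule DERIV_imp_deriv) (auto intro!: derivative_eq_intros)
    moreover have "deriv (\<lambda>r::real. 2 * r) \<rho> = 2"
      by (rule DERIV_imp_deriv) (auto intro!: derivative_eq_intros)
    ultimately show ?thesis
      using 3 jl by (elim disjE) (simp_all add: pd_ambient h_def)
  qed
qed

section \<open>Christoffel symbols of the ambient metric\<close>

lemmas factor_nz' = factor_nz[OF \<rho>]

text \<open>Within one eigenvalue the metric is rescaled by a factor that is constant along the
  base, which leaves the Levi-Civita connection unchanged. Across eigenvalues either the inverse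
  entry or all the derivatives vanish.\<close>

lemma christoffel_h_base:
  assumes "k < n" "i < n" "j < n"
  shows "christoffel ambient h (c, ab) (p, t, \<rho>) k i j = christoffel M g c p k i j"
proof -
  have "inverse_matrix n (g c p) k l / (t\<^sup>2 * ((1 + e k * \<rho>) * (1 + e l * \<rho>))) *
      (t\<^sup>2 * ((1 + e j * \<rho>) * (1 + e l * \<rho>)) * pd M c i (\<lambda>p. g c p j l) p +
       t\<^sup>2 * ((1 + e i * \<rho>) * (1 + e l * \<rho>)) * pd M c j (\<lambda>p. g c p i l) p -
       t\<^sup>2 * ((1 + e i * \<rho>) * (1 + e j * \<rho>)) * pd M c l (\<lambda>p. g c p i j) p) =
      inverse_matrix n (g c p) k l *
      (pd M c i (\<lambda>p. g c p j l) p + pd M c j (\<lambda>p. g c p i l) p - pd M c l (\<lambda>p. g c p i j) p)"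
    if l: "l < n" for l
  proof (cases "e k = e l")
    case False
    then show ?thesis using e_ginv[OF c p assms(1) l] by simp
  next
    case ekl: True
    show ?thesis
    proof (cases "e i = e l \<and> e j = e l")
      case True
      then show ?thesis using ekl rescaled_christoffel_terms(1)[OF _ factor_nz'[OF l], of t] t by simp
    next
      case False
      then show ?thesis
        using e_pd[OF c p assms(3) l assms(2)] e_pd[OF c p assms(2) l assms(3)]
          e_pd[OF c p assms(2,3) l] by auto
    qed
  qed
  with assms show ?thesis
    by (simp add: christoffel_def ambient_simps inverse_matrix_h pd_h)
qed

text \<open>For upper index \<open>n\<close> only the derivative in \<rho> enters, through the
  inverse entry 1/t. For upper index \<open>Suc n\<close> the derivatives in t and \<rho> contribute
  \<open>- l\<^sup>2\<close> and \<open>2 \<rho> (e i) l\<close> times \<open>g c p i j\<close>,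
  where \<open>l = 1 + e i * \<rho>\<close>; their sum is
  \<open>- l (1 - e i * \<rho>)\<close>.\<close>

lemma christoffel_h_up:
  assumes "i < n" "j < n"
  shows "christoffel ambient h (c, ab) (p, t, \<rho>) n i j =
      - (t * (1 + e i * \<rho>) * e i * g c p i j)"
    and "christoffel ambient h (c, ab) (p, t, \<rho>) (Suc n) i j =
      - ((1 + e i * \<rho>) * (1 - e i * \<rho>) * g c p i j)"
proof -
  have *: "e i = e j \<or> g c p i j = 0" using e_g[OF c p assms] by blast
  show "christoffel ambient h (c, ab) (p, t, \<rho>) n i j =
      - (t * (1 + e i * \<rho>) * e i * g c p i j)"
    using assms t * by (auto simp: christoffel_def ambient_simps inverse_matrix_h pd_h
        power2_eq_square field_simps)
  show "christoffel ambient h (c, ab) (p, t, \<rho>) (Suc n) i j =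
      - ((1 + e i * \<rho>) * (1 - e i * \<rho>) * g c p i j)"
    using assms t * by (auto simp: christoffel_def ambient_simps inverse_matrix_h pd_h
        power2_eq_square field_simps)
qed

text \<open>Half the logarithmic derivatives of the warping factor
  \<open>t\<^sup>2 (1 + e k * \<rho>)\<^sup>2\<close> in t and in \<rho>; contraction with the
  inverse metric leaves a Kronecker delta.\<close>

lemma christoffel_h_mixed:
  assumes k: "k < n" and i: "i < n"
  shows "christoffel ambient h (c, ab) (p, t, \<rho>) k i n = (if k = i then 1 / t else 0)"
    and "christoffel ambient h (c, ab) (p, t, \<rho>) k n i = (if k = i then 1 / t else 0)"
    and "christoffel ambient h (c, ab) (p, t, \<rho>) k i (Suc n) = (if k = i then e k / (1 + e k * \<rho>) else 0)"
    and "christoffel ambient h (c, ab) (p, t, \<rho>) k (Suc n) i = (if k = i then e k / (1 + e k * \<rho>) else 0)"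
proof -
  let ?B = "inverse_matrix n (g c p)"
  have 1: "?B k l / (t\<^sup>2 * ((1 + e k * \<rho>) * (1 + e l * \<rho>))) *
      (2 * t * ((1 + e i * \<rho>) * (1 + e l * \<rho>)) * g c p i l) = 2 / t * (?B k l * g c p l i)"
    and 2: "?B k l / (t\<^sup>2 * ((1 + e k * \<rho>) * (1 + e l * \<rho>))) *
      (t\<^sup>2 * (e i * (1 + e l * \<rho>) + (1 + e i * \<rho>) * e l) * g c p i l) =
      2 * e k / (1 + e k * \<rho>) * (?B k l * g c p l i)"
    if l: "l < n" for l
  proof -
    have "?B k l = 0 \<or> g c p l i = 0 \<or> e k = e l \<and> e i = e l"
      using e_ginv[OF c p k l] e_g[OF c p l i] by metis
    then show "?B k l / (t\<^sup>2 * ((1 + e k * \<rho>) * (1 + e l * \<rho>))) *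
      (2 * t * ((1 + e i * \<rho>) * (1 + e l * \<rho>)) * g c p i l) = 2 / t * (?B k l * g c p l i)"
     and "?B k l / (t\<^sup>2 * ((1 + e k * \<rho>) * (1 + e l * \<rho>))) *
      (t\<^sup>2 * (e i * (1 + e l * \<rho>) + (1 + e i * \<rho>) * e l) * g c p i l) =
      2 * e k / (1 + e k * \<rho>) * (?B k l * g c p l i)"
      unfolding sym[OF c p i l] using rescaled_christoffel_terms(2,3)[OF _ factor_nz'[OF l], of t] t
      by (elim disjE conjE; simp)+
  qed
  note inv = inverse_matrix_left[OF nondeg[OF c p] k i]
  have sum1: "(\<Sum>l<n. ?B k l / (t\<^sup>2 * ((1 + e k * \<rho>) * (1 + e l * \<rho>))) *
      (2 * t * ((1 + e i * \<rho>) * (1 + e l * \<rho>)) * g c p i l)) = 2 / t * (if k = i then 1 else 0)"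
    unfolding inv[symmetric] sum_distrib_left using 1 by (intro sum.cong) auto
  define f where "f = e k / (1 + e k * \<rho>)"
  have sum2: "(\<Sum>l<n. ?B k l / (t\<^sup>2 * ((1 + e k * \<rho>) * (1 + e l * \<rho>))) *
      (t\<^sup>2 * (e i * (1 + e l * \<rho>) + (1 + e i * \<rho>) * e l) * g c p i l)) =
      2 * f * (if k = i then 1 else 0)"
    unfolding inv[symmetric] sum_distrib_left using 2 by (intro sum.cong) (auto simp: f_def)
  have "christoffel ambient h (c, ab) (p, t, \<rho>) k i n =
      (\<Sum>l<n. ?B k l / (t\<^sup>2 * ((1 + e k * \<rho>) * (1 + e l * \<rho>))) *
      (2 * t * ((1 + e i * \<rho>) * (1 + e l * \<rho>)) * g c p i l)) / 2"
    "christoffel ambient h (c, ab) (p, t, \<rho>) k n i =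
      (\<Sum>l<n. ?B k l / (t\<^sup>2 * ((1 + e k * \<rho>) * (1 + e l * \<rho>))) *
      (2 * t * ((1 + e i * \<rho>) * (1 + e l * \<rho>)) * g c p i l)) / 2"
    "christoffel ambient h (c, ab) (p, t, \<rho>) k i (Suc n) =
      (\<Sum>l<n. ?B k l / (t\<^sup>2 * ((1 + e k * \<rho>) * (1 + e l * \<rho>))) *
      (t\<^sup>2 * (e i * (1 + e l * \<rho>) + (1 + e i * \<rho>) * e l) * g c p i l)) / 2"
    "christoffel ambient h (c, ab) (p, t, \<rho>) k (Suc n) i =
      (\<Sum>l<n. ?B k l / (t\<^sup>2 * ((1 + e k * \<rho>) * (1 + e l * \<rho>))) *
      (t\<^sup>2 * (e i * (1 + e l * \<rho>) + (1 + e i * \<rho>) * e l) * g c p i l)) / 2"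
    using k i by (simp_all add: christoffel_def ambient_simps inverse_matrix_h pd_h)
  note sums = this[unfolded sum1 sum2]
  show "christoffel ambient h (c, ab) (p, t, \<rho>) k i n = (if k = i then 1 / t else 0)"
    "christoffel ambient h (c, ab) (p, t, \<rho>) k n i = (if k = i then 1 / t else 0)"
    "christoffel ambient h (c, ab) (p, t, \<rho>) k i (Suc n) = (if k = i then e k / (1 + e k * \<rho>) else 0)"
    "christoffel ambient h (c, ab) (p, t, \<rho>) k (Suc n) i = (if k = i then e k / (1 + e k * \<rho>) else 0)"
    unfolding sums f_def[symmetric] by simp_all
qed

text \<open>The vertical metric \<open>2 dt d(t\<rho>)\<close> is flat with affine coordinates t and
  t\<rho>. The symbol 1/t appears because \<rho> is used as coordinate in place of t\<rho>.\<close>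

lemma christoffel_h_vertical:
  assumes "k < Suc (Suc n)"
  shows "christoffel ambient h (c, ab) (p, t, \<rho>) k n n = 0"
    and "christoffel ambient h (c, ab) (p, t, \<rho>) k n (Suc n) = (if k = Suc n then 1 / t else 0)"
    and "christoffel ambient h (c, ab) (p, t, \<rho>) k (Suc n) n = (if k = Suc n then 1 / t else 0)"
    and "christoffel ambient h (c, ab) (p, t, \<rho>) k (Suc n) (Suc n) = 0"
proof -
  have "k < n \<or> k = n \<or> k = Suc n" using assms by linarith
  then show "christoffel ambient h (c, ab) (p, t, \<rho>) k n n = 0"
    "christoffel ambient h (c, ab) (p, t, \<rho>) k n (Suc n) = (if k = Suc n then 1 / t else 0)"
    "christoffel ambient h (c, ab) (p, t, \<rho>) k (Suc n) n = (if k = Suc n then 1 / t else 0)"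
    "christoffel ambient h (c, ab) (p, t, \<rho>) k (Suc n) (Suc n) = 0"
    by (elim disjE; simp add: christoffel_def ambient_simps inverse_matrix_h pd_h)+
qed

lemma christoffel_h_mixed_up:
  assumes i: "i < n" and k: "k = n \<or> k = Suc n" and j: "j = n \<or> j = Suc n"
  shows "christoffel ambient h (c, ab) (p, t, \<rho>) k i j = 0"
    and "christoffel ambient h (c, ab) (p, t, \<rho>) k j i = 0"
  using k j i by (elim disjE; simp add: christoffel_def ambient_simps inverse_matrix_h pd_h)+

lemma christoffel_h_sum:
  fixes u V :: "nat \<Rightarrow> real"
  shows "k < n \<Longrightarrow>
      (\<Sum>i<Suc (Suc n). \<Sum>j<Suc (Suc n). christoffel ambient h (c, ab) (p, t, \<rho>) k i j * u i * V j) =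
      (\<Sum>i<n. \<Sum>j<n. christoffel M g c p k i j * u i * V j) +
      (u k * V n + u n * V k) / t + e k / (1 + e k * \<rho>) * (u k * V (Suc n) + u (Suc n) * V k)"
    and "(\<Sum>i<Suc (Suc n). \<Sum>j<Suc (Suc n). christoffel ambient h (c, ab) (p, t, \<rho>) n i j * u i * V j) =
      - (\<Sum>i<n. \<Sum>j<n. t * (1 + e i * \<rho>) * e i * g c p i j * u i * V j)"
    and "(\<Sum>i<Suc (Suc n). \<Sum>j<Suc (Suc n). christoffel ambient h (c, ab) (p, t, \<rho>) (Suc n) i j * u i * V j) =
      - (\<Sum>i<n. \<Sum>j<n. (1 + e i * \<rho>) * (1 - e i * \<rho>) * g c p i j * u i * V j) +
      (u n * V (Suc n) + u (Suc n) * V n) / t"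
proof -
  show "(\<Sum>i<Suc (Suc n). \<Sum>j<Suc (Suc n). christoffel ambient h (c, ab) (p, t, \<rho>) n i j * u i * V j) =
      - (\<Sum>i<n. \<Sum>j<n. t * (1 + e i * \<rho>) * e i * g c p i j * u i * V j)"
    by (simp add: christoffel_h_up christoffel_h_mixed_up christoffel_h_vertical sum_negf)
  show "(\<Sum>i<Suc (Suc n). \<Sum>j<Suc (Suc n). christoffel ambient h (c, ab) (p, t, \<rho>) (Suc n) i j * u i * V j) =
      - (\<Sum>i<n. \<Sum>j<n. (1 + e i * \<rho>) * (1 - e i * \<rho>) * g c p i j * u i * V j) +
      (u n * V (Suc n) + u (Suc n) * V n) / t"
    by (simp add: christoffel_h_up christoffel_h_mixed_up christoffel_h_vertical sum_negf[symmetric]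
        add_divide_distrib)
  assume k: "k < n"
  have delta: "(\<Sum>i<n. (if k = i then a else 0) * f i * b) = a * f k * b"
    "(\<Sum>i<n. (if k = i then a else 0) * b * f i) = a * b * f k" for a b and f :: "nat \<Rightarrow> real"
  proof -
    have *: "(if k = i then a else 0) * f i * b = (if i = k then a * f k * b else 0)"
      "(if k = i then a else 0) * b * f i = (if i = k then a * b * f k else 0)" for i
      by auto
    with k show "(\<Sum>i<n. (if k = i then a else 0) * f i * b) = a * f k * b"
      "(\<Sum>i<n. (if k = i then a else 0) * b * f i) = a * b * f k"
      unfolding * by simp_all
  qed
  show "(\<Sum>i<Suc (Suc n). \<Sum>j<Suc (Suc n). christoffel ambient h (c, ab) (p, t, \<rho>) k i j * u i * V j) =
      (\<Sum>i<n. \<Sum>j<n. christoffel M g c p k i j * u i * V j) +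
      (u k * V n + u n * V k) / t + e k / (1 + e k * \<rho>) * (u k * V (Suc n) + u (Suc n) * V k)"
    using k by (simp add: christoffel_h_base christoffel_h_mixed christoffel_h_vertical sum.distrib
        delta add_divide_distrib distrib_left)
qed

end

end

section \<open>Ambient tangent vectors as tractors\<close>

text \<open>If \<open>A = P\<^sup>T B P\<close> is nondegenerate, then
  \<open>B P A\<^sup>-\<^sup>1\<close> is a right inverse of \<open>P\<^sup>T\<close>, hence also a
  left inverse. For a Jacobian \<open>P\<close> this extracts invertibility from the transformation
  law of the metric, without inverting the change of charts.\<close>

lemma congruence_transpose_injective:
  fixes A B P :: "nat \<Rightarrow> nat \<Rightarrow> real" and v :: "nat \<Rightarrow> real"
  assumes A: "nondegenerate_matrix n A"
    and AB: "\<And>i j. i < n \<Longrightarrow> j < n \<Longrightarrow> A i j = (\<Sum>k<n. \<Sum>l<n. P k i * P l j * B k l)"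
    and v: "\<And>i. i < n \<Longrightarrow> (\<Sum>k<n. P k i * v k) = 0" and k: "k < n"
  shows "v k = 0"
proof -
  define R where "R k m = (\<Sum>j<n. \<Sum>l<n. B k l * P l j * inverse_matrix n A j m)" for k m
  have right: "(\<Sum>k<n. P k i * R k m) = (if i = m then 1 else 0)" if im: "i < n" "m < n" for i m
  proof -
    have "(\<Sum>k<n. P k i * R k m) = (\<Sum>k<n. \<Sum>j<n. \<Sum>l<n. P k i * P l j * B k l * inverse_matrix n A j m)"
      by (simp add: R_def sum_distrib_left mult_ac)
    also have "\<dots> = (\<Sum>j<n. \<Sum>k<n. \<Sum>l<n. P k i * P l j * B k l * inverse_matrix n A j m)"
      by (rule sum.swap)
    also have "\<dots> = (\<Sum>j<n. A i j * inverse_matrix n A j m)"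
      by (intro sum.cong refl) (simp add: AB[OF im(1)] sum_distrib_right)
    finally show ?thesis by (simp only: inverse_matrix_right[OF A im])
  qed
  have "\<forall>i<n. \<forall>m<n. (\<Sum>j<n. R i j * P m j) = (if i = m then 1 else 0)"
    by (rule right_inverse_imp_left_inverse[of n "\<lambda>i k. P k i" R]) (intro allI impI right)
  then have left: "(\<Sum>j<n. R k j * P m j) = (if k = m then 1 else 0)" if "m < n" for m
    using k that by blast
  have "v k = (\<Sum>m<n. (if k = m then 1 else 0) * v m)"
    by (rule sum_kronecker_mult(1)[OF k, symmetric])
  also have "\<dots> = (\<Sum>m<n. (\<Sum>j<n. R k j * P m j) * v m)"
    by (intro sum.cong refl) (simp only: left lessThan_iff)
  also have "\<dots> = (\<Sum>j<n. R k j * (\<Sum>m<n. P m j * v m))"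
    unfolding sum_distrib_left sum_distrib_right by (subst sum.swap) (simp only: mult.assoc)
  also have "\<dots> = 0"
    by (intro sum.neutral ballI) (simp add: v)
  finally show ?thesis .
qed

context split_conformal
begin

definition to_tractor :: "'p \<Rightarrow> real \<Rightarrow> real \<Rightarrow> ('k ambient_label \<Rightarrow> nat \<Rightarrow> real) \<Rightarrow> 'k tractor" where
  "to_tractor p t \<rho> \<xi> =
     (let c\<^sub>0 = (SOME c. c \<in> charts M \<and> p \<in> cdom M c) in
      (t * \<xi> (c\<^sub>0, (), ()) (Suc n) + \<rho> * \<xi> (c\<^sub>0, (), ()) n,
       (\<lambda>c b. if c \<in> charts M \<and> p \<in> cdom M c \<and> b < n
              then t * (1 + e b * \<rho>) * (\<Sum>k<n. g c p b k * \<xi> (c, (), ()) k) else 0),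
       \<xi> (c\<^sub>0, (), ()) n))"

lemma to_tractor_0: "to_tractor p t 0 = ambient_to_tractor M g p t"
  by (simp add: fun_eq_iff to_tractor_def ambient_to_tractor_def Let_def)

context
  fixes p :: 'p and t \<rho> :: real
  assumes t: "t > 0" and \<rho>: "\<rho> \<in> J"
begin

lemma tangent_ambient_iff:
  "X \<in> tangent_space ambient (p, t, \<rho>) \<longleftrightarrow>
     (\<forall>c k. \<not> (c \<in> charts M \<and> p \<in> cdom M c \<and> k < Suc (Suc n)) \<longrightarrow> X (c, (), ()) k = 0) \<and>
     (\<forall>c\<in>charts M. \<forall>d\<in>charts M. p \<in> cdom M c \<and> p \<in> cdom M d \<longrightarrow>
        (\<forall>k<n. X (d, (), ()) k = (\<Sum>j<n. jac M c d p k j * X (c, (), ()) j)) \<and>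
        X (d, (), ()) n = X (c, (), ()) n \<and> X (d, (), ()) (Suc n) = X (c, (), ()) (Suc n))"
proof -
  have dom: "(p, t, \<rho>) \<in> cdom ambient (c, (), ()) \<longleftrightarrow> p \<in> cdom M c" if "c \<in> charts M" for c
    using t \<rho> ambient_simps(3)[OF that, of "((), ())"] by simp
  have comp: "component_family ambient (p, t, \<rho>) X \<longleftrightarrow>
      (\<forall>c k. \<not> (c \<in> charts M \<and> p \<in> cdom M c \<and> k < Suc (Suc n)) \<longrightarrow> X (c, (), ()) k = 0)"
  proof -
    have "component_family ambient (p, t, \<rho>) X \<longleftrightarrow> (\<forall>c k. \<not> (c \<in> charts M \<and>
        (p, t, \<rho>) \<in> cdom ambient (c, (), ()) \<and> k < Suc (Suc n)) \<longrightarrow> X (c, (), ()) k = 0)"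
      unfolding component_family_def by (simp add: ambient_simps(1,2) split_paired_All)
    also have "\<dots> \<longleftrightarrow>
        (\<forall>c k. \<not> (c \<in> charts M \<and> p \<in> cdom M c \<and> k < Suc (Suc n)) \<longrightarrow> X (c, (), ()) k = 0)"
      by (intro iff_allI imp_cong refl) (auto simp: dom)
    finally show ?thesis .
  qed
  have law: "(\<forall>k<Suc (Suc n). X (d, (), ()) k =
        (\<Sum>j<Suc (Suc n). jac ambient (c, (), ()) (d, (), ()) (p, t, \<rho>) k j * X (c, (), ()) j)) \<longleftrightarrow>
      (\<forall>k<n. X (d, (), ()) k = (\<Sum>j<n. jac M c d p k j * X (c, (), ()) j)) \<and>
        X (d, (), ()) n = X (c, (), ()) n \<and> X (d, (), ()) (Suc n) = X (c, (), ()) (Suc n)"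
    if "c \<in> charts M" "p \<in> cdom M c" for c d
    by (auto simp: All_less_Suc jac_ambient[OF that t \<rho>])
  have all: "(\<forall>c\<in>charts ambient. \<forall>d\<in>charts ambient.
        (p, t, \<rho>) \<in> cdom ambient c \<inter> cdom ambient d \<longrightarrow> R c d) \<longleftrightarrow>
      (\<forall>c\<in>charts M. \<forall>d\<in>charts M. p \<in> cdom M c \<and> p \<in> cdom M d \<longrightarrow> R (c, (), ()) (d, (), ()))" for R
    by (auto simp: ambient_simps(2) dom)
  show ?thesis
    unfolding tangent_space_def mem_Collect_eq all ambient_simps(1) comp
    by (intro conj_cong ball_cong imp_cong refl law) auto
qed

text \<open>Removes the chart chosen by \<open>SOME\<close>: chart changes act on the base alone, so
  the t and \<rho> components agree in all charts around the point.\<close>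

lemma to_tractor_chart:
  assumes X: "X \<in> tangent_space ambient (p, t, \<rho>)" and c: "c \<in> charts M" "p \<in> cdom M c"
  shows "fst (to_tractor p t \<rho> X) = t * X (c, (), ()) (Suc n) + \<rho> * X (c, (), ()) n"
    and "b < n \<Longrightarrow> fst (snd (to_tractor p t \<rho> X)) c b =
      t * (1 + e b * \<rho>) * (\<Sum>k<n. g c p b k * X (c, (), ()) k)"
    and "snd (snd (to_tractor p t \<rho> X)) = X (c, (), ()) n"
proof -
  define c\<^sub>0 where "c\<^sub>0 = (SOME c. c \<in> charts M \<and> p \<in> cdom M c)"
  have "c\<^sub>0 \<in> charts M \<and> p \<in> cdom M c\<^sub>0"
    unfolding c\<^sub>0_def by (rule someI[of _ c]) (simp add: c)
  then have "X (c, (), ()) n = X (c\<^sub>0, (), ()) n" "X (c, (), ()) (Suc n) = X (c\<^sub>0, (), ()) (Suc n)"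
    using X c unfolding tangent_ambient_iff by blast+
  then show "fst (to_tractor p t \<rho> X) = t * X (c, (), ()) (Suc n) + \<rho> * X (c, (), ()) n"
    and "snd (snd (to_tractor p t \<rho> X)) = X (c, (), ()) n"
    by (simp_all add: to_tractor_def Let_def c\<^sub>0_def[symmetric])
  show "b < n \<Longrightarrow> fst (snd (to_tractor p t \<rho> X)) c b =
      t * (1 + e b * \<rho>) * (\<Sum>k<n. g c p b k * X (c, (), ()) k)"
    using c by (simp add: to_tractor_def Let_def)
qed

text \<open>Lowering with \<open>g\<close> turns the vector law into the covector law. The scale
  factor passes through the Jacobian because \<open>jac M c d p k j\<close> vanishes unless
  \<open>e k = e j\<close>.\<close>

lemma to_tractor_in_fibre:
  assumes X: "X \<in> tangent_space ambient (p, t, \<rho>)"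
  shows "to_tractor p t \<rho> X \<in> tractor_fibre M p"
proof -
  define \<omega> where "\<omega> = fst (snd (to_tractor p t \<rho> X))"
  have zero: "\<omega> c b = 0" if "\<not> (c \<in> charts M \<and> p \<in> cdom M c \<and> b < n)" for c b
    using that by (auto simp: \<omega>_def to_tractor_def Let_def)
  have "\<omega> c j = (\<Sum>k<n. jac M c d p k j * \<omega> d k)"
    if c: "c \<in> charts M" "p \<in> cdom M c" and d: "d \<in> charts M" "p \<in> cdom M d" and j: "j < n" for c d j
  proof -
    let ?J = "jac M c d p" and ?X = "\<lambda>j. X (c, (), ()) j"
    have Xd: "X (d, (), ()) l = (\<Sum>b<n. ?J l b * ?X b)" if "l < n" for l
      using X c d that unfolding tangent_ambient_iff by blast
    have "(\<Sum>b<n. g c p j b * ?X b) = (\<Sum>b<n. \<Sum>k<n. \<Sum>l<n. ?J k j * (?J l b * g d p k l * ?X b))"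
      by (intro sum.cong refl)
        (simp add: transform[OF c(1) d(1) c(2) d(2) j] sum_distrib_right mult.assoc)
    also have "\<dots> = (\<Sum>k<n. \<Sum>b<n. \<Sum>l<n. ?J k j * (?J l b * g d p k l * ?X b))"
      by (rule sum.swap)
    also have "\<dots> = (\<Sum>k<n. ?J k j * (\<Sum>l<n. g d p k l * X (d, (), ()) l))"
    proof (intro sum.cong refl)
      fix k
      have "(\<Sum>b<n. \<Sum>l<n. ?J k j * (?J l b * g d p k l * ?X b)) =
          (\<Sum>l<n. \<Sum>b<n. ?J k j * (?J l b * g d p k l * ?X b))"
        by (rule sum.swap)
      also have "\<dots> = ?J k j * (\<Sum>l<n. g d p k l * X (d, (), ()) l)"
        by (simp add: Xd sum_distrib_left mult_ac)
      finally show "(\<Sum>b<n. \<Sum>l<n. ?J k j * (?J l b * g d p k l * ?X b)) =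
          ?J k j * (\<Sum>l<n. g d p k l * X (d, (), ()) l)" .
    qed
    finally have eq: "(\<Sum>b<n. g c p j b * ?X b) = (\<Sum>k<n. ?J k j * (\<Sum>l<n. g d p k l * X (d, (), ()) l))" .
    have "\<omega> c j = (\<Sum>k<n. t * (1 + e j * \<rho>) * (?J k j * (\<Sum>l<n. g d p k l * X (d, (), ()) l)))"
      unfolding \<omega>_def to_tractor_chart(2)[OF X c j] eq sum_distrib_left ..
    also have "\<dots> = (\<Sum>k<n. ?J k j * \<omega> d k)"
    proof (intro sum.cong refl)
      fix k assume "k \<in> {..<n}"
      then have k: "k < n" by simp
      have "e k = e j \<or> ?J k j = 0" using e_jac[OF c(1) d(1) c(2) d(2) k j] by blast
      then show "t * (1 + e j * \<rho>) * (?J k j * (\<Sum>l<n. g d p k l * X (d, (), ()) l)) = ?J k j * \<omega> d k"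
        unfolding \<omega>_def to_tractor_chart(2)[OF X d k] by auto
    qed
    finally show ?thesis .
  qed
  with zero have "\<omega> \<in> cotangent_space M p"
    unfolding cotangent_space_def component_family_def by blast
  then show ?thesis
    unfolding tractor_fibre_def \<omega>_def by (cases "to_tractor p t \<rho> X") auto
qed

text \<open>The system is triangular: \<tau> determines the t component, then \<sigma> the \<rho>
  component; nondegeneracy of \<open>g\<close> settles the base components.\<close>

lemma inj_on_to_tractor:
  assumes p: "p \<in> topspace (topo M)"
  shows "inj_on (to_tractor p t \<rho>) (tangent_space ambient (p, t, \<rho>))"
proof (rule inj_onI)
  fix X Y assume X: "X \<in> tangent_space ambient (p, t, \<rho>)" and Y: "Y \<in> tangent_space ambient (p, t, \<rho>)"
    and eq: "to_tractor p t \<rho> X = to_tractor p t \<rho> Y"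
  have eq_c: "X (c, (), ()) k = Y (c, (), ()) k"
    if c: "c \<in> charts M" "p \<in> cdom M c" and k: "k < Suc (Suc n)" for c k
  proof -
    have n: "X (c, (), ()) n = Y (c, (), ()) n"
      using eq to_tractor_chart(3)[OF X c] to_tractor_chart(3)[OF Y c] by simp
    have Sn: "X (c, (), ()) (Suc n) = Y (c, (), ()) (Suc n)"
      using eq to_tractor_chart(1)[OF X c] to_tractor_chart(1)[OF Y c] n t by simp
    have "(\<Sum>j<n. g c p b j * (X (c, (), ()) j - Y (c, (), ()) j)) = 0" if b: "b < n" for b
    proof -
      have "t * (1 + e b * \<rho>) * (\<Sum>k<n. g c p b k * X (c, (), ()) k) =
          t * (1 + e b * \<rho>) * (\<Sum>k<n. g c p b k * Y (c, (), ()) k)"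
        unfolding to_tractor_chart(2)[OF X c b, symmetric] to_tractor_chart(2)[OF Y c b, symmetric] eq ..
      then show ?thesis
        using t factor_nz[OF \<rho> b] by (simp add: right_diff_distrib sum_subtractf)
    qed
    then have "X (c, (), ()) j - Y (c, (), ()) j = 0" if "j < n" for j
      using nondeg[OF c, unfolded nondegenerate_matrix_def, rule_format,
        of "\<lambda>j. X (c, (), ()) j - Y (c, (), ()) j" j] that by blast
    with n Sn k show ?thesis by (auto simp: less_Suc_eq)
  qed
  show "X = Y"
  proof (intro ext)
    fix cab :: "'k ambient_label" and k
    obtain c where [simp]: "cab = (c, (), ())" by (metis old.unit.exhaust prod.exhaust)
    show "X cab k = Y cab k"
    proof (cases "c \<in> charts M \<and> p \<in> cdom M c \<and> k < Suc (Suc n)")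
      case True
      then show ?thesis using eq_c by simp
    next
      case False
      then have "X (c, (), ()) k = 0" "Y (c, (), ()) k = 0"
        using X Y unfolding tangent_ambient_iff by blast+
      then show ?thesis by simp
    qed
  qed
qed

lemma to_tractor_surj:
  assumes p: "p \<in> topspace (topo M)" and W: "W \<in> tractor_fibre M p"
  shows "\<exists>X\<in>tangent_space ambient (p, t, \<rho>). to_tractor p t \<rho> X = W"
proof -
  obtain \<sigma> \<omega> \<tau> where [simp]: "W = (\<sigma>, \<omega>, \<tau>)" by (rule prod_cases3)
  have "\<omega> \<in> cotangent_space M p" using W by (simp add: tractor_fibre_def)
  then have zero: "\<And>c b. \<not> (c \<in> charts M \<and> p \<in> cdom M c \<and> b < n) \<Longrightarrow> \<omega> c b = 0"
    and cov: "\<And>c d j. c \<in> charts M \<Longrightarrow> d \<in> charts M \<Longrightarrow> p \<in> cdom M c \<Longrightarrow> p \<in> cdom M d \<Longrightarrow> j < n \<Longrightarrow>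
      \<omega> c j = (\<Sum>k<n. jac M c d p k j * \<omega> d k)"
    unfolding cotangent_space_def component_family_def by blast+
  \<comment> \<open>The covector with the scaling undone; what remains is to raise its
    index.\<close>
  define w where "w c b = \<omega> c b / (t * (1 + e b * \<rho>))" for c b
  define X :: "'k ambient_label \<Rightarrow> nat \<Rightarrow> real" where
    "X = (\<lambda>(c, _) k. if c \<in> charts M \<and> p \<in> cdom M c
       then if k < n then \<Sum>b<n. inverse_matrix n (g c p) k b * w c b
         else if k = n then \<tau> else if k = Suc n then (\<sigma> - \<rho> * \<tau>) / t else 0
       else 0)"
  have gX: "(\<Sum>k<n. g c p b k * X (c, (), ()) k) = w c b"
    if c: "c \<in> charts M" "p \<in> cdom M c" and b: "b < n" for c b
  proof -
    have "(\<Sum>k<n. g c p b k * X (c, (), ()) k) =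
        (\<Sum>k<n. \<Sum>j<n. g c p b k * inverse_matrix n (g c p) k j * w c j)"
      using c by (simp add: X_def sum_distrib_left mult.assoc)
    also have "\<dots> = (\<Sum>j<n. (\<Sum>k<n. g c p b k * inverse_matrix n (g c p) k j) * w c j)"
      by (subst sum.swap) (simp only: sum_distrib_right)
    also have "\<dots> = (\<Sum>j<n. (if b = j then 1 else 0) * w c j)"
      by (intro sum.cong refl) (simp only: lessThan_iff inverse_matrix_right[OF nondeg[OF c] b])
    also have "\<dots> = w c b" by (rule sum_kronecker_mult(1)[OF b])
    finally show ?thesis .
  qed
  \<comment> \<open>Vectors raised in different charts must fit together. The transposed Jacobian
    annihilates the difference between \<open>?Y\<close> lowered in \<open>d\<close> and
    \<open>w d\<close>, so this difference is 0, and nondegeneracy of \<open>g\<close> in the chart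
    \<open>d\<close> identifies \<open>?Y\<close> with the components of \<open>X\<close>.\<close>
  have Xd: "X (d, (), ()) k = (\<Sum>j<n. jac M c d p k j * X (c, (), ()) j)"
    if c: "c \<in> charts M" "p \<in> cdom M c" and d: "d \<in> charts M" "p \<in> cdom M d" and k: "k < n" for c d k
  proof -
    let ?J = "jac M c d p"
    let ?Y = "\<lambda>k. \<Sum>j<n. ?J k j * X (c, (), ()) j"
    have wJ: "w c j = (\<Sum>k<n. ?J k j * w d k)" if j: "j < n" for j
    proof -
      have "w c j = (\<Sum>k<n. ?J k j * \<omega> d k / (t * (1 + e j * \<rho>)))"
        unfolding w_def cov[OF c(1) d(1) c(2) d(2) j] sum_divide_distrib ..
      also have "\<dots> = (\<Sum>k<n. ?J k j * w d k)"
      proof (intro sum.cong refl)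
        fix k assume "k \<in> {..<n}"
        then have "e k = e j \<or> ?J k j = 0" using e_jac[OF c(1) d(1) c(2) d(2) _ j] by blast
        then show "?J k j * \<omega> d k / (t * (1 + e j * \<rho>)) = ?J k j * w d k"
          unfolding w_def by auto
      qed
      finally show ?thesis .
    qed
    have JgY: "(\<Sum>k<n. ?J k i * (\<Sum>l<n. g d p k l * ?Y l)) = w c i" if i: "i < n" for i
    proof -
      have "w c i = (\<Sum>j<n. (\<Sum>k<n. \<Sum>l<n. ?J k i * ?J l j * g d p k l) * X (c, (), ()) j)"
        unfolding gX[OF c i, symmetric]
        by (intro sum.cong refl) (simp only: lessThan_iff transform[OF c(1) d(1) c(2) d(2) i])
      also have "\<dots> = (\<Sum>j<n. \<Sum>k<n. \<Sum>l<n. ?J k i * ?J l j * g d p k l * X (c, (), ()) j)"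
        by (simp only: sum_distrib_right)
      also have "\<dots> = (\<Sum>k<n. \<Sum>j<n. \<Sum>l<n. ?J k i * ?J l j * g d p k l * X (c, (), ()) j)"
        by (rule sum.swap)
      also have "\<dots> = (\<Sum>k<n. \<Sum>l<n. \<Sum>j<n. ?J k i * ?J l j * g d p k l * X (c, (), ()) j)"
        by (rule sum.cong[OF refl], rule sum.swap)
      also have "\<dots> = (\<Sum>k<n. ?J k i * (\<Sum>l<n. g d p k l * ?Y l))"
        by (simp only: sum_distrib_left mult_ac)
      finally show ?thesis ..
    qed
    have gY: "(\<Sum>l<n. g d p b l * ?Y l) - w d b = 0" if b: "b < n" for b
    proof (rule congruence_transpose_injective[OF nondeg[OF c] transform[OF c(1) d(1) c(2) d(2)] _ b])
      fix i assume i: "i < n"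
      show "(\<Sum>k<n. ?J k i * ((\<Sum>l<n. g d p k l * ?Y l) - w d k)) = 0"
        unfolding right_diff_distrib sum_subtractf JgY[OF i] wJ[OF i] by simp
    qed
    have "(\<Sum>l<n. g d p b l * (X (d, (), ()) l - ?Y l)) = 0" if b: "b < n" for b
      using gY[OF b] gX[OF d b] unfolding right_diff_distrib sum_subtractf by simp
    then have "X (d, (), ()) k - ?Y k = 0"
      using nondeg[OF d, unfolded nondegenerate_matrix_def, rule_format,
        of "\<lambda>l. X (d, (), ()) l - ?Y l" k] k by blast
    then show ?thesis by simp
  qed
  have X: "X \<in> tangent_space ambient (p, t, \<rho>)"
    unfolding tangent_ambient_iff
    by (intro conjI allI impI ballI; (rule Xd; blast)?) (auto simp: X_def)
  obtain c where c: "c \<in> charts M" "p \<in> cdom M c" using p cover by blast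
  have "fst (to_tractor p t \<rho> X) = \<sigma>" "snd (snd (to_tractor p t \<rho> X)) = \<tau>"
    using c t by (simp_all add: to_tractor_chart[OF X c]) (simp_all add: X_def)
  moreover have "fst (snd (to_tractor p t \<rho> X)) = \<omega>"
  proof (intro ext)
    fix c b
    show "fst (snd (to_tractor p t \<rho> X)) c b = \<omega> c b"
    proof (cases "c \<in> charts M \<and> p \<in> cdom M c \<and> b < n")
      case True
      then show ?thesis
        using t factor_nz[OF \<rho>, of b] by (simp add: to_tractor_chart(2)[OF X] gX w_def)
    next
      case False
      then show ?thesis using zero by (auto simp: to_tractor_def Let_def)
    qed
  qed
  ultimately have "to_tractor p t \<rho> X = W" by (simp add: prod_eq_iff)
  with X show ?thesis by blast
qed

lemma bij_betw_to_tractor: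
  assumes p: "p \<in> topspace (topo M)"
  shows "bij_betw (to_tractor p t \<rho>) (tangent_space ambient (p, t, \<rho>)) (tractor_fibre M p)"
  unfolding bij_betw_def
  using inj_on_to_tractor[OF p] to_tractor_surj[OF p] to_tractor_in_fibre by blast

end

end

section \<open>Parallel transport\<close>

lemma inverse_matrix_solve:
  assumes A: "nondegenerate_matrix n A" and b: "b < n"
  shows "(\<Sum>k<n. A b k * (\<Sum>m<n. inverse_matrix n A k m * w m)) = w b"
    and "(\<Sum>k<n. inverse_matrix n A b k * (\<Sum>m<n. A k m * w m)) = w b"
proof -
  have *: "(\<Sum>k<n. B b k * (\<Sum>m<n. C k m * w m)) = w b"
    if "\<And>m. m < n \<Longrightarrow> (\<Sum>k<n. B b k * C k m) = (if b = m then 1 else 0)" for B C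
  proof -
    have "(\<Sum>k<n. B b k * (\<Sum>m<n. C k m * w m)) = (\<Sum>m<n. (\<Sum>k<n. B b k * C k m) * w m)"
      unfolding sum_distrib_left sum_distrib_right by (subst sum.swap) (simp only: mult.assoc)
    also have "\<dots> = (\<Sum>m<n. (if b = m then 1 else 0) * w m)"
      by (intro sum.cong refl) (simp only: that lessThan_iff)
    also have "\<dots> = w b" by (rule sum_kronecker_mult(1)[OF b])
    finally show ?thesis .
  qed
  show "(\<Sum>k<n. A b k * (\<Sum>m<n. inverse_matrix n A k m * w m)) = w b"
    by (rule *) (rule inverse_matrix_right[OF A b])
  show "(\<Sum>k<n. inverse_matrix n A b k * (\<Sum>m<n. A k m * w m)) = w b"
    by (rule *) (rule inverse_matrix_left[OF A b])
qed

text \<open>Bookkeeping for the covector slot: \<open>x\<close> and \<open>y\<close> are the field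
  and the velocity lowered at an index \<open>b\<close>, \<open>l\<close> is the warping factor,
  \<open>f\<close> the eigenvalue. All terms in \<open>x\<close> other than those inside
  \<open>A\<close> cancel: the change of the scale \<open>t * l\<close> along the curve offsets the
  mixed Christoffel symbols. This is why the motion of t and \<rho> leaves no trace in the
  tractor.\<close>

lemma transport_algebra:
  fixes t l :: real
  assumes "t \<noteq> 0" "l \<noteq> 0"
  shows "(a * l + t * f * b) * x + t * l * (A + B + (- B - (y * (c / t) + x * (a / t))
      - (y * (f / l * d) + x * (f / l * b)))) = t * l * A - l * y * c - t * f * y * d"
  using assms by (simp add: field_simps)

section \<open>The transport equations in components\<close>

context split_conformal
begin

context
  fixes c :: 'k and p :: 'p
  assumes c: "c \<in> charts M" and p: "p \<in> cdom M c"
begin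

lemma pd_g_sym:
  "i < n \<Longrightarrow> j < n \<Longrightarrow> l < n \<Longrightarrow> pd M c l (\<lambda>p. g c p i j) p = pd M c l (\<lambda>p. g c p j i) p"
  by (rule pd_cong[OF reg c p]) (auto intro: sym[OF c])

lemma christoffel_lower:
  assumes "b < n"
  shows "(\<Sum>l<n. g c p b l * christoffel M g c p l i k) =
    (pd M c i (\<lambda>p. g c p k b) p + pd M c k (\<lambda>p. g c p i b) p - pd M c b (\<lambda>p. g c p i k) p) / 2"
  using inverse_matrix_solve(1)[OF nondeg[OF c p] assms, of "\<lambda>l. pd M c i (\<lambda>p. g c p k l) p +
      pd M c k (\<lambda>p. g c p i l) p - pd M c l (\<lambda>p. g c p i k) p"]
  by (simp add: christoffel_def sum_divide_distrib[symmetric])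

text \<open>In the sum of the two lowered symbols the derivatives other than the one in direction
  \<open>i\<close> cancel by symmetry of the metric.\<close>

lemma metric_compatibility:
  assumes "i < n" "b < n" "k < n"
  shows "pd M c i (\<lambda>p. g c p b k) p =
    (\<Sum>l<n. g c p k l * christoffel M g c p l i b) + (\<Sum>l<n. g c p b l * christoffel M g c p l i k)"
  unfolding christoffel_lower[OF assms(2)] christoffel_lower[OF assms(3)]
  using pd_g_sym[of k b i] assms by (simp add: field_simps)

lemma e_christoffel:
  assumes "k < n" "i < n" "j < n" "e k \<noteq> e j"
  shows "christoffel M g c p k i j = 0"
proof -
  have *: "inverse_matrix n (g c p) k l * (pd M c i (\<lambda>p. g c p j l) p + pd M c j (\<lambda>p. g c p i l) p -
      pd M c l (\<lambda>p. g c p i j) p) = 0" if l: "l < n" for l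
  proof (cases "e k = e l")
    case True
    with assms(4) have jl: "e j \<noteq> e l" by simp
    \<comment> \<open>Each of the three derivatives has both \<open>j\<close> and \<open>l\<close>
      among its indices, so its indices do not all share one eigenvalue.\<close>
    then have "pd M c i (\<lambda>p. g c p j l) p = 0" "pd M c j (\<lambda>p. g c p i l) p = 0" "pd M c l (\<lambda>p. g c p i j) p = 0"
      using assms l by (metis e_pd[OF c p])+
    then show ?thesis by simp
  next
    case False
    then show ?thesis using e_ginv[OF c p assms(1) l] by simp
  qed
  show ?thesis
    unfolding christoffel_def divide_eq_0_iff
    by (rule disjI1, rule sum.neutral, rule ballI) (simp only: lessThan_iff *)
qed

context
  fixes t \<rho> :: real and u X \<omega> :: "nat \<Rightarrow> real"
  assumes t: "t > 0" and \<rho>: "\<rho> \<in> J"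
    and \<omega>: "\<forall>b<n. \<omega> b = t * (1 + e b * \<rho>) * (\<Sum>k<n. g c p b k * X k)"
begin

text \<open>The derivative that ambient parallelism along a curve with velocity \<open>u\<close>
  prescribes for the component \<open>X k\<close>.\<close>

abbreviation "rhs k \<equiv> - (\<Sum>i<Suc (Suc n). \<Sum>j<Suc (Suc n).
  christoffel ambient h (c, (), ()) (p, t, \<rho>) k i j * u i * X j)"

lemmas \<omega>' = \<omega>[rule_format]
lemmas rhs_sum = christoffel_h_sum[OF c p t \<rho>]

text \<open>The vertical terms from the product rule cancel those of the Christoffel symbol 1/t. The
  base terms combine by \<open>(1 - e i * \<rho>) + e i * \<rho> = 1\<close>.\<close>

lemma transport_sigma:
  "u n * X (Suc n) + t * rhs (Suc n) + (u (Suc n) * X n + \<rho> * rhs n) = (\<Sum>i<n. u i * \<omega> i)"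
proof -
  have "(\<Sum>i<n. u i * \<omega> i) = (\<Sum>i<n. \<Sum>j<n. t * ((1 + e i * \<rho>) * (1 - e i * \<rho>) * g c p i j * u i * X j) +
      \<rho> * (t * (1 + e i * \<rho>) * e i * g c p i j * u i * X j))"
    by (intro sum.cong refl) (simp add: \<omega>' sum_distrib_left algebra_simps)
  also have "\<dots> = t * (\<Sum>i<n. \<Sum>j<n. (1 + e i * \<rho>) * (1 - e i * \<rho>) * g c p i j * u i * X j) +
      \<rho> * (\<Sum>i<n. \<Sum>j<n. t * (1 + e i * \<rho>) * e i * g c p i j * u i * X j)"
    by (simp only: sum.distrib sum_distrib_left)
  finally show ?thesis
    unfolding rhs_sum using t by (simp add: field_simps)
qed

text \<open>As the Schouten tensor is \<open>e i\<close> times the metric, its contraction with the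
  inverse metric leaves \<open>u i * e i * \<omega> i\<close>, which is also the ambient
  term.\<close>

lemma transport_tau:
  "rhs n = (\<Sum>i<n. \<Sum>d<n. \<Sum>k<n. u i * schouten M g c p i d * inverse_matrix n (g c p) d k * \<omega> k)"
proof -
  have "(\<Sum>d<n. \<Sum>k<n. u i * schouten M g c p i d * inverse_matrix n (g c p) d k * \<omega> k) =
      u i * e i * \<omega> i" if i: "i < n" for i
  proof -
    have "(\<Sum>d<n. \<Sum>k<n. u i * schouten M g c p i d * inverse_matrix n (g c p) d k * \<omega> k) =
        u i * e i * (\<Sum>d<n. g c p i d * (\<Sum>k<n. inverse_matrix n (g c p) d k * \<omega> k))"
      unfolding sum_distrib_left
      by (intro sum.cong refl) (simp add: schouten[OF c p i] mult_ac)
    then show ?thesis unfolding inverse_matrix_solve(1)[OF nondeg[OF c p] i] .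
  qed
  then have "(\<Sum>i<n. \<Sum>d<n. \<Sum>k<n. u i * schouten M g c p i d * inverse_matrix n (g c p) d k * \<omega> k) =
      (\<Sum>i<n. u i * e i * \<omega> i)"
    by (intro sum.cong) simp_all
  also have "\<dots> = (\<Sum>i<n. \<Sum>j<n. t * (1 + e i * \<rho>) * e i * g c p i j * u i * X j)"
    by (intro sum.cong refl) (simp add: \<omega>' sum_distrib_left mult_ac)
  finally show ?thesis unfolding rhs_sum by simp
qed

text \<open>Metric compatibility splits the derivative of \<open>g\<close> into \<open>A\<close> and
  \<open>B\<close>. Here \<open>B\<close> cancels the base Christoffel term of the field,
  \<open>A\<close> becomes that of the covector, and the velocity terms \<open>Gu\<close> supply the
  Schouten and metric terms.\<close>

lemma transport_omega:
  assumes b: "b < n"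
  shows "(u n * (1 + e b * \<rho>) + t * e b * u (Suc n)) * (\<Sum>k<n. g c p b k * X k) +
      t * (1 + e b * \<rho>) * (\<Sum>k<n. (\<Sum>i<n. u i * pd M c i (\<lambda>p. g c p b k) p) * X k + g c p b k * rhs k) =
    (\<Sum>i<n. \<Sum>k<n. christoffel M g c p k i b * u i * \<omega> k)
      - (\<Sum>i<n. u i * schouten M g c p i b) * (t * X (Suc n) + \<rho> * X n) - (\<Sum>i<n. u i * g c p i b) * X n"
proof -
  let ?l = "1 + e b * \<rho>"
  define GX where "GX = (\<Sum>k<n. g c p b k * X k)"
  define Gu where "Gu = (\<Sum>k<n. g c p b k * u k)"
  define A where "A = (\<Sum>i<n. \<Sum>l<n. u i * christoffel M g c p l i b * (\<Sum>k<n. g c p l k * X k))"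
  define B where "B = (\<Sum>k<n. g c p b k * (\<Sum>i<n. \<Sum>j<n. christoffel M g c p k i j * u i * X j))"
  have "(\<Sum>k<n. (\<Sum>i<n. u i * pd M c i (\<lambda>p. g c p b k) p) * X k) =
      (\<Sum>i<n. \<Sum>k<n. u i * X k * pd M c i (\<lambda>p. g c p b k) p)"
    unfolding sum_distrib_right by (subst sum.swap) (simp only: mult_ac)
  also have "\<dots> = (\<Sum>i<n. \<Sum>k<n. \<Sum>l<n. u i * X k * g c p l k * christoffel M g c p l i b) +
      (\<Sum>i<n. \<Sum>k<n. \<Sum>l<n. u i * X k * g c p b l * christoffel M g c p l i k)"
    unfolding sum.distrib[symmetric]
    by (intro sum.cong refl)
      (simp add: metric_compatibility[OF _ b] distrib_left sum_distrib_left sum.distrib mult.assoc sym[OF c p])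
  also have "(\<Sum>i<n. \<Sum>k<n. \<Sum>l<n. u i * X k * g c p l k * christoffel M g c p l i b) = A"
    unfolding A_def
    by (rule sum.cong[OF refl], subst sum.swap) (simp only: sum_distrib_left mult_ac)
  also have "(\<Sum>i<n. \<Sum>k<n. \<Sum>l<n. u i * X k * g c p b l * christoffel M g c p l i k) = B"
  proof -
    have "(\<Sum>i<n. \<Sum>k<n. \<Sum>l<n. u i * X k * g c p b l * christoffel M g c p l i k) =
        (\<Sum>i<n. \<Sum>l<n. \<Sum>k<n. u i * X k * g c p b l * christoffel M g c p l i k)"
      by (rule sum.cong[OF refl], rule sum.swap)
    also have "\<dots> = (\<Sum>l<n. \<Sum>i<n. \<Sum>k<n. u i * X k * g c p b l * christoffel M g c p l i k)"
      by (rule sum.swap)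
    also have "\<dots> = B"
      unfolding B_def by (simp only: sum_distrib_left mult_ac)
    finally show ?thesis .
  qed
  finally have S1: "(\<Sum>k<n. (\<Sum>i<n. u i * pd M c i (\<lambda>p. g c p b k) p) * X k) = A + B" .
  have "g c p b k * rhs k = - (g c p b k * (\<Sum>i<n. \<Sum>j<n. christoffel M g c p k i j * u i * X j))
      - ((g c p b k * u k) * (X n / t) + (g c p b k * X k) * (u n / t))
      - ((g c p b k * u k) * (e b / ?l * X (Suc n)) + (g c p b k * X k) * (e b / ?l * u (Suc n)))"
    if k: "k < n" for k
  proof (cases "e b = e k")
    case True
    then show ?thesis unfolding rhs_sum(1)[OF k] by (simp add: algebra_simps add_divide_distrib)
  next
    case False
    then show ?thesis using e_g[OF c p b k] by simp
  qed
  then have "(\<Sum>k<n. g c p b k * rhs k) = (\<Sum>k<n.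
      - (g c p b k * (\<Sum>i<n. \<Sum>j<n. christoffel M g c p k i j * u i * X j))
      - ((g c p b k * u k) * (X n / t) + (g c p b k * X k) * (u n / t))
      - ((g c p b k * u k) * (e b / ?l * X (Suc n)) + (g c p b k * X k) * (e b / ?l * u (Suc n))))"
    by (intro sum.cong) simp_all
  also have "\<dots> = - B - (Gu * (X n / t) + GX * (u n / t))
      - (Gu * (e b / ?l * X (Suc n)) + GX * (e b / ?l * u (Suc n)))"
    unfolding sum_subtractf sum.distrib sum_negf sum_distrib_right[symmetric] B_def Gu_def GX_def ..
  finally have S2: "(\<Sum>k<n. g c p b k * rhs k) = - B - (Gu * (X n / t) + GX * (u n / t))
      - (Gu * (e b / ?l * X (Suc n)) + GX * (e b / ?l * u (Suc n)))" .
  \<comment> \<open>The scale factor at \<open>k\<close> may be replaced by the one at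
    \<open>b\<close>, since the symbol vanishes when \<open>e k\<close> and \<open>e b\<close>
    differ.\<close>
  have *: "christoffel M g c p k i b * u i * \<omega> k =
      t * ?l * (u i * christoffel M g c p k i b * (\<Sum>j<n. g c p k j * X j))" if "i < n" "k < n" for i k
    using e_christoffel[OF that(2,1) b] \<omega>'[OF that(2)] by (cases "e k = e b") auto
  have "(\<Sum>i<n. \<Sum>k<n. christoffel M g c p k i b * u i * \<omega> k) =
      (\<Sum>i<n. \<Sum>k<n. t * ?l * (u i * christoffel M g c p k i b * (\<Sum>j<n. g c p k j * X j)))"
    by (intro sum.cong refl) (simp only: lessThan_iff *)
  also have "\<dots> = t * ?l * A"
    unfolding A_def by (simp only: sum_distrib_left)
  finally have S3: "(\<Sum>i<n. \<Sum>k<n. christoffel M g c p k i b * u i * \<omega> k) = t * ?l * A" .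
  have S4: "(\<Sum>i<n. u i * g c p i b) = Gu"
    unfolding Gu_def by (intro sum.cong) (auto simp: sym[OF c p b])
  have "u i * schouten M g c p i b = e b * (g c p b i * u i)" if i: "i < n" for i
    using e_g[OF c p i b] sym[OF c p b i] schouten[OF c p i b] by (cases "e i = e b") auto
  then have S5: "(\<Sum>i<n. u i * schouten M g c p i b) = e b * Gu"
    unfolding Gu_def sum_distrib_left by (intro sum.cong) simp_all
  have l: "?l \<noteq> 0" using factor_nz[OF \<rho> b] .
  have "(u n * ?l + t * e b * u (Suc n)) * GX + t * ?l * (A + B + (- B - (Gu * (X n / t) + GX * (u n / t))
      - (Gu * (e b / ?l * X (Suc n)) + GX * (e b / ?l * u (Suc n))))) =
      t * ?l * A - ?l * Gu * X n - t * e b * Gu * X (Suc n)"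
    using t l by (intro transport_algebra) simp_all
  \<comment> \<open>Expanding \<open>?l = 1 + e b * \<rho>\<close> frees the term that completes
    \<sigma> in the Schouten part.\<close>
  also have "\<dots> = t * ?l * A - e b * Gu * (t * X (Suc n) + \<rho> * X n) - Gu * X n"
    by (simp add: algebra_simps)
  finally show ?thesis
    unfolding sum.distrib S1 S2 S3 S4 S5 GX_def[symmetric] .
qed

end

end

text \<open>The derivative \<open>X'\<close> is left arbitrary: it is the one prescribed by
  parallelism when passing to tractors, and still unknown when passing back.\<close>

lemma covector_has_derivative:
  assumes c: "c \<in> charts M" and b: "b < n" and \<gamma>: "\<gamma> ` S \<subseteq> cdom M c" and s: "s \<in> S"
    and u: "\<And>i. i < n \<Longrightarrow> ((\<lambda>s. coord M c (\<gamma> s) i) has_real_derivative u i) (at s within S)"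
    and T: "(T has_real_derivative u n) (at s within S)"
    and R: "(R has_real_derivative u (Suc n)) (at s within S)"
    and X: "\<And>k. k < n \<Longrightarrow> ((\<lambda>s. X s k) has_real_derivative X' k) (at s within S)"
  shows "((\<lambda>s. T s * (1 + e b * R s) * (\<Sum>k<n. g c (\<gamma> s) b k * X s k)) has_real_derivative
    (u n * (1 + e b * R s) + T s * e b * u (Suc n)) * (\<Sum>k<n. g c (\<gamma> s) b k * X s k) +
    T s * (1 + e b * R s) * (\<Sum>k<n. (\<Sum>i<n. u i * pd M c i (\<lambda>p. g c p b k) (\<gamma> s)) * X s k +
      g c (\<gamma> s) b k * X' k)) (at s within S)"
proof -
  have "((\<lambda>s. g c (\<gamma> s) b k * X s k) has_real_derivative
      (\<Sum>i<n. u i * pd M c i (\<lambda>p. g c p b k) (\<gamma> s)) * X s k + g c (\<gamma> s) b k * X' k) (at s within S)"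
    if k: "k < n" for k
    using DERIV_mult'[OF differentiable_in_chartD[OF diff[OF c b k] \<gamma> s u] X[OF k]]
    by (simp add: add.commute)
  then have 1: "((\<lambda>s. \<Sum>k<n. g c (\<gamma> s) b k * X s k) has_real_derivative
      (\<Sum>k<n. (\<Sum>i<n. u i * pd M c i (\<lambda>p. g c p b k) (\<gamma> s)) * X s k + g c (\<gamma> s) b k * X' k)) (at s within S)"
    by (intro DERIV_sum) simp
  have 2: "((\<lambda>s. T s * (1 + e b * R s)) has_real_derivative
      T s * (e b * u (Suc n)) + u n * (1 + e b * R s)) (at s within S)"
    by (rule DERIV_mult'[OF T]) (auto intro!: derivative_eq_intros R)
  show ?thesis
    using DERIV_mult'[OF 2 1] by (simp add: algebra_simps)
qed

end

section \<open>One-sided derivatives on closed intervals\<close>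

lemma has_real_derivative_unique_Icc:
  fixes f :: "real \<Rightarrow> real"
  assumes "a < b" "s \<in> {a..b}" "(f has_real_derivative x) (at s within {a..b})"
    "(f has_real_derivative y) (at s within {a..b})"
  shows "x = y"
  using assms tendsto_unique[of "at s within {a..b}"] unfolding has_field_derivative_iff
  by (metis islimpt_Icc trivial_limit_within)

lemma has_real_derivative_transform:
  fixes f g :: "real \<Rightarrow> real"
  assumes "(f has_real_derivative x) (at s within S)" "s \<in> S" "\<And>r. r \<in> S \<Longrightarrow> f r = g r"
  shows "(g has_real_derivative x) (at s within S)"
  by (rule has_field_derivative_transform_within[of f x s S 1 g]) (simp_all add: assms)

lemma vector_derivative_Icc:
  fixes f :: "real \<Rightarrow> real"
  assumes "a < b" "s \<in> {a..b}" "(f has_real_derivative x) (at s within {a..b})"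
  shows "vector_derivative f (at s within {a..b}) = x"
  using assms by (intro vector_derivative_within_closed_interval)
    (simp_all add: has_real_derivative_iff_has_vector_derivative)

lemma smooth_on_interval_has_derivative:
  assumes "smooth_on_interval f a b" "a < b" "s \<in> {a..b}"
  shows "(f has_real_derivative vector_derivative f (at s within {a..b})) (at s within {a..b})"
proof -
  obtain D where "D 0 = f" "(D 0 has_real_derivative D (Suc 0) s) (at s within {a..b})"
    using assms(1,3) unfolding smooth_on_interval_def by blast
  then show ?thesis
    using vector_derivative_Icc[OF assms(2,3)] by metis
qed

lemma smooth_on_interval_const: "smooth_on_interval (\<lambda>_. k) a b"
  unfolding smooth_on_interval_def
  by (rule exI[of _ "\<lambda>j _. if j = 0 then k else 0"]) (auto intro!: derivative_eq_intros)

lemma pathin_in_topspace: "pathin X \<gamma> \<Longrightarrow> s \<in> {0..1} \<Longrightarrow> \<gamma> s \<in> topspace X"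
  unfolding pathin_def by (drule continuous_map_image_subset_topspace) auto

context split_conformal
begin

section \<open>Ambient curves, their projections and parallel fields along them\<close>

lemma topspace_ambient: "topspace (topo ambient) = topspace (topo M) \<times> {0<..} \<times> J"
  unfolding ambient_def using JD by auto

text \<open>Every ambient chart contains the whole vertical factor, so lying in a chart is a
  condition on the projected curve, and the same set of break points serves both curves.\<close>

lemma chart_segment_ambient:
  assumes "\<And>s. s \<in> {0..1} \<Longrightarrow> snd (\<Gamma> s) \<in> {0<..} \<times> J"
  shows "chart_segment ambient F \<Gamma> (c, ab) a b \<longleftrightarrow> chart_segment M F (\<lambda>s. fst (\<Gamma> s)) c a b"
proof -
  have "\<Gamma> s \<in> cdom ambient (c, ab) \<longleftrightarrow> fst (\<Gamma> s) \<in> cdom M c" if "c \<in> charts M" "s \<in> {0..1}" for s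
    using assms[OF that(2)] by (simp add: ambient_simps(3)[OF that(1)] mem_Times_iff)
  moreover have "s \<in> {0..1}" if "0 \<le> a" "b \<le> 1" "s \<in> {a..b}" for s using that by auto
  ultimately have "\<Gamma> ` {a..b} \<subseteq> cdom ambient (c, ab) \<longleftrightarrow> (\<lambda>s. fst (\<Gamma> s)) ` {a..b} \<subseteq> cdom M c"
    if "c \<in> charts M" "0 \<le> a" "b \<le> 1"
    unfolding image_subset_iff using that by (intro ball_cong refl) blast
  then show ?thesis
    unfolding chart_segment_def by (auto simp: ambient_simps(2))
qed

lemma coord_ambient:
  "i < n \<Longrightarrow> coord ambient (c, ab) x i = coord M c (fst x) i"
  "coord ambient (c, ab) x n = fst (snd x)"
  "coord ambient (c, ab) x (Suc n) = snd (snd x)"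
  by (cases x; simp add: ambient_simps(4))+

lemma ambient_curve_fibre:
  assumes "piecewise_smooth_curve ambient F \<Gamma>" "s \<in> {0..1}"
  shows "fst (\<Gamma> s) \<in> topspace (topo M)" "snd (\<Gamma> s) \<in> {0<..} \<times> J"
proof -
  have "\<Gamma> s \<in> topspace (topo ambient)"
    using assms unfolding piecewise_smooth_curve_def by (intro pathin_in_topspace) auto
  then show "fst (\<Gamma> s) \<in> topspace (topo M)" "snd (\<Gamma> s) \<in> {0<..} \<times> J"
    unfolding topspace_ambient by (simp_all add: mem_Times_iff)
qed

lemma piecewise_smooth_curve_fst:
  assumes \<Gamma>: "piecewise_smooth_curve ambient F \<Gamma>"
  shows "piecewise_smooth_curve M F (\<lambda>s. fst (\<Gamma> s))"
  unfolding piecewise_smooth_curve_def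
proof (intro conjI allI impI)
  show "finite F" using \<Gamma> unfolding piecewise_smooth_curve_def by blast
  have "pathin (topo ambient) \<Gamma>" using \<Gamma> unfolding piecewise_smooth_curve_def by blast
  then have "continuous_map (subtopology euclideanreal {0..1}) (prod_topology (topo M)
      (topo (prod_manifold (real_manifold {0<..}) (real_manifold D)))) \<Gamma>"
    unfolding pathin_def ambient_def open_submanifold_simps prod_manifold_simps(1)
      continuous_map_in_subtopology by (rule conjunct1)
  then have "continuous_map (subtopology euclideanreal {0..1}) (topo M) (fst \<circ> \<Gamma>)"
    by (rule continuous_map_fst_of)
  then show "pathin (topo M) (\<lambda>s. fst (\<Gamma> s))" by (simp add: pathin_def comp_def)
  fix c a b i assume seg: "chart_segment M F (\<lambda>s. fst (\<Gamma> s)) c a b" and i: "i < n"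
  have "chart_segment ambient F \<Gamma> (c, (), ()) a b"
    using seg chart_segment_ambient[of \<Gamma>] ambient_curve_fibre(2)[OF \<Gamma>] by blast
  then have "smooth_on_interval (\<lambda>s. coord ambient (c, (), ()) (\<Gamma> s) i) a b"
    using \<Gamma> i unfolding piecewise_smooth_curve_def ambient_simps(1) by simp
  then show "smooth_on_interval (\<lambda>s. coord M c (fst (\<Gamma> s)) i) a b"
    unfolding coord_ambient(1)[OF i] .
qed

lemma piecewise_smooth_curve_lift:
  assumes \<gamma>: "piecewise_smooth_curve M F \<gamma>" and t: "t > 0"
  shows "piecewise_smooth_curve ambient F (\<lambda>s. (\<gamma> s, t, 0))"
  unfolding piecewise_smooth_curve_def
proof (intro conjI allI impI)
  show "finite F" using \<gamma> unfolding piecewise_smooth_curve_def by blast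
  have path: "pathin (topo M) \<gamma>" using \<gamma> unfolding piecewise_smooth_curve_def by blast
  have "0 \<in> D" using J0 JD by blast
  then have "continuous_map (subtopology euclideanreal {0..1})
      (prod_topology (topo M) (prod_topology (subtopology euclideanreal {0<..}) (subtopology euclideanreal D)))
      (\<lambda>s. (\<gamma> s, t, 0))"
    using path t unfolding pathin_def by (intro continuous_map_pairedI) (auto simp: continuous_map_in_subtopology)
  moreover have "(\<lambda>s. (\<gamma> s, t, 0)) \<in> {0..1} \<rightarrow> topspace (topo M) \<times> {0<..} \<times> J"
    using pathin_in_topspace[OF path] t J0 by auto
  ultimately show "pathin (topo ambient) (\<lambda>s. (\<gamma> s, t, 0))"
    unfolding pathin_def ambient_def open_submanifold_simps prod_manifold_simps(1) real_manifold_simps(1)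
    by (auto simp: continuous_map_in_subtopology)
  fix cab a b i assume seg: "chart_segment ambient F (\<lambda>s. (\<gamma> s, t, 0)) cab a b" and i: "i < mdim ambient"
  obtain c where [simp]: "cab = (c, (), ())" by (metis old.unit.exhaust prod.exhaust)
  have "chart_segment M F \<gamma> c a b"
    using seg chart_segment_ambient[of "\<lambda>s. (\<gamma> s, t, 0)"] t J0 by simp
  then have "smooth_on_interval (\<lambda>s. coord M c (\<gamma> s) i) a b" if "i < n"
    using \<gamma> that unfolding piecewise_smooth_curve_def by simp
  moreover have "i < n \<or> i = n \<or> i = Suc n" using i ambient_simps(1) by linarith
  ultimately show "smooth_on_interval (\<lambda>s. coord ambient cab (\<gamma> s, t, 0) i) a b"
    by (auto simp: coord_ambient smooth_on_interval_const)
qed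

text \<open>The curve may move in t and \<rho>. Differentiating the three slots by the product rule
  gives the left-hand sides of \<open>transport_sigma\<close>, \<open>transport_tau\<close> and
  \<open>transport_omega\<close>, which those lemmas evaluate as the tractor equations.\<close>

lemma parallel_along_imp_tractor_parallel_along:
  assumes \<Gamma>: "piecewise_smooth_curve ambient F \<Gamma>" and V: "parallel_along ambient h F \<Gamma> V"
  shows "tractor_parallel_along M g F (\<lambda>s. fst (\<Gamma> s))
    (\<lambda>s. to_tractor (fst (\<Gamma> s)) (fst (snd (\<Gamma> s))) (snd (snd (\<Gamma> s))) (V s))"
proof -
  define \<gamma> where "\<gamma> s = fst (\<Gamma> s)" for s
  define T where "T s = fst (snd (\<Gamma> s))" for s
  define R where "R s = snd (snd (\<Gamma> s))" for s
  define W where "W s = to_tractor (\<gamma> s) (T s) (R s) (V s)" for s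
  have \<Gamma>_eq: "\<Gamma> s = (\<gamma> s, T s, R s)" for s
    by (simp add: \<gamma>_def T_def R_def)
  have fib: "\<gamma> s \<in> topspace (topo M)" "T s > 0" "R s \<in> J" if "s \<in> {0..1}" for s
    using ambient_curve_fibre[OF \<Gamma> that] by (auto simp: \<gamma>_def T_def R_def)
  have VT: "V s \<in> tangent_space ambient (\<gamma> s, T s, R s)" if "s \<in> {0..1}" for s
    using V that unfolding parallel_along_def \<Gamma>_eq by blast
  have "W s \<in> tractor_fibre M (\<gamma> s)" if "s \<in> {0..1}" for s
    unfolding W_def using to_tractor_in_fibre[OF fib(2,3) VT] that by blast
  moreover have "((\<lambda>s. fst (W s)) has_real_derivative
      (\<Sum>i<n. velocity M c \<gamma> a b s i * fst (snd (W s)) c i)) (at s within {a..b})" (is ?\<sigma>)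
    "\<And>b'. b' < n \<Longrightarrow> ((\<lambda>s. fst (snd (W s)) c b') has_real_derivative
        (\<Sum>i<n. \<Sum>k<n. christoffel M g c (\<gamma> s) k i b' * velocity M c \<gamma> a b s i * fst (snd (W s)) c k)
        - (\<Sum>i<n. velocity M c \<gamma> a b s i * schouten M g c (\<gamma> s) i b') * fst (W s)
        - (\<Sum>i<n. velocity M c \<gamma> a b s i * g c (\<gamma> s) i b') * snd (snd (W s)))
        (at s within {a..b})" (is "\<And>b'. _ \<Longrightarrow> ?\<omega> b'")
    "((\<lambda>s. snd (snd (W s))) has_real_derivative (\<Sum>i<n. \<Sum>d<n. \<Sum>k<n. velocity M c \<gamma> a b s i *
        schouten M g c (\<gamma> s) i d * inverse_matrix n (g c (\<gamma> s)) d k * fst (snd (W s)) c k))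
        (at s within {a..b})" (is ?\<tau>)
    if seg: "chart_segment M F \<gamma> c a b" and s: "s \<in> {a..b}" for c a b s
  proof -
    from seg have c: "c \<in> charts M" and ab: "0 \<le> a" "a < b" "b \<le> 1" and \<gamma>c: "\<gamma> ` {a..b} \<subseteq> cdom M c"
      unfolding chart_segment_def by auto
    have seg': "chart_segment ambient F \<Gamma> (c, (), ()) a b"
      using seg chart_segment_ambient[of \<Gamma>] ambient_curve_fibre(2)[OF \<Gamma>] unfolding \<gamma>_def by blast
    have in01: "r \<in> {0..1}" and dom: "\<gamma> r \<in> cdom M c" if "r \<in> {a..b}" for r
      using that ab \<gamma>c by auto
    define u where "u = velocity ambient (c, (), ()) \<Gamma> a b s"
    have u: "((\<lambda>s. coord ambient (c, (), ()) (\<Gamma> s) i) has_real_derivative u i) (at s within {a..b})"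
      if "i < Suc (Suc n)" for i
    proof -
      have "smooth_on_interval (\<lambda>s. coord ambient (c, (), ()) (\<Gamma> s) i) a b"
        using \<Gamma> seg' that unfolding piecewise_smooth_curve_def ambient_simps(1) by blast
      then show ?thesis
        unfolding u_def velocity_def using ab(2) s by (rule smooth_on_interval_has_derivative)
    qed
    have u_M: "velocity M c \<gamma> a b s i = u i" if "i < n" for i
      unfolding u_def velocity_def \<gamma>_def coord_ambient(1)[OF that] ..
    have vel: "(\<Sum>i<n. velocity M c \<gamma> a b s i * f i) = (\<Sum>i<n. u i * f i)"
      "(\<Sum>i<n. \<Sum>k<n. f' i k * velocity M c \<gamma> a b s i * f k) = (\<Sum>i<n. \<Sum>k<n. f' i k * u i * f k)"
      "(\<Sum>i<n. \<Sum>d<n. \<Sum>k<n. velocity M c \<gamma> a b s i * f' i d * f'' d k * f k) =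
        (\<Sum>i<n. \<Sum>d<n. \<Sum>k<n. u i * f' i d * f'' d k * f k)" for f f' f''
      by (intro sum.cong refl; simp only: u_M lessThan_iff)+
    have u\<gamma>: "((\<lambda>s. coord M c (\<gamma> s) i) has_real_derivative u i) (at s within {a..b})" if "i < n" for i
      using u[of i] that unfolding \<gamma>_def coord_ambient(1)[OF that] by simp
    have uT: "(T has_real_derivative u n) (at s within {a..b})"
      using u[of n] unfolding coord_ambient T_def by simp
    have uR: "(R has_real_derivative u (Suc n)) (at s within {a..b})"
      using u[of "Suc n"] unfolding coord_ambient R_def by simp
    define X where "X s = V s (c, (), ())" for s
    define \<omega> where "\<omega> = fst (snd (W s)) c"
    define rhs where "rhs k = - (\<Sum>i<Suc (Suc n). \<Sum>j<Suc (Suc n).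
      christoffel ambient h (c, (), ()) (\<gamma> s, T s, R s) k i j * u i * X s j)" for k
    have X: "((\<lambda>s. X s k) has_real_derivative rhs k) (at s within {a..b})" if "k < Suc (Suc n)" for k
      using V[unfolded parallel_along_def ambient_simps(1), THEN conjunct2, rule_format, OF seg' s that]
      unfolding X_def rhs_def u_def \<Gamma>_eq[symmetric] .
    have W: "fst (W r) = T r * X r (Suc n) + R r * X r n"
      "snd (snd (W r)) = X r n"
      "b' < n \<Longrightarrow> fst (snd (W r)) c b' = T r * (1 + e b' * R r) * (\<Sum>k<n. g c (\<gamma> r) b' k * X r k)"
      if "r \<in> {a..b}" for r b'
      unfolding W_def X_def
      using to_tractor_chart[OF fib(2,3)[OF in01[OF that]] VT[OF in01[OF that]] c dom[OF that]]
      by simp_all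
    note tr = transport_sigma[OF c dom[OF s] fib(2,3)[OF in01[OF s]], of \<omega> "X s" u, folded rhs_def]
      transport_tau[OF c dom[OF s] fib(2,3)[OF in01[OF s]], of \<omega> "X s" u, folded rhs_def]
      transport_omega[OF c dom[OF s] fib(2,3)[OF in01[OF s]], of \<omega> "X s" _ u, folded rhs_def]
    have \<omega>: "\<forall>b'<n. \<omega> b' = T s * (1 + e b' * R s) * (\<Sum>k<n. g c (\<gamma> s) b' k * X s k)"
      unfolding \<omega>_def by (intro allI impI W(3)[OF s])
    have "((\<lambda>s. T s * X s (Suc n) + R s * X s n) has_real_derivative (\<Sum>i<n. u i * \<omega> i)) (at s within {a..b})"
      by (rule DERIV_cong[OF DERIV_add[OF DERIV_mult'[OF uT X] DERIV_mult'[OF uR X]]])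
        (use tr(1)[OF \<omega>] in \<open>simp_all add: add.commute\<close>)
    then have "((\<lambda>s. fst (W s)) has_real_derivative (\<Sum>i<n. u i * \<omega> i)) (at s within {a..b})"
      by (rule has_real_derivative_transform[OF _ s]) (rule W(1)[symmetric])
    then show ?\<sigma>
      unfolding \<omega>_def[symmetric] vel .
    have "((\<lambda>s. snd (snd (W s))) has_real_derivative rhs n) (at s within {a..b})"
      by (rule has_real_derivative_transform[OF X s], simp, rule W(2)[symmetric])
    then show ?\<tau>
      unfolding tr(2)[OF \<omega>] \<omega>_def[symmetric] vel .
    fix b' assume b': "b' < n"
    have "((\<lambda>s. T s * (1 + e b' * R s) * (\<Sum>k<n. g c (\<gamma> s) b' k * X s k)) has_real_derivative
        (\<Sum>i<n. \<Sum>k<n. christoffel M g c (\<gamma> s) k i b' * u i * \<omega> k)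
      - (\<Sum>i<n. u i * schouten M g c (\<gamma> s) i b') * (T s * X s (Suc n) + R s * X s n)
      - (\<Sum>i<n. u i * g c (\<gamma> s) i b') * X s n) (at s within {a..b})"
      unfolding tr(3)[OF \<omega> b', symmetric]
      by (rule covector_has_derivative[OF c b' \<gamma>c s u\<gamma> uT uR X]) simp_all
    then have "((\<lambda>s. fst (snd (W s)) c b') has_real_derivative
        (\<Sum>i<n. \<Sum>k<n. christoffel M g c (\<gamma> s) k i b' * u i * \<omega> k)
      - (\<Sum>i<n. u i * schouten M g c (\<gamma> s) i b') * (T s * X s (Suc n) + R s * X s n)
      - (\<Sum>i<n. u i * g c (\<gamma> s) i b') * X s n) (at s within {a..b})"
      by (rule has_real_derivative_transform[OF _ s]) (rule W(3)[OF _ b', symmetric])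
    then show "?\<omega> b'"
      unfolding \<omega>_def[symmetric] W(1,2)[OF s] vel .
  qed
  ultimately show ?thesis
    unfolding tractor_parallel_along_def Let_def \<gamma>_def[symmetric] T_def[symmetric] R_def[symmetric]
      W_def[symmetric] by blast
qed

text \<open>Along the lift with t constant and \<rho> = 0 the vertical components follow directly
  from the equations for \<tau> and \<sigma>. For the base components, existence of a derivative
  comes first; its value is then forced by the equation for \<omega>.\<close>

lemma tractor_parallel_along_imp_parallel_along:
  assumes \<gamma>: "piecewise_smooth_curve M F \<gamma>" and t: "t > 0" and W: "tractor_parallel_along M g F \<gamma> W"
  shows "parallel_along ambient h F (\<lambda>s. (\<gamma> s, t, 0))
    (\<lambda>s. inv_into (tangent_space ambient (\<gamma> s, t, 0)) (to_tractor (\<gamma> s) t 0) (W s))"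
proof -
  define V where "V s = inv_into (tangent_space ambient (\<gamma> s, t, 0)) (to_tractor (\<gamma> s) t 0) (W s)" for s
  have top: "\<gamma> s \<in> topspace (topo M)" if "s \<in> {0..1}" for s
    using \<gamma> that unfolding piecewise_smooth_curve_def by (intro pathin_in_topspace) auto
  have fib: "W s \<in> tractor_fibre M (\<gamma> s)" if "s \<in> {0..1}" for s
    using W that unfolding tractor_parallel_along_def by blast
  have V: "V s \<in> tangent_space ambient (\<gamma> s, t, 0)" "to_tractor (\<gamma> s) t 0 (V s) = W s"
    if s: "s \<in> {0..1}" for s
  proof -
    have "W s \<in> to_tractor (\<gamma> s) t 0 ` tangent_space ambient (\<gamma> s, t, 0)"
      using bij_betw_to_tractor[OF t J0 top[OF s]] fib[OF s] unfolding bij_betw_def by simp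
    then show "V s \<in> tangent_space ambient (\<gamma> s, t, 0)" "to_tractor (\<gamma> s) t 0 (V s) = W s"
      unfolding V_def by (rule inv_into_into, rule f_inv_into_f)
  qed
  have "((\<lambda>s. V s (c, (), ()) k) has_real_derivative
      - (\<Sum>i<Suc (Suc n). \<Sum>j<Suc (Suc n). christoffel ambient h (c, (), ()) (\<gamma> s, t, 0) k i j *
          velocity ambient (c, (), ()) (\<lambda>s. (\<gamma> s, t, 0)) a b s i * V s (c, (), ()) j)) (at s within {a..b})"
    if seg': "chart_segment ambient F (\<lambda>s. (\<gamma> s, t, 0)) (c, (), ()) a b" and s: "s \<in> {a..b}"
      and k: "k < Suc (Suc n)" for c a b s k
  proof -
    have seg: "chart_segment M F \<gamma> c a b"
      using seg' chart_segment_ambient[of "\<lambda>s. (\<gamma> s, t, 0)"] t J0 by simp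
    from seg have c: "c \<in> charts M" and ab: "0 \<le> a" "a < b" "b \<le> 1" and \<gamma>c: "\<gamma> ` {a..b} \<subseteq> cdom M c"
      unfolding chart_segment_def by auto
    have in01: "r \<in> {0..1}" and dom: "\<gamma> r \<in> cdom M c" if "r \<in> {a..b}" for r
      using that ab \<gamma>c by auto
    define u where "u = velocity ambient (c, (), ()) (\<lambda>s. (\<gamma> s, t, 0)) a b s"
    have u_M: "velocity M c \<gamma> a b s i = u i" if "i < n" for i
      unfolding u_def velocity_def coord_ambient(1)[OF that] by simp
    \<comment> \<open>With no vertical velocity, the \<sigma> equation gives the \<rho> component
      after division by t.\<close>
    have u0: "u n = 0" "u (Suc n) = 0"
      unfolding u_def velocity_def coord_ambient
      by (rule vector_derivative_Icc[OF ab(2) s], simp)+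
    have vel: "(\<Sum>i<n. velocity M c \<gamma> a b s i * f i) = (\<Sum>i<n. u i * f i)"
      "(\<Sum>i<n. \<Sum>k<n. f' i k * velocity M c \<gamma> a b s i * f k) = (\<Sum>i<n. \<Sum>k<n. f' i k * u i * f k)"
      "(\<Sum>i<n. \<Sum>d<n. \<Sum>k<n. velocity M c \<gamma> a b s i * f' i d * f'' d k * f k) =
        (\<Sum>i<n. \<Sum>d<n. \<Sum>k<n. u i * f' i d * f'' d k * f k)" for f f' f''
      by (intro sum.cong refl; simp only: u_M lessThan_iff)+
    have u\<gamma>: "((\<lambda>s. coord M c (\<gamma> s) i) has_real_derivative u i) (at s within {a..b})" if i: "i < n" for i
    proof -
      have "smooth_on_interval (\<lambda>s. coord M c (\<gamma> s) i) a b"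
        using \<gamma> seg i unfolding piecewise_smooth_curve_def by blast
      then show ?thesis
        unfolding u_M[OF i, symmetric] velocity_def using ab(2) s by (rule smooth_on_interval_has_derivative)
    qed
    define X where "X s = V s (c, (), ())" for s
    define \<omega> where "\<omega> s = fst (snd (W s)) c" for s
    define rhs where "rhs k = - (\<Sum>i<Suc (Suc n). \<Sum>j<Suc (Suc n).
      christoffel ambient h (c, (), ()) (\<gamma> s, t, 0) k i j * u i * X s j)" for k
    have W_X: "fst (W r) = t * X r (Suc n)" "snd (snd (W r)) = X r n"
      "b' < n \<Longrightarrow> \<omega> r b' = t * (1 + e b' * 0) * (\<Sum>k<n. g c (\<gamma> r) b' k * X r k)"
      if "r \<in> {a..b}" for r b'
      using to_tractor_chart[OF t J0 V(1)[OF in01[OF that]] c dom[OF that]] V(2)[OF in01[OF that]]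
      unfolding \<omega>_def X_def by simp_all
    have \<omega>: "\<forall>b'<n. \<omega> s b' = t * (1 + e b' * 0) * (\<Sum>k<n. g c (\<gamma> s) b' k * X s k)"
      by (intro allI impI W_X(3)[OF s])
    note tr = transport_sigma[OF c dom[OF s] t J0, of "\<omega> s" "X s" u, folded rhs_def]
      transport_tau[OF c dom[OF s] t J0, of "\<omega> s" "X s" u, folded rhs_def]
      transport_omega[OF c dom[OF s] t J0, of "\<omega> s" "X s" _ u, folded rhs_def]
    have "\<forall>s\<in>{a..b}. let p = \<gamma> s; u = velocity M c \<gamma> a b s;
            \<sigma> = fst (W s); \<omega> = fst (snd (W s)) c; \<tau> = snd (snd (W s));
            P = schouten M g c p; ginv = inverse_matrix n (g c p)
        in
          ((\<lambda>s. fst (W s)) has_real_derivative (\<Sum>i<n. u i * \<omega> i)) (at s within {a..b}) \<and>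
          (\<forall>b'<n. ((\<lambda>s. fst (snd (W s)) c b') has_real_derivative
             (\<Sum>i<n. \<Sum>k<n. christoffel M g c p k i b' * u i * \<omega> k)
             - (\<Sum>i<n. u i * P i b') * \<sigma> - (\<Sum>i<n. u i * g c p i b') * \<tau>)
             (at s within {a..b})) \<and>
          ((\<lambda>s. snd (snd (W s))) has_real_derivative
             (\<Sum>i<n. \<Sum>d<n. \<Sum>k<n. u i * P i d * ginv d k * \<omega> k)) (at s within {a..b})"
      using W[unfolded tractor_parallel_along_def, THEN conjunct2, rule_format, OF seg] by (simp only: Let_def) blast
    from bspec[OF this s] have
      W\<sigma>: "((\<lambda>s. fst (W s)) has_real_derivative (\<Sum>i<n. u i * \<omega> s i)) (at s within {a..b})" and
      W\<omega>: "\<And>b'. b' < n \<Longrightarrow> ((\<lambda>s. \<omega> s b') has_real_derivative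
             (\<Sum>i<n. \<Sum>k<n. christoffel M g c (\<gamma> s) k i b' * u i * \<omega> s k)
             - (\<Sum>i<n. u i * schouten M g c (\<gamma> s) i b') * (t * X s (Suc n))
             - (\<Sum>i<n. u i * g c (\<gamma> s) i b') * X s n) (at s within {a..b})" and
      W\<tau>: "((\<lambda>s. snd (snd (W s))) has_real_derivative (\<Sum>i<n. \<Sum>d<n. \<Sum>k<n. u i *
          schouten M g c (\<gamma> s) i d * inverse_matrix n (g c (\<gamma> s)) d k * \<omega> s k)) (at s within {a..b})"
      unfolding Let_def vel W_X(1,2)[OF s] \<omega>_def[symmetric] by blast+
    have Xn: "((\<lambda>s. X s n) has_real_derivative rhs n) (at s within {a..b})"
      unfolding tr(2)[OF \<omega>]
      by (rule has_real_derivative_transform[OF W\<tau> s]) (rule W_X(2))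
    have "((\<lambda>s. X s (Suc n)) has_real_derivative (\<Sum>i<n. u i * \<omega> s i) / t) (at s within {a..b})"
      by (rule has_real_derivative_transform[OF DERIV_cdivide[OF W\<sigma>] s]) (use W_X(1) t in simp)
    moreover have "(\<Sum>i<n. u i * \<omega> s i) / t = rhs (Suc n)"
      using tr(1)[OF \<omega>] t unfolding u0 by (simp add: field_simps)
    ultimately have XSn: "((\<lambda>s. X s (Suc n)) has_real_derivative rhs (Suc n)) (at s within {a..b})"
      by simp
    \<comment> \<open>The components are recovered as the inverse metric applied to \<omega>/t, an
      expression with differentiable entries; its derivative is not computed.\<close>
    have "\<exists>x. ((\<lambda>s. X s k) has_real_derivative x) (at s within {a..b})" if k: "k < n" for k
    proof -
      have "(\<lambda>s. \<Sum>b'<n. inverse_matrix n (g c (\<gamma> s)) k b' * (\<omega> s b' / t)) differentiable (at s within {a..b})"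
      proof (intro differentiable_sum finite_lessThan ballI differentiable_mult inverse_matrix_differentiable)
        fix i j assume "i < n" "j < n"
        from differentiable_in_chartD[OF diff[OF c this] \<gamma>c s u\<gamma>]
        show "(\<lambda>s. g c (\<gamma> s) i j) differentiable (at s within {a..b})"
          unfolding real_differentiable_def by blast
      next
        fix b' assume "b' \<in> {..<n}"
        then show "(\<lambda>s. \<omega> s b' / t) differentiable (at s within {a..b})"
          using DERIV_cdivide[OF W\<omega>] unfolding real_differentiable_def by blast
      qed (use s k nondeg[OF c dom] in auto)
      then obtain x where "((\<lambda>s. \<Sum>b'<n. inverse_matrix n (g c (\<gamma> s)) k b' * (\<omega> s b' / t))
          has_real_derivative x) (at s within {a..b})"
        unfolding real_differentiable_def by blast
      then have "((\<lambda>s. X s k) has_real_derivative x) (at s within {a..b})"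
      proof (rule has_real_derivative_transform[OF _ s])
        fix r assume r: "r \<in> {a..b}"
        have "(\<Sum>b'<n. inverse_matrix n (g c (\<gamma> r)) k b' * (\<omega> r b' / t)) =
            (\<Sum>b'<n. inverse_matrix n (g c (\<gamma> r)) k b' * (\<Sum>k<n. g c (\<gamma> r) b' k * X r k))"
          using t by (intro sum.cong refl) (simp add: W_X(3)[OF r])
        then show "(\<Sum>b'<n. inverse_matrix n (g c (\<gamma> r)) k b' * (\<omega> r b' / t)) = X r k"
          unfolding inverse_matrix_solve(2)[OF nondeg[OF c dom[OF r]] k] .
      qed
      then show ?thesis ..
    qed
    then obtain X' where X': "k < n \<Longrightarrow> ((\<lambda>s. X s k) has_real_derivative X' k) (at s within {a..b})" for k
      by metis
    \<comment> \<open>The product rule with \<open>X'\<close> and the tractor equation, rewritten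
      with \<open>rhs\<close>, both give the derivative of \<omega>. By uniqueness
      \<open>X' - rhs\<close> lies in the kernel of the metric.\<close>
    have "(\<Sum>k<n. g c (\<gamma> s) b' k * (X' k - rhs k)) = 0" if b': "b' < n" for b'
    proof -
      let ?Y = "\<lambda>X'. (u n * (1 + e b' * 0) + t * e b' * u (Suc n)) * (\<Sum>k<n. g c (\<gamma> s) b' k * X s k) +
          t * (1 + e b' * 0) * (\<Sum>k<n. (\<Sum>i<n. u i * pd M c i (\<lambda>p. g c p b' k) (\<gamma> s)) * X s k +
            g c (\<gamma> s) b' k * X' k)"
      have "((\<lambda>s. t * (1 + e b' * 0) * (\<Sum>k<n. g c (\<gamma> s) b' k * X s k)) has_real_derivative ?Y X')
          (at s within {a..b})"
        by (rule covector_has_derivative[OF c b' \<gamma>c s u\<gamma> _ _ X']) (simp_all add: u0)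
      then have "((\<lambda>s. \<omega> s b') has_real_derivative ?Y X') (at s within {a..b})"
        by (rule has_real_derivative_transform[OF _ s]) (rule W_X(3)[OF _ b', symmetric])
      moreover have "((\<lambda>s. \<omega> s b') has_real_derivative ?Y rhs) (at s within {a..b})"
        using W\<omega>[OF b'] unfolding tr(3)[OF \<omega> b'] by simp
      ultimately have "?Y X' = ?Y rhs"
        by (rule has_real_derivative_unique_Icc[OF ab(2) s])
      then show ?thesis
        using t by (simp add: sum.distrib right_diff_distrib sum_subtractf)
    qed
    then have "X' k - rhs k = 0" if "k < n" for k
      using nondeg[OF c dom[OF s], unfolded nondegenerate_matrix_def, rule_format, of "\<lambda>k. X' k - rhs k" k]
        that by blast
    then have "((\<lambda>s. X s k) has_real_derivative rhs k) (at s within {a..b})" if "k < n" for k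
      using X'[OF that] that by simp
    moreover have "k < n \<or> k = n \<or> k = Suc n" using k by linarith
    ultimately have "((\<lambda>s. X s k) has_real_derivative rhs k) (at s within {a..b})"
      using Xn XSn by blast
    then show ?thesis unfolding X_def rhs_def u_def .
  qed
  moreover have "V s \<in> tangent_space ambient (\<gamma> s, t, 0)" if "s \<in> {0..1}" for s
    by (rule V(1)[OF that])
  ultimately show ?thesis
    unfolding parallel_along_def V_def[symmetric] ambient_simps(1)
    by (auto simp: split_paired_All)
qed

lemma holonomy_eq:
  assumes p: "p \<in> topspace (topo M)" and t: "t > 0"
  shows "(\<lambda>A. restrict (to_tractor p t 0 \<circ> A \<circ> inv_into (tangent_space ambient (p, t, 0)) (to_tractor p t 0))
      (tractor_fibre M p)) ` metric_holonomy ambient h (p, t, 0) = conformal_holonomy M g p"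
proof -
  let ?T = "tangent_space ambient (p, t, 0)" and ?\<Psi> = "to_tractor p t 0"
  let ?conj = "\<lambda>A. restrict (?\<Psi> \<circ> A \<circ> inv_into ?T ?\<Psi>) (tractor_fibre M p)"
  have inj: "inj_on ?\<Psi> ?T" and img: "?\<Psi> ` ?T = tractor_fibre M p"
    using bij_betw_to_tractor[OF t J0 p] unfolding bij_betw_def by auto
  have inv: "inv_into ?T ?\<Psi> w \<in> ?T" "?\<Psi> (inv_into ?T ?\<Psi> w) = w" if "w \<in> tractor_fibre M p" for w
    using that inv_into_into[of w ?\<Psi> ?T] f_inv_into_f[of w ?\<Psi> ?T] unfolding img by auto
  show ?thesis
  proof (intro subset_antisym subsetI)
    fix B assume "B \<in> ?conj ` metric_holonomy ambient h (p, t, 0)"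
    then obtain A F \<Gamma> where B: "B = ?conj A"
      and \<Gamma>: "piecewise_smooth_curve ambient F \<Gamma>" "\<Gamma> 0 = (p, t, 0)" "\<Gamma> 1 = (p, t, 0)"
      and A: "\<And>v. v \<in> ?T \<Longrightarrow> \<exists>V. parallel_along ambient h F \<Gamma> V \<and> V 0 = v \<and> V 1 = A v"
      unfolding metric_holonomy_def holonomy_group_def by blast
    have "\<exists>W. tractor_parallel_along M g F (\<lambda>s. fst (\<Gamma> s)) W \<and> W 0 = w \<and> W 1 = B w"
      if w: "w \<in> tractor_fibre M p" for w
    proof -
      from A[OF inv(1)[OF w]] obtain V where V: "parallel_along ambient h F \<Gamma> V"
        "V 0 = inv_into ?T ?\<Psi> w" "V 1 = A (inv_into ?T ?\<Psi> w)" by blast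
      show ?thesis
        by (rule exI, intro conjI, rule parallel_along_imp_tractor_parallel_along[OF \<Gamma>(1) V(1)])
          (simp_all add: \<Gamma>(2,3) V(2,3) inv(2)[OF w] B w)
    qed
    moreover have "B \<in> extensional (tractor_fibre M p)" unfolding B by (rule restrict_extensional)
    ultimately show "B \<in> conformal_holonomy M g p"
      using piecewise_smooth_curve_fst[OF \<Gamma>(1)] \<Gamma>(2,3)
      unfolding conformal_holonomy_def holonomy_group_def by (auto intro!: exI[of _ F] exI[of _ "\<lambda>s. fst (\<Gamma> s)"])
  next
    fix B assume "B \<in> conformal_holonomy M g p"
    then obtain F \<gamma> where ext: "B \<in> extensional (tractor_fibre M p)"
      and \<gamma>: "piecewise_smooth_curve M F \<gamma>" "\<gamma> 0 = p" "\<gamma> 1 = p"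
      and B: "\<And>w. w \<in> tractor_fibre M p \<Longrightarrow> \<exists>W. tractor_parallel_along M g F \<gamma> W \<and> W 0 = w \<and> W 1 = B w"
      unfolding conformal_holonomy_def holonomy_group_def by blast
    \<comment> \<open>Being extensional says nothing about the range; that \<open>B\<close> maps
      into the fibre comes from the end value of a parallel tractor along a loop.\<close>
    have B_fibre: "B w \<in> tractor_fibre M p" if w: "w \<in> tractor_fibre M p" for w
    proof -
      from B[OF w] obtain W where W: "tractor_parallel_along M g F \<gamma> W" "W 1 = B w" by blast
      have "W 1 \<in> tractor_fibre M (\<gamma> 1)"
        by (rule bspec[OF conjunct1[OF W(1)[unfolded tractor_parallel_along_def]]]) simp
      then show ?thesis unfolding \<gamma>(3) W(2) .
    qed
    define A where "A = restrict (inv_into ?T ?\<Psi> \<circ> B \<circ> ?\<Psi>) ?T"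
    have "\<exists>V. parallel_along ambient h F (\<lambda>s. (\<gamma> s, t, 0)) V \<and> V 0 = v \<and> V 1 = A v" if v: "v \<in> ?T" for v
    proof -
      have "?\<Psi> v \<in> tractor_fibre M p" using v img by blast
      from B[OF this] obtain W where W: "tractor_parallel_along M g F \<gamma> W" "W 0 = ?\<Psi> v" "W 1 = B (?\<Psi> v)"
        by blast
      show ?thesis
        by (rule exI, intro conjI, rule tractor_parallel_along_imp_parallel_along[OF \<gamma>(1) t W(1)])
          (simp_all add: \<gamma>(2,3) W(2,3) inv_into_f_f[OF inj v] A_def v)
    qed
    moreover have "A \<in> extensional ?T" unfolding A_def by (rule restrict_extensional)
    ultimately have "A \<in> metric_holonomy ambient h (p, t, 0)"
      using piecewise_smooth_curve_lift[OF \<gamma>(1) t] \<gamma>(2,3)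
      unfolding metric_holonomy_def holonomy_group_def
      by (auto intro!: exI[of _ F] exI[of _ "\<lambda>s. (\<gamma> s, t, 0)"])
    moreover have "B = ?conj A"
    proof (rule extensionalityI[OF ext restrict_extensional])
      fix w assume w: "w \<in> tractor_fibre M p"
      show "B w = ?conj A w"
        by (simp add: w A_def inv B_fibre)
    qed
    ultimately show "B \<in> ?conj ` metric_holonomy ambient h (p, t, 0)" by blast
  qed
qed

end

section \<open>Einstein products\<close>

lemma open_rho_domain: "open (rho_domain \<mu> m)"
  by (auto simp: rho_domain_def open_Diff)

lemma zero_in_rho_domain: "0 \<in> rho_domain \<mu> m"
  by (auto simp: rho_domain_def)

text \<open>For \<mu> nonzero the removed points are exactly the zeros of the warping factors that
  occur; the factor of the second manifold occurs only in positive dimension.\<close>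

lemma rho_domain_factor:
  assumes "\<rho> \<in> rho_domain \<mu> m"
  shows "1 + \<mu> * \<rho> \<noteq> 0" and "m \<noteq> 0 \<Longrightarrow> 1 - \<mu> * \<rho> \<noteq> 0"
proof -
  have "\<rho> = - 1 / \<mu>" if "1 + \<mu> * \<rho> = 0" "\<mu> \<noteq> 0"
  proof -
    have "\<mu> * \<rho> = - 1" using that(1) by linarith
    then show ?thesis using that(2) by (subst nonzero_eq_divide_eq) (simp_all add: mult.commute)
  qed
  then show "1 + \<mu> * \<rho> \<noteq> 0"
    using assms by (cases "\<mu> = 0") (auto simp: rho_domain_def split: if_splits)
  have "\<rho> = 1 / \<mu>" if "1 - \<mu> * \<rho> = 0" "\<mu> \<noteq> 0"
  proof -
    have "\<mu> * \<rho> = 1" using that(1) by linarith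
    then show ?thesis using that(2) by (subst nonzero_eq_divide_eq) (simp_all add: mult.commute)
  qed
  then show "1 - \<mu> * \<rho> \<noteq> 0" if "m \<noteq> 0"
    using assms that by (cases "\<mu> = 0") (auto simp: rho_domain_def split: if_splits)
qed

context product_charts
begin

lemma topspace_MN: "topspace (topo MN) = (\<Union>cd\<in>charts MN. cdom MN cd)"
proof -
  have "topspace (topo M) = (\<Union>c\<in>charts M. cdom M c)" "topspace (topo N) = (\<Union>d\<in>charts N. cdom N d)"
    using M N unfolding smooth_manifold_def by blast+
  then show ?thesis by auto
qed

lemma G_differentiable:
  assumes "c \<in> charts M" "d \<in> charts N" "i < m + n" "j < m + n"
  shows "differentiable_in_chart MN (c, d) (\<lambda>x. G (c, d) x i j)"
proof -
  have eq: "(\<lambda>x. G (c, d) x i j) = (\<lambda>x. block_diag m (g c (fst x)) (g' d (snd x)) i j)"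
    by (auto simp: fun_eq_iff product_metric_block_diag)
  show ?thesis
    unfolding eq using assms(3,4)
    by (elim less_add_cases)
      (simp_all add: differentiable_in_chart_fst[OF regM regN assms(1,2)
          pseudo_riemannian_differentiable[OF M g assms(1)]]
        differentiable_in_chart_snd[OF regM regN assms(1,2)
          pseudo_riemannian_differentiable[OF N g' assms(2)]])
qed

lemma jac_MN:
  assumes "c \<in> charts M" "d \<in> charts N" "p \<in> cdom M c" "q \<in> cdom N d" "k < m + n" "j < m + n"
  shows "jac MN (c, d) (c', d') (p, q) k j = block_diag m (jac M c c' p) (jac N d d' q) k j"
  using assms by (simp add: jac_prod_manifold[OF regM regN] block_diag_def)

lemma G_transform:
  assumes c: "c \<in> charts M" "p \<in> cdom M c" "c' \<in> charts M" "p \<in> cdom M c'"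
    and d: "d \<in> charts N" "q \<in> cdom N d" "d' \<in> charts N" "q \<in> cdom N d'"
    and ij: "i < m + n" "j < m + n"
  shows "G (c, d) (p, q) i j = (\<Sum>k<m + n. \<Sum>l<m + n.
    jac MN (c, d) (c', d') (p, q) k i * jac MN (c, d) (c', d') (p, q) l j * G (c', d') (p, q) k l)"
  using ij
  by (elim less_add_cases)
    (simp_all add: product_metric_block_diag sum_lessThan_add jac_MN[OF c(1) d(1) c(2) d(2)]
      pseudo_riemannian_transform[OF g c] pseudo_riemannian_transform[OF g' d])

end

text \<open>A connected set projects to a connected set of \<rho>-values, which contains 0.
  Conversely a point is joined to \<Q> vertically, with \<open>p\<close> and \<open>t\<close> fixed,
  so the components are decided by \<rho> alone.\<close>

lemma connected_component_of_Q:
  fixes X :: "'a topology" and D :: "real set"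
  assumes "0 \<in> D"
  shows "{x. \<exists>p t. connected_component_of (prod_topology X (prod_topology
      (subtopology euclideanreal {0<..}) (subtopology euclideanreal D))) (p, t, 0) x} =
    topspace X \<times> {0<..} \<times> connected_component_set D 0" (is "{x. \<exists>p t. connected_component_of ?Y (p, t, 0) x} = _")
proof (intro subset_antisym subsetI)
  fix x assume "x \<in> {x. \<exists>p t. connected_component_of ?Y (p, t, 0) x}"
  then obtain p t S where S: "connectedin ?Y S" "(p, t, 0) \<in> S" "x \<in> S"
    unfolding connected_component_of_def by blast
  have x: "x \<in> topspace X \<times> {0<..} \<times> D"
    using connectedin_subset_topspace[OF S(1)] S(3) by auto
  have "continuous_map ?Y (subtopology euclideanreal D) (\<lambda>x. snd (snd x))"
    using continuous_map_snd_of[OF continuous_map_snd, unfolded comp_def] .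
  from connectedin_continuous_map_image[OF this S(1)]
  have "connected ((\<lambda>x. snd (snd x)) ` S)" "(\<lambda>x. snd (snd x)) ` S \<subseteq> D"
    by (auto simp: connectedin_subtopology)
  moreover have "0 \<in> (\<lambda>x. snd (snd x)) ` S" "snd (snd x) \<in> (\<lambda>x. snd (snd x)) ` S"
    using S(2,3) by force+
  ultimately have "connected_component D 0 (snd (snd x))"
    unfolding connected_component_def by blast
  with x show "x \<in> topspace X \<times> {0::real<..} \<times> connected_component_set D 0"
    by (auto simp: mem_Times_iff)
next
  fix x assume "x \<in> topspace X \<times> {0::real<..} \<times> connected_component_set D 0"
  then obtain p t \<rho> where [simp]: "x = (p, t, \<rho>)" and p: "p \<in> topspace X" and t: "t > 0"
    and \<rho>: "\<rho> \<in> connected_component_set D 0"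
    by auto
  have "connectedin ?Y ({p} \<times> {t} \<times> connected_component_set D 0)"
    using p t connected_component_subset[of D 0]
    by (auto simp: connectedin_Times connectedin_subtopology)
  moreover have "0 \<in> connected_component_set D 0" using assms by simp
  ultimately have "connected_component_of ?Y (p, t, 0) x"
    unfolding connected_component_of_def using \<rho> by (intro exI conjI) auto
  then show "x \<in> {x. \<exists>p t. connected_component_of ?Y (p, t, 0) x}" by blast
qed

theorem theorem6p4:
  fixes M\<^sub>1 :: "('i, 'a) manifold" and M\<^sub>2 :: "('j, 'b) manifold"
    and g\<^sub>1 :: "('i, 'a) metric" and g\<^sub>2 :: "('j, 'b) metric"
    and m\<^sub>1 m\<^sub>2 :: nat and S\<^sub>1 S\<^sub>2 \<mu> :: real
  assumes "smooth_manifold M\<^sub>1" and "mdim M\<^sub>1 = m\<^sub>1" and "pseudo_riemannian M\<^sub>1 g\<^sub>1"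
    and "smooth_manifold M\<^sub>2" and "mdim M\<^sub>2 = m\<^sub>2" and "pseudo_riemannian M\<^sub>2 g\<^sub>2"
    and "m\<^sub>1 \<ge> 1" and "m\<^sub>1 + m\<^sub>2 \<ge> 3"
    and "m\<^sub>2 = 0 \<Longrightarrow> \<exists>x. topspace (topo M\<^sub>2) = {x}"
    and "einstein M\<^sub>1 g\<^sub>1 S\<^sub>1" and "einstein M\<^sub>2 g\<^sub>2 S\<^sub>2"
    and "real m\<^sub>2 * (real m\<^sub>2 - 1) * S\<^sub>1 = - (real m\<^sub>1 * (real m\<^sub>1 - 1) * S\<^sub>2)"
    and "2 * real m\<^sub>1 * (real m\<^sub>1 - 1) * \<mu> = S\<^sub>1"
    and "2 * real m\<^sub>2 * (real m\<^sub>2 - 1) * \<mu> = - S\<^sub>2"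
  shows "\<forall>p \<in> topspace (topo (prod_manifold M\<^sub>1 M\<^sub>2)). \<forall>t>0.
    (let M = prod_manifold M\<^sub>1 M\<^sub>2;
         g = product_metric M\<^sub>1 M\<^sub>2 g\<^sub>1 g\<^sub>2;
         N = Q_component M\<^sub>1 M\<^sub>2 \<mu>;
         h = ambient_metric M\<^sub>1 M\<^sub>2 g\<^sub>1 g\<^sub>2 \<mu>;
         \<Psi> = ambient_to_tractor M g p t
     in bij_betw \<Psi> (tangent_space N (p, t, 0)) (tractor_fibre M p) \<and>
        (\<lambda>A. restrict (\<Psi> \<circ> A \<circ> inv_into (tangent_space N (p, t, 0)) \<Psi>) (tractor_fibre M p))
          ` metric_holonomy N h (p, t, 0)
        = conformal_holonomy M g p)"
proof -
  let ?M = "prod_manifold M\<^sub>1 M\<^sub>2" and ?g = "product_metric M\<^sub>1 M\<^sub>2 g\<^sub>1 g\<^sub>2"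
  \<comment> \<open>For \<mu> = 0 the two eigenvalues coincide, and the conditions on indices with
    different eigenvalues become vacuous.\<close>
  define e where "e i = (if i < m\<^sub>1 then \<mu> else - \<mu>)" for i
  define D where "D = rho_domain \<mu> m\<^sub>2"
  define J where "J = connected_component_set D 0"
  have D0: "0 \<in> D" unfolding D_def by (rule zero_in_rho_domain)
  interpret P: product_charts M\<^sub>1 M\<^sub>2 g\<^sub>1 g\<^sub>2
    using assms(1,3,4,6) by unfold_locales
  note dims = assms(2,5)
  have e: "e i = \<mu>" if "i < m\<^sub>1" for i
    using that by (simp add: e_def)
  have e_right: "e (m\<^sub>1 + j) = - \<mu>" for j by (simp add: e_def)
  have schouten: "schouten ?M ?g (c, d) (p, q) i j = e i * ?g (c, d) (p, q) i j"
    if c: "c \<in> charts M\<^sub>1" "p \<in> cdom M\<^sub>1 c" and d: "d \<in> charts M\<^sub>2" "q \<in> cdom M\<^sub>2 d"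
      and ij: "i < m\<^sub>1 + m\<^sub>2" "j < m\<^sub>1 + m\<^sub>2" for c d p q i j
  proof -
    have S: "scalar_curvature M\<^sub>1 g\<^sub>1 c p = S\<^sub>1" "scalar_curvature M\<^sub>2 g\<^sub>2 d q = S\<^sub>2"
      using assms(10,11) c d unfolding einstein_def by auto
    have Ric1: "ricci M\<^sub>1 g\<^sub>1 c p i j = 2 * (real m\<^sub>1 - 1) * \<mu> * g\<^sub>1 c p i j" if "i < m\<^sub>1" "j < m\<^sub>1" for i j
    proof -
      have "ricci M\<^sub>1 g\<^sub>1 c p i j = S\<^sub>1 / real m\<^sub>1 * g\<^sub>1 c p i j"
        using assms(10) c that unfolding einstein_def dims S by (metis S(1))
      \<comment> \<open>Dividing by the dimension is legitimate because an index below it is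
        given.\<close>
      moreover have "S\<^sub>1 / real m\<^sub>1 = 2 * (real m\<^sub>1 - 1) * \<mu>"
        using assms(13) that by (simp add: field_simps)
      ultimately show ?thesis by simp
    qed
    have Ric2: "ricci M\<^sub>2 g\<^sub>2 d q i j = - (2 * (real m\<^sub>2 - 1) * \<mu>) * g\<^sub>2 d q i j" if "i < m\<^sub>2" "j < m\<^sub>2" for i j
    proof -
      have "ricci M\<^sub>2 g\<^sub>2 d q i j = S\<^sub>2 / real m\<^sub>2 * g\<^sub>2 d q i j"
        using assms(11) d that unfolding einstein_def dims S by (metis S(2))
      moreover have "S\<^sub>2 = - (2 * real m\<^sub>2 * (real m\<^sub>2 - 1) * \<mu>)"
        using assms(14) by linarith
      then have "S\<^sub>2 / real m\<^sub>2 = - (2 * (real m\<^sub>2 - 1) * \<mu>)"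
        using that by (simp add: field_simps)
      ultimately show ?thesis by simp
    qed
    \<comment> \<open>Based on \<open>m\<^sub>1 (m\<^sub>1 - 1) - m\<^sub>2 (m\<^sub>2 - 1) =
      (m\<^sub>1 - m\<^sub>2) (m\<^sub>1 + m\<^sub>2 - 1)\<close>; the last factor cancels the
      denominator in the Schouten tensor.\<close>
    have "S\<^sub>1 + S\<^sub>2 = 2 * (real m\<^sub>1 + real m\<^sub>2 - 1) * ((real m\<^sub>1 - real m\<^sub>2) * \<mu>)"
      using assms(13,14) by (simp add: algebra_simps)
    moreover have "real m\<^sub>1 + real m\<^sub>2 - 1 \<noteq> 0" using assms(8) by linarith
    ultimately have Sc: "(S\<^sub>1 + S\<^sub>2) / (2 * (real (m\<^sub>1 + m\<^sub>2) - 1)) = (real m\<^sub>1 - real m\<^sub>2) * \<mu>"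
      by simp
    have n2: "real (m\<^sub>1 + m\<^sub>2) - 2 \<noteq> 0" using assms(8) by linarith
    have schouten_eq: "schouten ?M ?g (c, d) (p, q) i j = (ricci ?M ?g (c, d) (p, q) i j -
        (real m\<^sub>1 - real m\<^sub>2) * \<mu> * ?g (c, d) (p, q) i j) / (real (m\<^sub>1 + m\<^sub>2) - 2)"
      unfolding schouten_def P.scalar_curvature_MN[OF c(1) d(1) c(2) d(2)] S prod_manifold_simps dims Sc ..
    have *: "ricci ?M ?g (c, d) (p, q) i j = block_diag m\<^sub>1 (ricci M\<^sub>1 g\<^sub>1 c p) (ricci M\<^sub>2 g\<^sub>2 d q) i j"
      using P.ricci_MN[OF c(1) d(1) c(2) d(2)] ij unfolding dims by simp
    have **: "?g (c, d) (p, q) = block_diag m\<^sub>1 (g\<^sub>1 c p) (g\<^sub>2 d q)"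
      unfolding product_metric_block_diag dims ..
    \<comment> \<open>With \<open>n = m\<^sub>1 + m\<^sub>2\<close> the coefficients of \<mu> are
      \<open>2 (m\<^sub>1 - 1) - (m\<^sub>1 - m\<^sub>2) = n - 2\<close> and
      \<open>- 2 (m\<^sub>2 - 1) - (m\<^sub>1 - m\<^sub>2) = - (n - 2)\<close>: division by
      \<open>n - 2\<close> leaves the eigenvalues \<mu> and -\<mu>.\<close>
    show ?thesis
      unfolding schouten_eq divide_eq_eq * **
      using ij n2 by (elim less_add_cases) (simp_all add: Ric1 Ric2 e e_right, simp_all add: algebra_simps)
  qed
  interpret A: split_conformal ?M ?g e D J
  proof
    show "regular_atlas ?M" by (rule P.regMN)
    show "topspace (topo ?M) = (\<Union>c\<in>charts ?M. cdom ?M c)" by (rule P.topspace_MN)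
    show "open D" unfolding D_def by (rule open_rho_domain)
    then show "open J" unfolding J_def by (rule open_connected_component)
    show "J \<subseteq> D" unfolding J_def by (rule connected_component_subset)
    show "0 \<in> J" unfolding J_def using D0 by simp
    show "1 + e i * \<rho> \<noteq> 0" if "\<rho> \<in> J" "i < mdim ?M" for \<rho> i
    proof -
      have "\<rho> \<in> rho_domain \<mu> m\<^sub>2"
        using that(1) connected_component_subset[of D 0] unfolding J_def D_def by blast
      from rho_domain_factor[OF this] that(2) show ?thesis
        unfolding e_def prod_manifold_simps dims by auto
    qed
    fix cd pq assume cd: "cd \<in> charts ?M" and pq: "pq \<in> cdom ?M cd"
    obtain c d p q where [simp]: "cd = (c, d)" "pq = (p, q)" by (metis prod.exhaust)
    have c: "c \<in> charts M\<^sub>1" "p \<in> cdom M\<^sub>1 c" and d: "d \<in> charts M\<^sub>2" "q \<in> cdom M\<^sub>2 d"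
      using cd pq by simp_all
    note nd = pseudo_riemannian_nondegenerate[OF assms(3) c] pseudo_riemannian_nondegenerate[OF assms(6) d]
    show "nondegenerate_matrix (mdim ?M) (?g cd pq)"
      using nondegenerate_block_diag[OF nd] by (simp add: product_metric_block_diag)
    show "?g cd pq i j = ?g cd pq j i" if "i < mdim ?M" "j < mdim ?M" for i j
      using that unfolding prod_manifold_simps
      by (elim less_add_cases) (simp_all add: product_metric_block_diag
        pseudo_riemannian_sym[OF assms(3) c] pseudo_riemannian_sym[OF assms(6) d])
    show "?g cd pq i j = 0" if "i < mdim ?M" "j < mdim ?M" "e i \<noteq> e j" for i j
      using that unfolding prod_manifold_simps dims
      by (elim less_add_cases) (simp_all add: product_metric_block_diag e e_right dims)
    show "inverse_matrix (mdim ?M) (?g cd pq) i j = 0" if "i < mdim ?M" "j < mdim ?M" "e i \<noteq> e j" for i j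
      using that unfolding prod_manifold_simps dims
      by (elim less_add_cases) (simp_all add: product_metric_block_diag dims e e_right
        P.inverse_G[OF c(1) d(1) c(2) d(2), unfolded dims])
    show "pd ?M cd l (\<lambda>p. ?g cd p i j) pq = 0"
      if "i < mdim ?M" "j < mdim ?M" "l < mdim ?M" "e l \<noteq> e i \<or> e i \<noteq> e j" for i j l
    proof -
      note ijl = that(1-3)[unfolded prod_manifold_simps dims]
      \<comment> \<open>Different eigenvalues force the indices into different factors, where the
        pattern is 0 whatever the blocks are.\<close>
      have "block_diag3 m\<^sub>1 A B l i j = 0" for A B
        using ijl that(4) by (elim less_add_cases) (simp_all add: e e_right)
      with P.pd_G[OF c(1) d(1) c(2) d(2), unfolded dims, OF ijl(3,1,2)] show ?thesis by simp
    qed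
    show "schouten ?M ?g cd pq i j = e i * ?g cd pq i j" if "i < mdim ?M" "j < mdim ?M" for i j
      using schouten[OF c d] that unfolding prod_manifold_simps dims by simp
    fix cd' assume cd': "cd' \<in> charts ?M" and pq': "pq \<in> cdom ?M cd'"
    obtain c' d' where [simp]: "cd' = (c', d')" by (metis prod.exhaust)
    have c': "c' \<in> charts M\<^sub>1" "p \<in> cdom M\<^sub>1 c'" and d': "d' \<in> charts M\<^sub>2" "q \<in> cdom M\<^sub>2 d'"
      using cd' pq' by simp_all
    show "?g cd pq i j = (\<Sum>k<mdim ?M. \<Sum>l<mdim ?M. jac ?M cd cd' pq k i * jac ?M cd cd' pq l j * ?g cd' pq k l)"
      if "i < mdim ?M" "j < mdim ?M" for i j
      using P.G_transform[OF c c' d d'] that by simp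
    show "jac ?M cd cd' pq i j = 0" if "i < mdim ?M" "j < mdim ?M" "e i \<noteq> e j" for i j
    proof -
      note ij = that(1,2)[unfolded prod_manifold_simps dims]
      have "block_diag m\<^sub>1 A B i j = 0" for A B
        using ij that(3) by (elim less_add_cases) (simp_all add: e e_right)
      with P.jac_MN[OF c(1) d(1) c(2) d(2), unfolded dims, OF ij] show ?thesis by simp
    qed
  next
    fix cd i j assume "cd \<in> charts ?M" "i < mdim ?M" "j < mdim ?M"
    then show "differentiable_in_chart ?M cd (\<lambda>p. ?g cd p i j)"
      by (cases cd) (simp add: P.G_differentiable)
  qed
  have N: "Q_component M\<^sub>1 M\<^sub>2 \<mu> = A.ambient"
    unfolding A.ambient_def
    unfolding Q_component_def ambient_manifold_def dims D_def[symmetric] J_def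
      prod_manifold_simps(1) real_manifold_simps(1) connected_component_of_Q[OF D0] ..
  have h: "ambient_metric M\<^sub>1 M\<^sub>2 g\<^sub>1 g\<^sub>2 \<mu> = A.h"
  proof (intro ext)
    fix cab :: "('i \<times> 'j) ambient_label" and x :: "('a \<times> 'b) ambient_point" and i j
    obtain c d ab where [simp]: "cab = ((c, d), ab)" by (metis prod.exhaust)
    obtain p q t \<rho> where [simp]: "x = ((p, q), t, \<rho>)" by (metis prod.exhaust)
    \<comment> \<open>For two indices of one factor the product of the scale factors is the square
      in \<open>ambient_metric\<close>; entries mixing the factors are 0 on both sides.\<close>
    show "ambient_metric M\<^sub>1 M\<^sub>2 g\<^sub>1 g\<^sub>2 \<mu> cab x i j = A.h cab x i j"
      unfolding A.h_def
      by (cases "i < m\<^sub>1"; cases "j < m\<^sub>1")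
        (simp_all add: ambient_metric_def Let_def product_metric_def e_def dims power2_eq_square)
  qed
  show ?thesis
    unfolding Let_def N h A.to_tractor_0[symmetric]
    by (intro ballI allI impI conjI A.bij_betw_to_tractor A.J0 A.holonomy_eq)
qed

end
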